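(* There is an algorithm that, given a digraph $D$ with $n$ vertices that contains no $2$-cycle and an integer $k$, decides whether $D$ has a geodetic set of size $k$ in time $2^{\mathcal{O}(\mathsf{fen})}\cdot n^{\mathcal{O}(1)}$, where $\mathsf{fen}$ is the feedback edge set number of the underlying undirected graph of $D$.
   Context: All digraphs are finite, without loops or parallel arcs. A $2$-cycle in a digraph is a pair of vertices $u,v$ such that both arcs $uv$ and $vu$ are present. The underlying undirected graph of a digraph is obtained by forgetting the orientations of the arcs (and deleting parallel edges). The feedback edge set number of an undirected graph $G$ is the minimum number of edges whose deletion from $G$ yields a forest. For vertices $u,v$ of a digraph $D$, $I(u,v)$ denotes the set of vertices lying on some shortest directed path from $u$ to $v$; for $S\subseteq V(D)$, $I(S)=\bigcup_{u,v\in S}(I(u,v)\cup I(v,u))$. A set $S\subseteq V(D)$ is a geodetic set of $D$ if $I(S)=V(D)$. The problem Geodetic Set asks, given a digraph $D$ and integer $k$, whether there is a geodetic set of $D$ of size $k$. *)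

theory Defs
  imports Main
begin

definition digraph :: "nat \<Rightarrow> (nat \<times> nat) set \<Rightarrow> bool" where
  "digraph n A \<longleftrightarrow> A \<subseteq> {0..<n} \<times> {0..<n} \<and> (\<forall>v. (v, v) \<notin> A)"

definition no_2cycle :: "(nat \<times> nat) set \<Rightarrow> bool" where
  "no_2cycle A \<longleftrightarrow> (\<forall>u v. (u, v) \<in> A \<longrightarrow> (v, u) \<notin> A)"

definition dwalk :: "(nat \<times> nat) set \<Rightarrow> nat list \<Rightarrow> bool" where
  "dwalk A xs \<longleftrightarrow> xs \<noteq> [] \<and> (\<forall>i. Suc i < length xs \<longrightarrow> (xs ! i, xs ! Suc i) \<in> A)"

definition shortest_dpath :: "(nat \<times> nat) set \<Rightarrow> nat \<Rightarrow> nat \<Rightarrow> nat list \<Rightarrow> bool" where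
  "shortest_dpath A u v xs \<longleftrightarrow>
     dwalk A xs \<and> hd xs = u \<and> last xs = v \<and>
     (\<forall>ys. dwalk A ys \<and> hd ys = u \<and> last ys = v \<longrightarrow> length xs \<le> length ys)"

definition interval :: "(nat \<times> nat) set \<Rightarrow> nat \<Rightarrow> nat \<Rightarrow> nat set" where
  "interval A u v = {w. \<exists>xs. shortest_dpath A u v xs \<and> w \<in> set xs}"

definition interval_set :: "(nat \<times> nat) set \<Rightarrow> nat set \<Rightarrow> nat set" where
  "interval_set A S = (\<Union>u\<in>S. \<Union>v\<in>S. interval A u v \<union> interval A v u)"

definition geodetic_set :: "nat \<Rightarrow> (nat \<times> nat) set \<Rightarrow> nat set \<Rightarrow> bool" where
  "geodetic_set n A S \<longleftrightarrow> S \<subseteq> {0..<n} \<and> interval_set A S = {0..<n}"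

definition has_geodetic_set_of_size :: "nat \<Rightarrow> (nat \<times> nat) set \<Rightarrow> nat \<Rightarrow> bool" where
  "has_geodetic_set_of_size n A k \<longleftrightarrow> (\<exists>S. geodetic_set n A S \<and> card S = k)"

definition underlying_edges :: "(nat \<times> nat) set \<Rightarrow> nat set set" where
  "underlying_edges A = {{u, v} | u v. (u, v) \<in> A}"

definition ucycle :: "nat set set \<Rightarrow> nat list \<Rightarrow> bool" where
  "ucycle E xs \<longleftrightarrow> 3 \<le> length xs \<and> distinct xs \<and>
     (\<forall>i < length xs. {xs ! i, xs ! ((Suc i) mod length xs)} \<in> E)"

definition forest :: "nat set set \<Rightarrow> bool" where
  "forest E \<longleftrightarrow> \<not> (\<exists>xs. ucycle E xs)"

definition feedback_edge_set_number :: "nat set set \<Rightarrow> nat" where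
  "feedback_edge_set_number E = (LEAST m. \<exists>F. F \<subseteq> E \<and> card F = m \<and> forest (E - F))"

section \<open>Machine model: unit-cost RAM with addition, subtraction, indirect addressing\<close>

datatype instr =
    Const nat nat
  | Add nat nat nat
  | Sub nat nat nat
  | Load nat nat
  | Store nat nat
  | Jz nat nat

type_synonym conf = "nat \<times> (nat \<Rightarrow> nat)"

fun exec :: "instr \<Rightarrow> nat \<Rightarrow> (nat \<Rightarrow> nat) \<Rightarrow> conf" where
  "exec (Const r c) pc m = (Suc pc, m(r := c))"
| "exec (Add r a b) pc m = (Suc pc, m(r := m a + m b))"
| "exec (Sub r a b) pc m = (Suc pc, m(r := m a - m b))"
| "exec (Load r a) pc m = (Suc pc, m(r := m (m a)))"
| "exec (Store a r) pc m = (Suc pc, m(m a := m r))"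
| "exec (Jz r t) pc m = (if m r = 0 then t else Suc pc, m)"

definition step :: "instr list \<Rightarrow> conf \<Rightarrow> conf" where
  "step P c = (if length P \<le> fst c then c else exec (P ! fst c) (fst c) (snd c))"

definition halted :: "instr list \<Rightarrow> conf \<Rightarrow> bool" where
  "halted P c \<longleftrightarrow> length P \<le> fst c"

definition run :: "instr list \<Rightarrow> nat \<Rightarrow> conf \<Rightarrow> conf" where
  "run P t c = (step P ^^ t) c"

definition input_mem :: "nat \<Rightarrow> nat \<Rightarrow> (nat \<times> nat) list \<Rightarrow> nat \<Rightarrow> nat" where
  "input_mem n k as j =
     (if j = 0 then n else if j = 1 then k else if j = 2 then length as
      else if j < 3 + 2 * length as then
        (if even (j - 3) then fst (as ! ((j - 3) div 2)) else snd (as ! ((j - 3) div 2)))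
      else 0)"

end

theory Submission
  imports Defs
begin

text \<open>
  A bridge is an arc whose removal disconnects its ends in the underlying graph. Every geodetic set
  contains a vertex that reaches the tail of the bridge and a vertex reachable from its head, and
  shortest walks through the bridge split there. So the bridges can be deleted if their heads are
  added as free starting points P and their tails as free end points Q; this also handles all trees
  hanging off the digraph.

  In the remaining digraph, call a vertex of in-degree and out-degree one a through vertex. Through
  vertices form chains and cycles, and a walk entering (leaving) a chain passes its first (last)
  vertex. Exchange arguments show that some optimal solution meets every chain next to a vertex of
  degree at least 3 only in its first vertex, its last vertex, or one pivot, which lies just before
  an element of P or just after an element of Q. On all other chains and on cycles an optimal choice
  can be made greedily. Vertices without in-arc or without out-arc are forced or useless. Since
  every vertex on a non-bridge has degree at least 2, the sum of deg(v) - 2 is at most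
  twice the feedback edge set number, which bounds the number of remaining candidates linearly, and
  all sets of candidates are tested.
\<close>

section \<open>Shortest walks\<close>

text \<open>The obstacle on a chain is that its last vertex may reach its first one again through
  the rest of the digraph. A walk between two chain vertices then either follows the chain or leaves
  at the last vertex and returns at the first one. If such a return exists and a free start
  \<open>p\<close> in \<open>P\<close> lies on the chain behind its first vertex, the walk from
  \<open>p\<close> around to the vertex just before \<open>p\<close> covers the whole chain, so one
  chosen vertex does the work of two; this is why a pivot is needed besides the two ends. Otherwise
  a single chosen vertex can be pushed to one end. Which pivot is used is fixed by the order of the
  vertices, independently of the solution, so a chain contributes at most three candidates. Size
  exactly \<open>k\<close> and size at most \<open>k\<close> agree for \<open>k \<le> n\<close>,
  since covering is monotone in the chosen set; hence minimum solutions suffice. The absence of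
  2-cycles enters where arcs are counted: arcs and underlying edges are then in bijection. The
  program is written in a loop language whose cost is measured in machine steps; its loops run n
  times each, except for the one over the sets of candidates.\<close>

definition btw :: "('a \<times> 'a) set \<Rightarrow> 'a \<Rightarrow> 'a \<Rightarrow> 'a \<Rightarrow> bool" where
  "btw A s w t \<longleftrightarrow> (\<exists>i j. (s, w) \<in> A ^^ i \<and> (w, t) \<in> A ^^ j \<and> (\<forall>k. (s, t) \<in> A ^^ k \<longrightarrow> i + j \<le> k))"

text \<open>An unavoidable vertex \<open>e\<close>: the splitting is asked of walks of every length,
  not only of shortest ones, so distances from \<open>s\<close> to \<open>t\<close> add up at
  \<open>e\<close>. An unreachable \<open>t\<close> satisfies the condition vacuously, which saves
  case distinctions.\<close>

definition via :: "('a \<times> 'a) set \<Rightarrow> 'a \<Rightarrow> 'a \<Rightarrow> 'a \<Rightarrow> bool" where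
  "via A s e t \<longleftrightarrow> (\<forall>k. (s, t) \<in> A ^^ k \<longrightarrow>
     (\<exists>k1 k2. k = k1 + k2 \<and> (s, e) \<in> A ^^ k1 \<and> (e, t) \<in> A ^^ k2))"

lemma relpow_trans:
  fixes A :: "('a \<times> 'a) set"
  shows "(x, y) \<in> A ^^ i \<Longrightarrow> (y, z) \<in> A ^^ j \<Longrightarrow> (x, z) \<in> A ^^ (i + j)"
  by (auto simp: relpow_add)

lemma relpow_converse:
  fixes A :: "('a \<times> 'a) set"
  shows "(y, x) \<in> (A\<inverse>) ^^ k \<longleftrightarrow> (x, y) \<in> A ^^ k"
proof (induction k arbitrary: x y)
  case (Suc k)
  have "(y, x) \<in> (A\<inverse>) ^^ Suc k \<longleftrightarrow> (\<exists>z. (z, y) \<in> A \<and> (x, z) \<in> A ^^ k)"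
    by (metis Suc converse_iff relpow_Suc_D2 relpow_Suc_I2)
  then show ?case by auto
qed auto

lemma shortest_walkE:
  assumes "(x, y) \<in> A\<^sup>*"
  obtains i where "(x, y) \<in> A ^^ i" "\<And>k. (x, y) \<in> A ^^ k \<Longrightarrow> i \<le> k"
proof -
  obtain k where "(x, y) \<in> A ^^ k" using assms rtrancl_power by blast
  then show thesis
    using that[of "LEAST i. (x, y) \<in> A ^^ i"] by (metis (mono_tags, lifting) LeastI Least_le)
qed

lemma btw_converse: "btw (A\<inverse>) t w s \<longleftrightarrow> btw A s w t"
proof -
  have "btw (A\<inverse>) t w s" if "btw A s w t" for A :: "('a \<times> 'a) set" and s w t
    using that unfolding btw_def relpow_converse by (metis (no_types, lifting) add.commute)
  from this[of A s w t] this[of "A\<inverse>" t w s] show ?thesis by auto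
qed

lemma via_converse: "via (A\<inverse>) t e s \<longleftrightarrow> via A s e t"
proof -
  have "via (A\<inverse>) t e s" if "via A s e t" for A :: "('a \<times> 'a) set" and s e t
    using that unfolding via_def relpow_converse by (metis add.commute)
  from this[of A s e t] this[of "A\<inverse>" t e s] show ?thesis by auto
qed

lemma btw_reach: "btw A s w t \<Longrightarrow> (s, w) \<in> A\<^sup>* \<and> (w, t) \<in> A\<^sup>*"
  unfolding btw_def using relpow_imp_rtrancl by blast

lemma btw_start: "(s, t) \<in> A\<^sup>* \<Longrightarrow> btw A s s t"
  by (erule shortest_walkE) (metis add_0 btw_def relpow_0_I)

lemma btw_end: "(s, t) \<in> A\<^sup>* \<Longrightarrow> btw A s t t"
  using btw_start[of t s "A\<inverse>"] by (simp add: btw_converse rtrancl_converse)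

lemma btw_same: "btw A s w s \<longleftrightarrow> w = s"
proof
  assume "btw A s w s"
  then show "w = s" by (auto simp: btw_def dest!: spec[of _ 0])
qed (auto intro: btw_start)

text \<open>The part up to \<open>w\<close> can be cut at the unavoidable \<open>e\<close>, and a
  suffix of a shortest walk is shortest: a shorter walk from \<open>e\<close> to \<open>t\<close>
  would also shorten the one from \<open>s\<close>.\<close>

lemma btw_shrink_start: "btw A s w t \<Longrightarrow> via A s e w \<Longrightarrow> btw A e w t"
proof -
  assume st: "btw A s w t" and e: "via A s e w"
  obtain i j where ij: "(s, w) \<in> A ^^ i" "(w, t) \<in> A ^^ j" "\<And>k. (s, t) \<in> A ^^ k \<Longrightarrow> i + j \<le> k"
    using st by (auto simp: btw_def)
  obtain i1 i2 where i: "i = i1 + i2" "(s, e) \<in> A ^^ i1" "(e, w) \<in> A ^^ i2"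
    using e ij(1) by (auto simp: via_def)
  have "i2 + j \<le> k" if "(e, t) \<in> A ^^ k" for k
    using ij(3)[OF relpow_trans[OF i(2) that]] i(1) by simp
  then show ?thesis using i ij unfolding btw_def by blast
qed

lemma btw_shrink_end: "btw A s w t \<Longrightarrow> via A w e t \<Longrightarrow> btw A s w e"
  using btw_shrink_start[of "A\<inverse>" t w s e] by (simp add: btw_converse via_converse)

text \<open>Here \<open>e\<close> has to be unavoidable on the way to \<open>t\<close>, not just to
  \<open>w\<close>: only then is every walk from \<open>s\<close> to \<open>t\<close> at least as
  long as the distances from \<open>s\<close> to \<open>e\<close> and from \<open>e\<close> to
  \<open>t\<close> together.\<close>

lemma btw_extend_start:
  assumes "btw A e w t" "(s, e) \<in> A\<^sup>*" "via A s e t"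
  shows "btw A s w t"
proof -
  obtain i j where ij: "(e, w) \<in> A ^^ i" "(w, t) \<in> A ^^ j" "\<And>k. (e, t) \<in> A ^^ k \<Longrightarrow> i + j \<le> k"
    using assms(1) by (auto simp: btw_def)
  obtain h where h: "(s, e) \<in> A ^^ h" "\<And>k. (s, e) \<in> A ^^ k \<Longrightarrow> h \<le> k"
    using shortest_walkE[OF assms(2)] by blast
  have "h + i + j \<le> k" if k: "(s, t) \<in> A ^^ k" for k
  proof -
    obtain k1 k2 where "k = k1 + k2" "(s, e) \<in> A ^^ k1" "(e, t) \<in> A ^^ k2"
      using assms(3) k unfolding via_def by blast
    then show ?thesis using h(2)[of k1] ij(3)[of k2] by simp
  qed
  then show ?thesis
    unfolding btw_def using relpow_trans[OF h(1) ij(1)] ij(2) by blast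
qed

lemma btw_extend_end: "btw A s w e \<Longrightarrow> (e, t) \<in> A\<^sup>* \<Longrightarrow> via A s e t \<Longrightarrow> btw A s w t"
  using btw_extend_start[of "A\<inverse>" e w s t] by (simp add: btw_converse via_converse rtrancl_converse)

lemma btw_middle: "(s, w) \<in> A\<^sup>* \<Longrightarrow> (w, t) \<in> A\<^sup>* \<Longrightarrow> via A s w t \<Longrightarrow> btw A s w t"
  using btw_extend_start btw_start by fast

section \<open>Chains of through vertices\<close>

definition thr :: "('a \<times> 'a) set \<Rightarrow> 'a set" where
  "thr A = {x. (\<exists>!p. (p, x) \<in> A) \<and> (\<exists>!q. (x, q) \<in> A)}"

definition chn :: "('a \<times> 'a) set \<Rightarrow> ('a \<times> 'a) set" where
  "chn A = {(x, y). (x, y) \<in> A \<and> x \<in> thr A \<and> y \<in> thr A}"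

lemma thr_converse [simp]: "thr (A\<inverse>) = thr A"
  by (auto simp: thr_def)

lemma chn_converse: "chn (A\<inverse>) = (chn A)\<inverse>"
  by (auto simp: chn_def)

lemma chn_subset: "chn A \<subseteq> A"
  by (auto simp: chn_def)

lemma chn_rtrancl: "(x, y) \<in> (chn A)\<^sup>* \<Longrightarrow> (x, y) \<in> A\<^sup>*"
  using chn_subset rtrancl_mono by blast

lemma single_valued_chn: "single_valued (chn A)"
  by (auto simp: single_valued_def chn_def thr_def)

lemma single_valued_chn_converse: "single_valued ((chn A)\<inverse>)"
  by (auto simp: single_valued_def chn_def thr_def)

text \<open>Read backwards from \<open>y\<close>, a walk has no choice, because in-arcs are unique
  along the segment. It therefore runs back to \<open>w\<close> unless it starts inside the segment,
  strictly after \<open>w\<close>, which the second assumption rules out.\<close>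

lemma via_chn:
  assumes "(w, y) \<in> (chn A)\<^sup>*" "\<not> ((w, a) \<in> (chn A)\<^sup>+ \<and> (a, y) \<in> (chn A)\<^sup>*)"
  shows "via A a w y"
  using assms
proof (induction rule: rtrancl_induct)
  case base
  then show ?case unfolding via_def by (metis add.right_neutral relpow_0_I)
next
  case (step z y)
  show ?case unfolding via_def
  proof (intro allI impI)
    fix k assume k: "(a, y) \<in> A ^^ k"
    have wy: "(w, y) \<in> (chn A)\<^sup>+" using step.hyps by (rule rtrancl_into_trancl1)
    then have "k \<noteq> 0" using k step.prems by (cases k) auto
    then obtain k' z' where k': "k = Suc k'" "(a, z') \<in> A ^^ k'" "(z', y) \<in> A"
      using k by (metis not0_implies_Suc relpow_Suc_E)
    have "z' = z" using k'(3) step.hyps(2) by (auto simp: chn_def thr_def)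
    have "via A a w z" using step by (meson rtrancl.rtrancl_into_rtrancl)
    then obtain k1 k2 where "k' = k1 + k2" "(a, w) \<in> A ^^ k1" "(w, z) \<in> A ^^ k2"
      using k' \<open>z' = z\<close> by (auto simp: via_def)
    then show "\<exists>k1 k2. k = k1 + k2 \<and> (a, w) \<in> A ^^ k1 \<and> (w, y) \<in> A ^^ k2"
      using k' \<open>z' = z\<close> by (metis add_Suc_right relpow_Suc_I)
  qed
qed

lemma via_chn':
  assumes "(y, w) \<in> (chn A)\<^sup>*" "\<not> ((y, a) \<in> (chn A)\<^sup>* \<and> (a, w) \<in> (chn A)\<^sup>+)"
  shows "via A y w a"
  using via_chn[of w y "A\<inverse>" a] assms
  by (auto simp: chn_converse via_converse rtrancl_converse trancl_converse)

definition feasible :: "'a set \<Rightarrow> ('a \<times> 'a) set \<Rightarrow> 'a set \<Rightarrow> 'a set \<Rightarrow> 'a set \<Rightarrow> bool" where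
  "feasible V A P Q S \<longleftrightarrow> (\<forall>w\<in>V. \<exists>s\<in>S \<union> P. \<exists>t\<in>S \<union> Q. btw A s w t)"

lemma feasible_converse: "feasible V (A\<inverse>) Q P S \<longleftrightarrow> feasible V A P Q S"
  unfolding feasible_def btw_converse by blast

text \<open>A component of \<open>chn A\<close> with a beginning and an end, possibly the same
  vertex. The assumptions are symmetric under reversal of all arcs, so each statement on
  \<open>f\<close> yields one on \<open>e\<close> by \<open>dual\<close>; a cycle of through
  vertices has no such \<open>f\<close> and \<open>e\<close>.\<close>

locale chain =
  fixes A :: "('a \<times> 'a) set" and X :: "'a set" and f e :: 'a
  assumes ends: "f \<in> X" "e \<in> X"
    and from_first: "x \<in> X \<Longrightarrow> (f, x) \<in> (chn A)\<^sup>*"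
    and to_last: "x \<in> X \<Longrightarrow> (x, e) \<in> (chn A)\<^sup>*"
    and first: "(x, f) \<notin> chn A"
    and last: "(e, x) \<notin> chn A"
    and closed: "(x, y) \<in> chn A \<Longrightarrow> x \<in> X \<longleftrightarrow> y \<in> X"
    and through: "X \<subseteq> thr A"
begin

abbreviation "R \<equiv> chn A"

lemma dual: "chain (A\<inverse>) X e f"
  by unfold_locales
    (use ends from_first to_last first last closed through in \<open>auto simp: chn_converse rtrancl_converse\<close>)

lemma closed_rtrancl: "(x, y) \<in> R\<^sup>* \<Longrightarrow> x \<in> X \<longleftrightarrow> y \<in> X"
  by (induction rule: rtrancl_induct) (auto simp: closed)

lemma closed_trancl: "(x, y) \<in> R\<^sup>+ \<Longrightarrow> x \<in> X \<longleftrightarrow> y \<in> X"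
  by (meson closed_rtrancl trancl_into_rtrancl)

lemma comparable: "x \<in> X \<Longrightarrow> y \<in> X \<Longrightarrow> (x, y) \<in> R\<^sup>* \<or> (y, x) \<in> R\<^sup>*"
  using from_first single_valued_chn single_valued_confluent by metis

lemma comparable': "x \<in> X \<Longrightarrow> y \<in> X \<Longrightarrow> (x, y) \<in> R\<^sup>* \<or> (y, x) \<in> R\<^sup>+"
  using comparable[of x y] by (metis rtranclD rtrancl.rtrancl_refl)

text \<open>Out-arcs in a chain are unique, so everything that a vertex on a cycle of
  \<open>chn A\<close> reaches along \<open>chn A\<close> lies on this cycle. The last vertex would
  lie there too and have a successor.\<close>

lemma irrefl: assumes "x \<in> X" shows "(x, x) \<notin> R\<^sup>+"
proof
  assume x: "(x, x) \<in> R\<^sup>+"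
  have "(z, x) \<in> R\<^sup>+" if "(x, z) \<in> R\<^sup>*" for z
    using that
  proof (induction rule: rtrancl_induct)
    case (step y z)
    have "(z, x) \<in> R\<^sup>*"
    proof -
      obtain u where "(y, u) \<in> R" "(u, x) \<in> R\<^sup>*" using step.IH by (blast dest: tranclD)
      then show ?thesis using step.hyps(2) single_valuedD[OF single_valued_chn] by metis
    qed
    then show ?case using x by (rule rtrancl_trancl_trancl)
  qed (rule x)
  then have "(e, x) \<in> R\<^sup>+" using to_last[OF assms] by blast
  then show False using last by (meson tranclD)
qed

lemma antisym: "x \<in> X \<Longrightarrow> (x, y) \<in> R\<^sup>+ \<Longrightarrow> (y, x) \<notin> R\<^sup>*"
  using irrefl by (meson trancl_rtrancl_trancl)

lemma reach: "x \<in> X \<Longrightarrow> (x, e) \<in> A\<^sup>*" "x \<in> X \<Longrightarrow> (f, x) \<in> A\<^sup>*"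
  using to_last from_first chn_rtrancl by fast+

text \<open>The target may well lie in the chain, namely before \<open>x\<close>; the walk then has
  to go round through the rest of the digraph. This case is what makes the exchanges
  delicate.\<close>

lemma exit: "x \<in> X \<Longrightarrow> (x, y) \<notin> R\<^sup>* \<Longrightarrow> via A x e y"
  by (rule via_chn') (auto intro: to_last)

lemma enter: "y \<in> X \<Longrightarrow> (x, y) \<notin> R\<^sup>* \<Longrightarrow> via A x f y"
  by (rule via_chn) (auto intro: from_first)

lemma exit_out: "x \<in> X \<Longrightarrow> y \<notin> X \<Longrightarrow> via A x e y"
  using exit closed_rtrancl by blast

lemma enter_out: "y \<in> X \<Longrightarrow> x \<notin> X \<Longrightarrow> via A x f y"
  using enter closed_rtrancl by blast

lemma via_reach: "via A x z y \<Longrightarrow> (x, y) \<in> A\<^sup>* \<Longrightarrow> (x, z) \<in> A\<^sup>* \<and> (z, y) \<in> A\<^sup>*"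
  unfolding via_def by (meson relpow_imp_rtrancl rtrancl_imp_relpow)

text \<open>A connection that does not follow the chain must leave at \<open>e\<close> and come back
  at \<open>f\<close>, so a single backward connection makes all vertices of the chain mutually
  reachable.\<close>

lemma circular:
  assumes "x \<in> X" "y \<in> X" "(x, y) \<in> A\<^sup>*" "(x, y) \<notin> R\<^sup>*"
  shows "(e, f) \<in> A\<^sup>*"
proof -
  have ey: "(e, y) \<in> A\<^sup>*" using exit via_reach assms by blast
  show ?thesis
  proof (cases "(e, y) \<in> R\<^sup>*")
    case True
    then have "y = e" using last by (metis converse_rtranclE)
    then show ?thesis using assms to_last by blast
  next
    case False
    then show ?thesis using enter via_reach assms ey by blast
  qed
qed

text \<open>Leaving the chain is possible only at \<open>e\<close>, and the way from
  \<open>x\<close> to \<open>e\<close> already passes \<open>y\<close>; a shortest walk would have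
  stopped there.\<close>

lemma no_detour:
  assumes "btw A x w y" "x \<in> X" "y \<in> X" "(x, y) \<in> R\<^sup>*"
  shows "w \<in> X"
proof (rule ccontr)
  assume w: "w \<notin> X"
  obtain i j where ij: "(x, w) \<in> A ^^ i" "(w, y) \<in> A ^^ j" "\<And>k. (x, y) \<in> A ^^ k \<Longrightarrow> i + j \<le> k"
    using assms(1) by (auto simp: btw_def)
  obtain i1 i2 where i: "i = i1 + i2" "(x, e) \<in> A ^^ i1" "(e, w) \<in> A ^^ i2"
    using exit_out[OF assms(2) w] ij(1) by (auto simp: via_def)
  have "via A x y e"
    by (rule via_chn) (use assms to_last antisym in auto)
  then obtain a b where "i1 = a + b" "(x, y) \<in> A ^^ a"
    using i by (auto simp: via_def)
  then have "i2 = 0" using ij(3)[of a] i by simp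
  then show False using i w ends by auto
qed

section \<open>Exchanging the chosen vertices of a single chain\<close>

lemma reroute_start: "btw A s w t \<Longrightarrow> w \<notin> X \<Longrightarrow> s \<in> X \<Longrightarrow> btw A e w t"
  by (rule btw_shrink_start[OF _ exit_out])

lemma reroute_end: "btw A s w t \<Longrightarrow> w \<notin> X \<Longrightarrow> t \<in> X \<Longrightarrow> btw A s w f"
  by (rule btw_shrink_end[OF _ enter_out])

lemma cover_all: assumes "w \<in> X" shows "btw A f w e"
proof (rule btw_middle)
  show "via A f w e"
    by (rule via_chn) (use assms to_last from_first antisym in auto)
qed (use assms reach in auto)

text \<open>The two ends do everything that vertices of the chain can do: walks to the outside leave
  through \<open>e\<close>, walks from the outside arrive at \<open>f\<close>, and the chain itself
  lies on the way from \<open>f\<close> to \<open>e\<close>. This costs nothing once two vertices of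
  the chain are chosen.\<close>

lemma exchange_two:
  assumes S: "feasible V A P Q S"
  shows "feasible V A P Q ((S - X) \<union> {f, e})"
  unfolding feasible_def
proof
  fix w assume "w \<in> V"
  then obtain s t where st: "s \<in> S \<union> P" "t \<in> S \<union> Q" "btw A s w t" using S unfolding feasible_def by blast
  show "\<exists>s\<in>S - X \<union> {f, e} \<union> P. \<exists>t\<in>S - X \<union> {f, e} \<union> Q. btw A s w t"
  proof (cases "w \<in> X")
    case True
    then show ?thesis using cover_all by blast
  next
    case False
    define s' where "s' = (if s \<in> X then e else s)"
    define t' where "t' = (if t \<in> X then f else t)"
    have "btw A s' w t" using st False reroute_start by (auto simp: s'_def)
    then have "btw A s' w t'" using False reroute_end by (auto simp: t'_def)
    moreover have "s' \<in> S - X \<union> {f, e} \<union> P" "t' \<in> S - X \<union> {f, e} \<union> Q"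
      using st by (auto simp: s'_def t'_def)
    ultimately show ?thesis by blast
  qed
qed

text \<open>The free start \<open>p\<close> is the successor of \<open>c\<close>, so every walk from
  \<open>p\<close> to \<open>c\<close> goes round: along the chain to \<open>e\<close>, outside to
  \<open>f\<close> and on to \<open>c\<close>. One chosen vertex therefore covers the chain and also
  every outside vertex that lies on a shortest walk from \<open>e\<close> to
  \<open>f\<close>.\<close>

lemma exchange_circular:
  assumes S: "feasible V A P Q S" and circ: "(e, f) \<in> A\<^sup>*" and cp: "c \<in> X" "(c, p) \<in> R" "p \<in> P"
  shows "feasible V A P Q ((S - X) \<union> {c})"
  unfolding feasible_def
proof
  fix w assume "w \<in> V"
  then obtain s t where st: "s \<in> S \<union> P" "t \<in> S \<union> Q" "btw A s w t" using S unfolding feasible_def by blast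
  have p: "p \<in> X" using cp closed by blast
  have pc: "(p, c) \<notin> R\<^sup>*" using antisym cp by blast
  have pc': "(p, c) \<in> A\<^sup>*" using reach[of p] reach[of c] circ p cp by (meson rtrancl_trans)
  have pf: "(p, f) \<notin> R\<^sup>*" using cp first by (metis rtranclE)
  show "\<exists>s\<in>S - X \<union> {c} \<union> P. \<exists>t\<in>S - X \<union> {c} \<union> Q. btw A s w t"
  proof (cases "w \<in> X")
    case w: True
    \<comment> \<open>Each \<open>w\<close> is either at or before \<open>c\<close>, hence passed on
      arrival, or at or after \<open>p\<close>, hence passed on departure.\<close>
    have "btw A p w c"
    proof (cases "(w, c) \<in> R\<^sup>*")
      case True
      have "via A p w c" by (rule via_chn) (use True pc in auto)
      then show ?thesis using btw_middle via_reach pc' by metis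
    next
      case False
      then have "(c, w) \<in> R\<^sup>+" using comparable' w cp by blast
      then have "(p, w) \<in> R\<^sup>*" using cp(2) single_valued_chn by (metis single_valuedD tranclD)
      then have "via A p w c" by (rule via_chn') (use pc in auto)
      then show ?thesis using btw_middle via_reach pc' by metis
    qed
    then show ?thesis using cp by blast
  next
    case w: False
    consider "s \<notin> X" "t \<notin> X" | "s \<in> X" "t \<notin> X" | "s \<notin> X" "t \<in> X" | "s \<in> X" "t \<in> X" by blast
    then show ?thesis
    proof cases
      case 1
      then show ?thesis using st by blast
    next
      case 2
      then have "btw A e w t" using st w reroute_start by blast
      then have "btw A c w t" using btw_extend_start reach exit_out cp 2 by metis
      then show ?thesis using st 2 by blast
    next
      case 3
      then have "btw A s w f" using st w reroute_end by blast
      then have "btw A s w c" using btw_extend_end reach enter_out cp 3 by metis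
      then show ?thesis using st 3 by blast
    next
      \<comment> \<open>With both ends in the chain, the walk reduces to one from \<open>e\<close>
        to \<open>f\<close>, which is then prolonged to one from \<open>p\<close> to
        \<open>c\<close>.\<close>
      case 4
      then have "btw A e w f" using st w reroute_start reroute_end by blast
      then have "btw A p w f" using btw_extend_start reach exit pf p by metis
      then have "btw A p w c" using btw_extend_end reach enter pc cp by metis
      then show ?thesis using cp by blast
    qed
  qed
qed

text \<open>Seen from outside, a start \<open>s\<close> in the chain acts through \<open>e\<close>,
  and walks that end in \<open>s\<close> can be prolonged to \<open>e\<close>. Only chain vertices
  covered with \<open>s\<close> as a start could get lost; the other start \<open>a\<close>, which
  reaches \<open>s\<close>, takes them over. A free start inside a circular chain might lie beyond
  \<open>w\<close> and reach it only by going round; this is what \<open>circ\<close>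
  excludes.\<close>

lemma exchange_right:
  assumes S: "feasible V A P Q S" and X: "S \<inter> X = {s}" "X \<subseteq> V"
    and a: "a \<in> (S - {s}) \<union> P" "(a, s) \<in> A\<^sup>*"
    and circ: "(e, f) \<in> A\<^sup>* \<Longrightarrow> X \<inter> P \<subseteq> {f}"
  shows "feasible V A P Q ((S - X) \<union> {e})"
  unfolding feasible_def
proof
  fix w assume "w \<in> V"
  then obtain s0 t0 where st: "s0 \<in> S \<union> P" "t0 \<in> S \<union> Q" "btw A s0 w t0"
    using S unfolding feasible_def by blast
  have s: "s \<in> X" using X by auto
  show "\<exists>s\<in>S - X \<union> {e} \<union> P. \<exists>t\<in>S - X \<union> {e} \<union> Q. btw A s w t"
  proof (cases "w \<in> X")
    case w: True
    have aXf: "(a, f) \<in> A\<^sup>*" if "(e, f) \<in> A\<^sup>*"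
    proof (cases "a \<in> X")
      case True
      then have "a = f" using circ that a X by blast
      then show ?thesis by simp
    next
      case False
      then show ?thesis using enter_out[OF s False] via_reach a by blast
    qed
    \<comment> \<open>Some start that survives the exchange reaches \<open>w\<close>: either the old
      start \<open>s0\<close> or \<open>a\<close>.\<close>
    have "\<exists>b\<in>(S - X) \<union> P. (b, w) \<in> A\<^sup>*"
    proof (cases "(s, w) \<in> R\<^sup>*")
      case True
      then have "(a, w) \<in> A\<^sup>*" using a chn_rtrancl by (metis rtrancl_trans)
      then show ?thesis using a X by blast
    next
      case False
      show ?thesis
      proof (cases "s0 = s")
        case True
        then have "(s, w) \<in> A\<^sup>*" using st btw_reach by metis
        then have "(e, f) \<in> A\<^sup>*" using circular s w False by blast
        then have "(a, w) \<in> A\<^sup>*" using aXf reach(2)[OF w] by (meson rtrancl_trans)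
        then show ?thesis using a X by blast
      next
        case False
        then have "s0 \<in> (S - X) \<union> P" using st X by blast
        then show ?thesis using btw_reach[OF st(3)] by blast
      qed
    qed
    then obtain b where b: "b \<in> (S - X) \<union> P" "(b, w) \<in> A\<^sup>*" by blast
    have "via A b w e"
    proof (rule via_chn)
      \<comment> \<open>A start \<open>b\<close> in the chain strictly after \<open>w\<close> could
        reach \<open>w\<close> only by going round, so it would be \<open>f\<close>, which has no
        predecessor on the chain.\<close>
      show "\<not> ((w, b) \<in> R\<^sup>+ \<and> (b, e) \<in> R\<^sup>*)"
      proof (intro notI, elim conjE)
        assume wb: "(w, b) \<in> R\<^sup>+"
        then have "b \<in> X" using closed_trancl w by blast
        moreover have "(b, w) \<notin> R\<^sup>*" using antisym w wb by blast
        ultimately have "(e, f) \<in> A\<^sup>*" using circular b w by blast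
        then have "b = f" using circ b \<open>b \<in> X\<close> by blast
        then show False using wb first by (metis tranclE)
      qed
    qed (use to_last w in auto)
    then have "btw A b w e" using btw_middle b reach w by metis
    then show ?thesis using b by blast
  next
    case w: False
    show ?thesis
    proof (cases "t0 = s")
      case True
      then have "s0 \<noteq> s" using st w s by (auto simp: btw_same)
      show ?thesis
      proof (cases "s0 \<in> X")
        \<comment> \<open>A shortest walk from \<open>s0\<close> to \<open>s\<close> with
          \<open>w\<close> outside has to go round, which forces \<open>s0 = f\<close>; but from
          \<open>f\<close> the chain leads directly to \<open>s\<close>.\<close>
        case s0: True
        have "btw A s0 w s" using st True by simp
        then have "(s0, s) \<notin> R\<^sup>*" using no_detour s s0 w by blast
        moreover have "(s0, s) \<in> A\<^sup>*" using btw_reach[OF \<open>btw A s0 w s\<close>] by (meson rtrancl_trans)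
        ultimately have "(e, f) \<in> A\<^sup>*" using circular s s0 by blast
        then have "s0 = f" using circ s0 st \<open>s0 \<noteq> s\<close> X by blast
        then show ?thesis using \<open>(s0, s) \<notin> R\<^sup>*\<close> from_first s by blast
      next
        case False
        then have "btw A s0 w f" using reroute_end st w True s by blast
        then have "btw A s0 w e" using btw_extend_end reach enter_out False ends by metis
        then show ?thesis using st False by blast
      qed
    next
      case False
      then have t0: "t0 \<in> S - X \<union> {e} \<union> Q" using st X by blast
      show ?thesis
      proof (cases "s0 = s")
        case True
        then have "btw A e w t0" using reroute_start st w s by blast
        then show ?thesis using t0 by blast
      next
        case False
        then have "s0 \<in> S - X \<union> P" using st X by blast
        then show ?thesis using t0 st by blast
      qed
    qed
  qed
qed

end

section \<open>Vertices without in-arc or without out-arc\<close>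

definition cov :: "('a \<times> 'a) set \<Rightarrow> 'a set \<Rightarrow> 'a set \<Rightarrow> 'a set \<Rightarrow> 'a set" where
  "cov A P Q S = {w. \<exists>s\<in>S \<union> P. \<exists>t\<in>S \<union> Q. btw A s w t}"

lemma feasible_cov: "feasible V A P Q S \<longleftrightarrow> V \<subseteq> cov A P Q S"
  by (auto simp: feasible_def cov_def)

lemma cov_mono: "S \<subseteq> S' \<Longrightarrow> cov A P Q S \<subseteq> cov A P Q S'"
  unfolding cov_def by blast

definition forced :: "'a set \<Rightarrow> ('a \<times> 'a) set \<Rightarrow> 'a set \<Rightarrow> 'a set \<Rightarrow> 'a set" where
  "forced V A P Q = {v \<in> V. (\<forall>z. (z, v) \<notin> A) \<and> v \<notin> P \<or> (\<forall>z. (v, z) \<notin> A) \<and> v \<notin> Q}"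

lemma no_in_rtrancl: "(x, v) \<in> A\<^sup>* \<Longrightarrow> (\<And>z. (z, v) \<notin> A) \<Longrightarrow> x = v"
  by (metis rtranclE)

lemma no_out_rtrancl: "(v, x) \<in> A\<^sup>* \<Longrightarrow> (\<And>z. (v, z) \<notin> A) \<Longrightarrow> x = v"
  by (metis converse_rtranclE)

lemma forced_subset:
  assumes "feasible V A P Q S"
  shows "forced V A P Q \<subseteq> S"
proof
  fix v assume v: "v \<in> forced V A P Q"
  then obtain s t where st: "s \<in> S \<union> P" "t \<in> S \<union> Q" "btw A s v t"
    using assms unfolding feasible_def forced_def by blast
  then have "(s, v) \<in> A\<^sup>*" "(v, t) \<in> A\<^sup>*" by (auto dest: btw_reach)
  then show "v \<in> S"
    using v st no_in_rtrancl[of s v A] no_out_rtrancl[of v t A] by (auto simp: forced_def)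
qed

text \<open>Such a \<open>v\<close> lies in \<open>P\<close>, so it is available as a start anyway,
  and as an end a vertex without in-arc covers only itself.\<close>

lemma feasible_remove_no_in:
  assumes S: "feasible V A P Q S" and v: "v \<in> V" "v \<notin> forced V A P Q" "\<And>z. (z, v) \<notin> A"
    and A: "A \<subseteq> V \<times> V"
  shows "feasible V A P Q (S - {v})"
  unfolding feasible_def
proof
  fix w assume "w \<in> V"
  then obtain s t where st: "s \<in> S \<union> P" "t \<in> S \<union> Q" "btw A s w t"
    using S unfolding feasible_def by blast
  have vP: "v \<in> P" using v by (auto simp: forced_def)
  show "\<exists>s\<in>S - {v} \<union> P. \<exists>t\<in>S - {v} \<union> Q. btw A s w t"
  proof (cases "w = v")
    case True
    show ?thesis
    proof (cases "\<exists>z. (v, z) \<in> A")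
      case False
      then have "v \<in> Q" using v by (auto simp: forced_def)
      moreover have "btw A v w v" using True by (simp add: btw_same)
      ultimately show ?thesis using vP by blast
    next
      case True
      \<comment> \<open>Whatever end serves the out-neighbour \<open>z\<close> also serves
        \<open>v\<close>, taken as its own free start.\<close>
      then obtain z where z: "(v, z) \<in> A" by blast
      then have "z \<in> V" using A by auto
      then obtain s' t' where st': "t' \<in> S \<union> Q" "btw A s' z t'"
        using S unfolding feasible_def by blast
      have zt: "(z, t') \<in> A\<^sup>*" using st' by (auto dest: btw_reach)
      then have "t' \<noteq> v" using z v(3) no_in_rtrancl[of z v A] by blast
      moreover have "btw A v v t'" using z zt btw_start by (metis converse_rtrancl_into_rtrancl)
      ultimately show ?thesis using vP st' \<open>w = v\<close> by blast
    qed
  next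
    case False
    have "(w, t) \<in> A\<^sup>*" using st by (auto dest: btw_reach)
    then have "t \<noteq> v" using False v(3) no_in_rtrancl[of w v A] by blast
    then have "s \<in> S - {v} \<union> P" "t \<in> S - {v} \<union> Q" using st vP by auto
    then show ?thesis using st(3) by blast
  qed
qed

lemma forced_converse: "forced V (A\<inverse>) Q P = forced V A P Q"
  by (auto simp: forced_def)

lemma feasible_remove:
  assumes S: "feasible V A P Q S" and v: "v \<in> V" "v \<notin> forced V A P Q"
    and "(\<forall>z. (z, v) \<notin> A) \<or> (\<forall>z. (v, z) \<notin> A)" and A: "A \<subseteq> V \<times> V"
  shows "feasible V A P Q (S - {v})"
  using assms(4)
proof
  assume "\<forall>z. (z, v) \<notin> A"
  then show ?thesis by (intro feasible_remove_no_in[OF S v _ A]) simp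
next
  assume "\<forall>z. (v, z) \<notin> A"
  moreover have "A\<inverse> \<subseteq> V \<times> V" using A by auto
  ultimately have "feasible V (A\<inverse>) Q P (S - {v})"
    using S v by (intro feasible_remove_no_in) (auto simp: forced_converse feasible_converse)
  then show ?thesis by (simp add: feasible_converse)
qed

section \<open>Which vertices of a chain have to be considered\<close>

definition pivot :: "('a \<times> 'a) set \<Rightarrow> 'a set \<Rightarrow> 'a set \<Rightarrow> 'a set" where
  "pivot A P Q = {x. \<exists>y. (x, y) \<in> chn A \<and> y \<in> P \<or> (y, x) \<in> chn A \<and> y \<in> Q}"

context chain
begin

lemma card_exchange: "finite S \<Longrightarrow> S \<inter> X \<noteq> {} \<Longrightarrow> card ((S - X) \<union> {c}) \<le> card S"
proof -
  assume S: "finite S" "S \<inter> X \<noteq> {}"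
  have "card (S - X) < card S" by (rule psubset_card_mono) (use S in auto)
  then show ?thesis using card_insert_le_m1[of "card S" "S - X" c] by (simp add: card_insert_if S)
qed

lemma exchange_left:
  assumes S: "feasible V A P Q S" and X: "S \<inter> X = {s}" "X \<subseteq> V"
    and a: "a \<in> (S - {s}) \<union> Q" "(s, a) \<in> A\<^sup>*"
    and circ: "(e, f) \<in> A\<^sup>* \<Longrightarrow> X \<inter> Q \<subseteq> {e}"
  shows "feasible V A P Q ((S - X) \<union> {f})"
proof -
  have "feasible V (A\<inverse>) Q P ((S - X) \<union> {f})"
    by (rule chain.exchange_right[OF dual, of V Q P S s a])
      (use assms in \<open>auto simp: feasible_converse rtrancl_converse\<close>)
  then show ?thesis by (simp add: feasible_converse)
qed

lemma exchange_circular':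
  assumes S: "feasible V A P Q S" and circ: "(e, f) \<in> A\<^sup>*" and c: "c \<in> X" "c \<in> pivot A P Q"
  shows "feasible V A P Q ((S - X) \<union> {c})"
proof -
  obtain p where "(c, p) \<in> R \<and> p \<in> P \<or> (p, c) \<in> R \<and> p \<in> Q" using c by (auto simp: pivot_def)
  then show ?thesis
  proof (elim disjE conjE)
    assume "(p, c) \<in> R" "p \<in> Q"
    then have "feasible V (A\<inverse>) Q P ((S - X) \<union> {c})"
      by (intro chain.exchange_circular[OF dual, of V Q P S c p])
        (use S circ c in \<open>auto simp: feasible_converse rtrancl_converse chn_converse\<close>)
    then show ?thesis by (simp add: feasible_converse)
  qed (rule exchange_circular[OF S circ c(1)])
qed

lemma has_pred: "x \<in> X \<Longrightarrow> x \<noteq> f \<Longrightarrow> \<exists>y\<in>X. (y, x) \<in> R"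
  using from_first closed by (metis rtranclE)

lemma has_succ: "x \<in> X \<Longrightarrow> x \<noteq> e \<Longrightarrow> \<exists>y\<in>X. (x, y) \<in> R"
  using to_last closed by (metis converse_rtranclE)

text \<open>Two chosen vertices are replaced by the ends. A single one becomes the pivot if the
  chain is circular and has one, and moves to an end otherwise. The pivot \<open>c\<close> is
  prescribed from outside, so it can be fixed once for all solutions.\<close>

lemma exchange_branching:
  assumes S: "finite S" "feasible V A P Q S" and X: "X \<subseteq> V"
    and A: "A \<subseteq> V \<times> V" "\<And>x. (x, x) \<notin> A"
    and c: "X \<inter> pivot A P Q \<noteq> {} \<Longrightarrow> c \<in> X \<inter> pivot A P Q"
  obtains S' where "feasible V A P Q S'" "card S' \<le> card S" "S' - X = S - X"
    "S' \<inter> X \<subseteq> {f, e} \<union> ({c} \<inter> pivot A P Q)"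
proof -
  consider "S \<inter> X = {}" | s where "S \<inter> X = {s}" | s s' where "s \<in> S \<inter> X" "s' \<in> S \<inter> X" "s \<noteq> s'"
    by blast
  then show thesis
  proof cases
    case 1
    then show thesis using that[of S] S by auto
  next
    case (3 s s')
    have "card {s, s'} \<le> card (S \<inter> X)" by (rule card_mono) (use S 3 in auto)
    then have "card (S - X) + 2 \<le> card S"
      using card_Int_Diff[OF S(1), of X] 3 by simp
    moreover have "card ((S - X) \<union> {f, e}) \<le> card (S - X) + card {f, e}" by (rule card_Un_le)
    moreover have "card {f, e} \<le> 2" by (simp add: card_insert_if)
    ultimately have "card ((S - X) \<union> {f, e}) \<le> card S" by linarith
    then show thesis using that[OF exchange_two[OF S(2)]] ends by auto
  next
    case (2 s)
    then have card: "card ((S - X) \<union> {x}) \<le> card S" for x using card_exchange S(1) by blast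
    show thesis
    proof (cases "(e, f) \<in> A\<^sup>* \<and> X \<inter> pivot A P Q \<noteq> {}")
      case True
      then have "c \<in> X" "c \<in> pivot A P Q" using c by auto
      then show thesis using that[OF exchange_circular'[OF S(2)] card] True by auto
    next
      case False
      \<comment> \<open>A free start other than \<open>f\<close> has a predecessor on the chain,
        which would be a pivot.\<close>
      have circP: "X \<inter> P \<subseteq> {f}" if "(e, f) \<in> A\<^sup>*"
        using that False has_pred by (force simp: pivot_def)
      have circQ: "X \<inter> Q \<subseteq> {e}" if "(e, f) \<in> A\<^sup>*"
        using that False has_succ by (force simp: pivot_def)
      have s: "s \<in> X" using 2 by auto
      \<comment> \<open>How the predecessor \<open>p\<close> of \<open>s\<close> is covered decides
        the direction. Either its start is available even without \<open>s\<close>, and it reaches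
        \<open>s\<close>; or its start is \<open>s\<close>, and then its end differs from
        \<open>s\<close> and is reached from \<open>s\<close>.\<close>
      then obtain p where p: "(p, s) \<in> A" using through by (auto simp: thr_def)
      then have "p \<in> V" using A by auto
      then obtain a t where at: "a \<in> S \<union> P" "t \<in> S \<union> Q" "btw A a p t"
        using S(2) unfolding feasible_def by blast
      then have "(a, p) \<in> A\<^sup>*" "(p, t) \<in> A\<^sup>*" by (auto dest: btw_reach)
      then have as: "(a, s) \<in> A\<^sup>*" using p by auto
      show thesis
      proof (cases "a \<in> (S - {s}) \<union> P")
        case True
        have "feasible V A P Q ((S - X) \<union> {e})"
          by (rule exchange_right[OF S(2) 2 X True as circP])
        then show thesis using that card ends by auto
      next
        case False
        then have "a = s" using at by auto
        then have "t \<noteq> s" using at p A by (auto simp: btw_same)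
        then have t: "t \<in> (S - {s}) \<union> Q" using at by auto
        have st: "(s, t) \<in> A\<^sup>*" using \<open>a = s\<close> \<open>(a, p) \<in> A\<^sup>*\<close> \<open>(p, t) \<in> A\<^sup>*\<close> by auto
        have "feasible V A P Q ((S - X) \<union> {f})"
          by (rule exchange_left[OF S(2) 2 X t st circQ])
        then show thesis using that card ends by auto
      qed
    qed
  qed
qed

section \<open>Chains between a source and a sink\<close>

lemma reach_first_via:
  assumes "(u, f) \<in> A" "\<And>z. (z, u) \<notin> A" "x \<notin> X" "y \<in> X" "(x, y) \<in> A\<^sup>*"
  shows "x = u"
proof -
  have "(x, f) \<in> A\<^sup>*" using enter_out via_reach assms by blast
  moreover have "x \<noteq> f" using assms ends by blast
  ultimately obtain p where "(x, p) \<in> A\<^sup>*" "(p, f) \<in> A" by (metis rtranclE)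
  moreover have "p = u" using assms(1) \<open>(p, f) \<in> A\<close> ends through by (auto simp: thr_def)
  ultimately show ?thesis using assms(2) by (metis rtranclE)
qed

lemma reach_last_via:
  assumes "(e, w) \<in> A" "\<And>z. (w, z) \<notin> A" "x \<notin> X" "y \<in> X" "(y, x) \<in> A\<^sup>*"
  shows "x = w"
  using chain.reach_first_via[OF dual, of w x y] assms by (simp add: rtrancl_converse)

context
  fixes V P Q :: "'a set" and u w :: 'a
  assumes u: "(u, f) \<in> A" "\<And>z. (z, u) \<notin> A" and w: "(e, w) \<in> A" "\<And>z. (w, z) \<notin> A"
    and A: "A \<subseteq> V \<times> V"
begin

lemma uw_out: "u \<notin> X" "w \<notin> X"
  using u w through by (auto simp: thr_def)

text \<open>The source and the sink next to the chain are available as start and end in every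
  feasible set, so nothing about them has to be assumed of a solution.\<close>

lemma uw_terminal: "u \<in> forced V A P Q \<union> P" "w \<in> forced V A P Q \<union> Q"
  using u w A by (auto simp: forced_def)

lemma forced_disjoint: "forced V A P Q \<inter> X = {}"
  using through by (auto simp: forced_def thr_def)

lemma uw_reach: "x \<in> X \<Longrightarrow> (u, x) \<in> A\<^sup>*" "x \<in> X \<Longrightarrow> (x, w) \<in> A\<^sup>*"
  using u w reach by (meson converse_rtrancl_into_rtrancl rtrancl.rtrancl_into_rtrancl)+

text \<open>Without a chosen vertex in the chain, a walk covering one of its vertices starts in
  \<open>P\<close> or at the source and ends in \<open>Q\<close> or at the sink; the forced vertices
  alone would then cover it already.\<close>

lemma uncovered_nonempty:
  assumes S: "feasible V A P Q S" and "X \<subseteq> V" "\<not> X \<subseteq> cov A P Q (forced V A P Q)"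
  shows "S \<inter> X \<noteq> {}"
proof
  assume SX: "S \<inter> X = {}"
  obtain x where x: "x \<in> X" "x \<notin> cov A P Q (forced V A P Q)" using assms(3) by blast
  then obtain s t where st: "s \<in> S \<union> P" "t \<in> S \<union> Q" "btw A s x t"
    using S assms(2) unfolding feasible_def by blast
  then have "(s, x) \<in> A\<^sup>*" "(x, t) \<in> A\<^sup>*" by (auto dest: btw_reach)
  then have "s \<in> X \<or> s = u" "t \<in> X \<or> t = w"
    using reach_first_via[OF u] reach_last_via[OF w] x by blast+
  then have "s \<in> forced V A P Q \<union> P" "t \<in> forced V A P Q \<union> Q"
    using uw_terminal SX st by blast+
  then show False using x st unfolding cov_def by blast
qed

text \<open>Any one vertex \<open>c\<close> of the chain suffices: what precedes it lies on the way
  from \<open>u\<close>, what follows it on the way to \<open>w\<close>. Outside the chain, only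
  \<open>u\<close> and \<open>w\<close> can depend on walks that start or end in the chain, and
  these two are the ends of a walk from \<open>u\<close> to \<open>w\<close>.\<close>

lemma exchange_source_sink:
  assumes S: "feasible V A P Q S" and "U \<subseteq> X"
    and "U \<noteq> {} \<or> X \<subseteq> cov A P Q (forced V A P Q)"
  shows "feasible V A P Q ((S - X) \<union> U)"
  unfolding feasible_def
proof
  fix x assume x: "x \<in> V"
  let ?F = "forced V A P Q" and ?S = "(S - X) \<union> U"
  have F: "?F \<subseteq> ?S" using forced_subset[OF S] forced_disjoint by blast
  then have us: "u \<in> ?S \<union> P" "w \<in> ?S \<union> Q" using uw_terminal by blast+
  show "\<exists>s\<in>?S \<union> P. \<exists>t\<in>?S \<union> Q. btw A s x t"
  proof (cases "x \<in> X")
    case True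
    show ?thesis
    proof (cases "U = {}")
      case True
      then have "x \<in> cov A P Q ?F" using assms(3) \<open>x \<in> X\<close> by blast
      then show ?thesis using cov_mono[OF F] unfolding cov_def by blast
    next
      case False
      then obtain c where c: "c \<in> U" "c \<in> X" using assms(2) by blast
      show ?thesis
      proof (cases "(x, c) \<in> R\<^sup>*")
        case True
        have "via A u x c" by (rule via_chn) (use True uw_out closed_trancl \<open>x \<in> X\<close> in auto)
        then have "btw A u x c" using btw_middle[of u x] uw_reach \<open>x \<in> X\<close> True chn_rtrancl by metis
        then show ?thesis using us c by blast
      next
        case False
        then have cx: "(c, x) \<in> R\<^sup>*" using comparable \<open>x \<in> X\<close> c by blast
        have "via A c x w" by (rule via_chn') (use cx uw_out closed_rtrancl c in auto)
        then have "btw A c x w" using btw_middle[of c x] uw_reach \<open>x \<in> X\<close> cx chn_rtrancl by metis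
        then show ?thesis using us c by blast
      qed
    qed
  next
    case False
    obtain s t where st: "s \<in> S \<union> P" "t \<in> S \<union> Q" "btw A s x t"
      using S x unfolding feasible_def by blast
    then have "(s, x) \<in> A\<^sup>*" "(x, t) \<in> A\<^sup>*" by (auto dest: btw_reach)
    then consider "s \<notin> X" "t \<notin> X" | "x = u" | "x = w"
      using reach_first_via[OF u, of x t] reach_last_via[OF w, of x s] False by auto
    then show ?thesis
    proof cases
      case 1
      then show ?thesis using st by blast
    next
      case 2
      have "(u, w) \<in> A\<^sup>*" using uw_reach ends by (meson rtrancl_trans)
      then have "btw A u x w" unfolding 2 by (rule btw_start)
      then show ?thesis using us by blast
    next
      case 3
      have "(u, w) \<in> A\<^sup>*" using uw_reach ends by (meson rtrancl_trans)
      then have "btw A u x w" unfolding 3 by (rule btw_end)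
      then show ?thesis using us by blast
    qed
  qed
qed

end

end

section \<open>Cycles of through vertices\<close>

locale chain_cycle =
  fixes A :: "('a \<times> 'a) set" and X :: "'a set"
  assumes strong: "x \<in> X \<Longrightarrow> y \<in> X \<Longrightarrow> (x, y) \<in> (chn A)\<^sup>*"
    and isolated: "(x, y) \<in> A \<Longrightarrow> x \<in> X \<longleftrightarrow> y \<in> X"
    and through: "X \<subseteq> thr A"
begin

lemma isolated_rtrancl: "(x, y) \<in> A\<^sup>* \<Longrightarrow> x \<in> X \<longleftrightarrow> y \<in> X"
  by (induction rule: rtrancl_induct) (auto simp: isolated)

text \<open>Out-arcs are unique, so a walk from the successor \<open>p\<close> of \<open>c\<close>
  to \<open>c\<close> has to follow the whole cycle. Hence two consecutive chosen vertices cover a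
  cycle, and so does a pivot alone.\<close>

lemma cover_cycle:
  assumes "(c, p) \<in> A" "c \<in> X" "w \<in> X"
  shows "btw A p w c"
proof (rule btw_middle)
  have p: "p \<in> X" using assms isolated by blast
  show "(p, w) \<in> A\<^sup>*" "(w, c) \<in> A\<^sup>*" using strong assms p chn_rtrancl by fast+
  show "via A p w c"
    unfolding via_def
  proof (intro allI impI)
    fix k assume "(p, c) \<in> A ^^ k"
    then obtain g where g: "g 0 = p" "g k = c" "\<And>i. i < k \<Longrightarrow> (g i, g (Suc i)) \<in> A"
      by (auto simp: relpow_fun_conv)
    \<comment> \<open>The walk \<open>g\<close> lists all vertices that can be reached from
      \<open>p\<close> along the cycle; after its end \<open>c\<close> they repeat from
      \<open>p\<close>, that is from position 0.\<close>
    have "\<exists>i\<le>k. z = g i" if "(p, z) \<in> (chn A)\<^sup>*" for z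
      using that
    proof (induction rule: rtrancl_induct)
      case base
      then show ?case using g by (intro exI[of _ 0]) auto
    next
      case (step y z)
      then obtain i where i: "i \<le> k" "y = g i" by blast
      have yz: "(y, z) \<in> A" "y \<in> thr A" using step by (auto simp: chn_def)
      show ?case
      proof (cases "i = k")
        case True
        then have "z = p" using yz assms(1) g i by (auto simp: thr_def)
        then show ?thesis using g by (intro exI[of _ 0]) auto
      next
        case False
        then have "z = g (Suc i)" using yz g(3)[of i] i by (auto simp: thr_def)
        then show ?thesis using False i by (intro exI[of _ "Suc i"]) auto
      qed
    qed
    then obtain i where i: "i \<le> k" "w = g i" using strong p assms by blast
    have "(p, w) \<in> A ^^ i" unfolding relpow_fun_conv using g i by (intro exI[of _ g]) auto
    moreover have "(w, c) \<in> A ^^ (k - i)"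
      unfolding relpow_fun_conv using g i by (intro exI[of _ "\<lambda>j. g (i + j)"]) auto
    ultimately show "\<exists>k1 k2. k = k1 + k2 \<and> (p, w) \<in> A ^^ k1 \<and> (w, c) \<in> A ^^ k2"
      using i by (intro exI[of _ i] exI[of _ "k - i"]) auto
  qed
qed

lemma exchange_cycle:
  assumes S: "feasible V A P Q S" and U: "U \<subseteq> X" "X \<subseteq> cov A P Q ((S - X) \<union> U)"
  shows "feasible V A P Q ((S - X) \<union> U)"
  unfolding feasible_def
proof
  fix x assume x: "x \<in> V"
  show "\<exists>s\<in>S - X \<union> U \<union> P. \<exists>t\<in>S - X \<union> U \<union> Q. btw A s x t"
  proof (cases "x \<in> X")
    case True
    then show ?thesis using U unfolding cov_def by blast
  next
    case False
    obtain s t where st: "s \<in> S \<union> P" "t \<in> S \<union> Q" "btw A s x t"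
      using S x unfolding feasible_def by blast
    then have "s \<notin> X" "t \<notin> X" using False btw_reach[OF st(3)] isolated_rtrancl by blast+
    then show ?thesis using st by blast
  qed
qed

lemma uncovered_nonempty:
  assumes S: "feasible V A P Q S" and X: "X \<subseteq> V" "\<not> X \<subseteq> cov A P Q F"
  shows "S \<inter> X \<noteq> {}"
proof
  assume SX: "S \<inter> X = {}"
  obtain x where x: "x \<in> X" "x \<notin> cov A P Q F" using X by blast
  then obtain s t where st: "s \<in> S \<union> P" "t \<in> S \<union> Q" "btw A s x t"
    using S X unfolding feasible_def by blast
  then have "s \<in> X" "t \<in> X" using x btw_reach[OF st(3)] isolated_rtrancl by blast+
  then have "s \<in> P" "t \<in> Q" using SX st by blast+
  then show False using x st unfolding cov_def by blast
qed

text \<open>Without a pivot the cycle contains neither free starts nor free ends, and a single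
  chosen vertex would cover only itself. There is a second vertex to cover, because loops are
  excluded.\<close>

lemma no_pivot_two:
  assumes S: "feasible V A P Q S" and X: "X \<subseteq> V" "X \<noteq> {}" and A: "\<And>x. (x, x) \<notin> A"
    and pv: "X \<inter> pivot A P Q = {}"
  obtains s s' where "s \<in> S \<inter> X" "s' \<in> S \<inter> X" "s \<noteq> s'"
proof -
  have succ: "\<exists>y\<in>X. (x, y) \<in> chn A \<and> y \<noteq> x" if x: "x \<in> X" for x
  proof -
    obtain q where q: "(x, q) \<in> A" using x through unfolding thr_def by blast
    then have "q \<in> X" "q \<noteq> x" using isolated x A by blast+
    then show ?thesis using q x through by (auto simp: chn_def)
  qed
  have pred: "\<exists>y\<in>X. (y, x) \<in> chn A \<and> y \<noteq> x" if x: "x \<in> X" for x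
  proof -
    obtain q where q: "(q, x) \<in> A" using x through unfolding thr_def by blast
    then have "q \<in> X" "q \<noteq> x" using isolated x A by blast+
    then show ?thesis using q x through by (auto simp: chn_def)
  qed
  have P: "X \<inter> P = {}" using pred pv by (fastforce simp: pivot_def)
  have Q: "X \<inter> Q = {}" using succ pv by (fastforce simp: pivot_def)
  have cv: "\<exists>s\<in>S \<inter> X. \<exists>t\<in>S \<inter> X. btw A s x t" if x: "x \<in> X" for x
  proof -
    obtain s t where st: "s \<in> S \<union> P" "t \<in> S \<union> Q" "btw A s x t"
      using S x X unfolding feasible_def by blast
    then have "s \<in> X" "t \<in> X" using x btw_reach[OF st(3)] isolated_rtrancl by blast+
    then show ?thesis using st P Q by blast
  qed
  obtain x where x: "x \<in> X" using X by blast
  then obtain s t where st: "s \<in> S \<inter> X" "t \<in> S \<inter> X" "btw A s x t" using cv by blast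
  obtain y where y: "y \<in> X" "y \<noteq> s" using succ[of s] st by blast
  then obtain s' t' where st': "s' \<in> S \<inter> X" "t' \<in> S \<inter> X" "btw A s' y t'" using cv by blast
  then have "s' \<noteq> t' \<or> s' = y" by (auto simp: btw_same)
  then show thesis using that st st' y by metis
qed

end

section \<open>Normal form of an optimal solution\<close>

text \<open>An equivalence relation on the through vertices; its classes are the chains and the
  cycles. Undirected connection is used so that the relation can be computed as a reflexive
  transitive closure.\<close>

definition clsrel :: "('a \<times> 'a) set \<Rightarrow> ('a \<times> 'a) set" where
  "clsrel A = {(x, y). x \<in> thr A \<and> (x, y) \<in> (chn A \<union> (chn A)\<inverse>)\<^sup>*}"

definition firsts :: "('a \<times> 'a) set \<Rightarrow> 'a set" where
  "firsts A = {x \<in> thr A. \<forall>y. (y, x) \<notin> chn A}"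

definition lasts :: "('a \<times> 'a) set \<Rightarrow> 'a set" where
  "lasts A = {x \<in> thr A. \<forall>y. (x, y) \<notin> chn A}"

text \<open>The outer neighbour \<open>p\<close> of an end of a chain is never a through vertex; if
  it has in-arcs as well as out-arcs, its degree is at least 3, which makes such classes countable.
  All other chains run from a source to a sink. A cycle has no ends and does not qualify.\<close>

definition branching :: "('a \<times> 'a) set \<Rightarrow> 'a set" where
  "branching A = {x. \<exists>y. (x, y) \<in> clsrel A \<and>
     (y \<in> firsts A \<and> (\<exists>p q. (p, y) \<in> A \<and> (q, p) \<in> A) \<or>
      y \<in> lasts A \<and> (\<exists>p q. (y, p) \<in> A \<and> (p, q) \<in> A))}"

definition leaders :: "('a::linorder \<times> 'a) set \<Rightarrow> 'a set \<Rightarrow> 'a set" where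
  "leaders A Y = {x \<in> thr A \<inter> Y. \<forall>y\<in>Y. (x, y) \<in> clsrel A \<longrightarrow> x \<le> y}"

definition candidates :: "('a::linorder \<times> 'a) set \<Rightarrow> 'a set \<Rightarrow> 'a set \<Rightarrow> 'a set" where
  "candidates A P Q = {x. x \<notin> thr A \<and> (\<exists>p. (p, x) \<in> A) \<and> (\<exists>q. (x, q) \<in> A)} \<union>
     branching A \<inter> (firsts A \<union> lasts A \<union> leaders A (pivot A P Q))"

text \<open>The greedy choice in an uncovered class outside \<open>branching A\<close>: the first
  vertex of a chain; on a cycle the least pivot, or without pivot the least vertex together with its
  successor. Coverage by the forced vertices alone decides, since chosen vertices of other classes
  cannot help here.\<close>

definition picks :: "'a::linorder set \<Rightarrow> ('a \<times> 'a) set \<Rightarrow> 'a set \<Rightarrow> 'a set \<Rightarrow> 'a set" where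
  "picks V A P Q = {x \<in> thr A - branching A.
     (\<exists>y. (x, y) \<in> clsrel A \<and> y \<notin> cov A P Q (forced V A P Q)) \<and>
     (x \<in> firsts A \<or>
      clsrel A `` {x} \<inter> firsts A = {} \<and>
       (x \<in> leaders A (pivot A P Q) \<or>
        clsrel A `` {x} \<inter> pivot A P Q = {} \<and>
          (x \<in> leaders A UNIV \<or> (\<exists>y \<in> leaders A UNIV. (y, x) \<in> A))))}"

lemma clsrel_converse: "clsrel (A\<inverse>) = clsrel A"
  by (simp add: clsrel_def chn_converse Un_commute)

lemma firsts_converse: "firsts (A\<inverse>) = lasts A"
  by (simp add: firsts_def lasts_def chn_converse)

lemma sym_chn: "sym ((chn A \<union> (chn A)\<inverse>)\<^sup>*)"
  by (intro sym_rtrancl) (auto simp: sym_def)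

lemma clsrel_thr: "(x, y) \<in> clsrel A \<Longrightarrow> x \<in> thr A \<and> y \<in> thr A"
proof -
  have "y \<in> thr A" if "(x, y) \<in> (chn A \<union> (chn A)\<inverse>)\<^sup>*" "x \<in> thr A"
    using that by (induction rule: rtrancl_induct) (auto simp: chn_def)
  then show "(x, y) \<in> clsrel A \<Longrightarrow> x \<in> thr A \<and> y \<in> thr A" by (auto simp: clsrel_def)
qed

lemma clsrel_refl: "x \<in> thr A \<Longrightarrow> (x, x) \<in> clsrel A"
  by (simp add: clsrel_def)

lemma clsrel_sym:
  assumes "(x, y) \<in> clsrel A"
  shows "(y, x) \<in> clsrel A"
proof -
  have "(y, x) \<in> (chn A \<union> (chn A)\<inverse>)\<^sup>*"
    using assms symD[OF sym_chn] by (metis (mono_tags, lifting) CollectD case_prodD clsrel_def)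
  then show ?thesis using clsrel_thr[OF assms] by (simp add: clsrel_def)
qed

lemma clsrel_trans: "(x, y) \<in> clsrel A \<Longrightarrow> (y, z) \<in> clsrel A \<Longrightarrow> (x, z) \<in> clsrel A"
  unfolding clsrel_def by (clarsimp elim!: rtrancl_trans)

lemma chn_clsrel: "(x, y) \<in> chn A \<Longrightarrow> (x, y) \<in> clsrel A"
  by (auto simp: clsrel_def chn_def)

lemma clsrel_class: "(x, y) \<in> clsrel A \<Longrightarrow> clsrel A `` {x} = clsrel A `` {y}"
  by (rule set_eqI) (metis Image_singleton_iff clsrel_sym clsrel_trans)

text \<open>Zigzags collapse: \<open>chn A\<close> is single-valued in both directions, so two
  forward or two backward ways out of one vertex extend one another.\<close>

lemma clsrel_comparable:
  assumes "(x, y) \<in> clsrel A"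
  shows "(x, y) \<in> (chn A)\<^sup>* \<or> (y, x) \<in> (chn A)\<^sup>*"
proof -
  have "(x, y) \<in> (chn A \<union> (chn A)\<inverse>)\<^sup>*" using assms by (simp add: clsrel_def)
  then show ?thesis
  proof (induction rule: rtrancl_induct)
    case (step y z)
    from step.hyps(2) show ?case
    proof
      assume yz: "(y, z) \<in> chn A"
      show ?thesis
      proof (cases "(x, y) \<in> (chn A)\<^sup>*")
        case False
        then have "(y, x) \<in> (chn A)\<^sup>*" using step.IH by blast
        then show ?thesis using yz single_valued_confluent[OF single_valued_chn] by (metis r_into_rtrancl)
      qed (use yz in auto)
    next
      assume "(y, z) \<in> (chn A)\<inverse>"
      then have zy: "(z, y) \<in> chn A" by simp
      show ?thesis
      proof (cases "(y, x) \<in> (chn A)\<^sup>*")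
        case False
        then have "(y, x) \<in> ((chn A)\<inverse>)\<^sup>*" using step.IH by (simp add: rtrancl_converse)
        moreover have "(y, z) \<in> ((chn A)\<inverse>)\<^sup>*" using zy by auto
        ultimately have "(x, z) \<in> ((chn A)\<inverse>)\<^sup>* \<or> (z, x) \<in> ((chn A)\<inverse>)\<^sup>*"
          using single_valued_confluent[OF single_valued_chn_converse] by metis
        then show ?thesis by (auto simp: rtrancl_converse)
      qed (use zy in \<open>auto intro: converse_rtrancl_into_rtrancl\<close>)
    qed
  qed simp
qed

lemma leaders_unique: "x \<in> leaders A Y \<Longrightarrow> y \<in> leaders A Y \<Longrightarrow> (x, y) \<in> clsrel A \<Longrightarrow> x = y"
  using clsrel_sym[of x y A] by (auto simp: leaders_def intro: order.antisym)

locale geodetic_instance =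
  fixes V :: "'a::linorder set" and A :: "('a \<times> 'a) set" and P Q :: "'a set"
  assumes finite_V: "finite V" and arcs: "A \<subseteq> V \<times> V" and loopless: "(x, x) \<notin> A"
begin

abbreviation "cl x \<equiv> clsrel A `` {x}"

lemmas rel_thr = clsrel_thr[of _ _ A] and rel_refl = clsrel_refl[of _ A]
  and rel_sym = clsrel_sym[of _ _ A] and rel_trans = clsrel_trans[of _ _ A]
  and rel_class = clsrel_class[of _ _ A] and rel_comparable = clsrel_comparable[of _ _ A]
  and chn_rel = chn_clsrel[of _ _ A]

lemma dual: "geodetic_instance V (A\<inverse>)"
  using finite_V arcs loopless by unfold_locales auto

lemma thr_V: "thr A \<subseteq> V"
  using arcs by (auto simp: thr_def)

lemma cl_subset: "cl x \<subseteq> thr A" "cl x \<subseteq> V"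
proof -
  show "cl x \<subseteq> thr A" using rel_thr by fast
  then show "cl x \<subseteq> V" using thr_V by blast
qed

lemma finite_cl: "finite (cl x)"
  by (rule finite_subset[OF cl_subset(2) finite_V])

text \<open>If every vertex of the class had a successor, the successor map would be an injection of
  a finite set into itself, hence onto, and \<open>f\<close> would have a predecessor. So a last
  vertex exists.\<close>

lemma first_chain:
  assumes f: "f \<in> cl x" "f \<in> firsts A"
  obtains e where "chain A (cl x) f e" "e \<in> lasts A"
proof -
  have cl: "cl x = cl f" using f rel_class by blast
  have ff: "f \<in> thr A" using f cl_subset by blast
  have ff_reach: "(f, y) \<in> (chn A)\<^sup>*" if "y \<in> cl f" for y
  proof -
    have "(f, y) \<in> (chn A)\<^sup>* \<or> (y, f) \<in> (chn A)\<^sup>*" using that rel_comparable by blast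
    moreover have "y = f" if "(y, f) \<in> (chn A)\<^sup>*" using that f(2) by (metis (no_types, lifting) firsts_def mem_Collect_eq rtranclE)
    ultimately show ?thesis by auto
  qed
  have "\<exists>e\<in>cl f. \<forall>y. (e, y) \<notin> chn A"
  proof (rule ccontr)
    assume "\<not> ?thesis"
    then have "\<forall>e\<in>cl f. \<exists>y. (e, y) \<in> chn A" by blast
    then obtain g where g: "\<And>e. e \<in> cl f \<Longrightarrow> (e, g e) \<in> chn A" by metis
    have "inj_on g (cl f)"
      using g by (intro inj_onI) (metis converse_iff single_valuedD single_valued_chn_converse)
    moreover have "g ` cl f \<subseteq> cl f" using g chn_rel rel_trans by blast
    ultimately have "g ` cl f = cl f" using finite_cl endo_inj_surj by blast
    moreover have "f \<in> cl f" using ff rel_refl by blast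
    ultimately obtain y where "y \<in> cl f" "f = g y" by (metis imageE)
    then show False using g f(2) by (auto simp: firsts_def)
  qed
  then obtain e where e: "e \<in> cl f" "\<And>y. (e, y) \<notin> chn A" by blast
  have "chain A (cl f) f e"
  proof
    show "(y, e) \<in> (chn A)\<^sup>*" if "y \<in> cl f" for y
    proof -
      have "(y, e) \<in> clsrel A" using that e rel_trans rel_sym by blast
      then have "(y, e) \<in> (chn A)\<^sup>* \<or> (e, y) \<in> (chn A)\<^sup>*" by (rule rel_comparable)
      moreover have "y = e" if "(e, y) \<in> (chn A)\<^sup>*" using that e(2) by (metis converse_rtranclE)
      ultimately show ?thesis by auto
    qed
    show "(y, z) \<in> chn A \<Longrightarrow> (y \<in> cl f) = (z \<in> cl f)" for y z
      using chn_rel rel_trans rel_sym by blast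
  qed (use ff rel_refl e f(2) cl_subset ff_reach in \<open>auto simp: firsts_def\<close>)
  moreover have "e \<in> lasts A" using e cl_subset by (auto simp: lasts_def)
  ultimately show thesis using that cl by simp
qed

lemma last_chain:
  assumes "e \<in> cl x" "e \<in> lasts A"
  obtains f where "chain A (cl x) f e" "f \<in> firsts A"
proof -
  obtain f where f: "chain (A\<inverse>) (cl x) e f" "f \<in> lasts (A\<inverse>)"
    using geodetic_instance.first_chain[OF dual, of e x] assms
    by (auto simp: clsrel_converse firsts_converse)
  have "chain A (cl x) f e" using chain.dual[OF f(1)] by simp
  moreover have "f \<in> firsts A" using f(2) firsts_converse[of "A\<inverse>"] by simp
  ultimately show thesis using that by blast
qed

lemma cycle:
  assumes x: "x \<in> thr A" and no: "cl x \<inter> firsts A = {}"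
  shows "chain_cycle A (cl x)"
proof
  have nolast: "cl x \<inter> lasts A = {}"
  proof (rule ccontr)
    assume "\<not> ?thesis"
    then obtain e where e: "e \<in> cl x" "e \<in> lasts A" by blast
    obtain f where "chain A (cl x) f e" "f \<in> firsts A" using last_chain[OF e] .
    then show False using chain.ends(1) no by fast
  qed
  have pred: "\<exists>p\<in>cl x. (p, y) \<in> chn A" if y: "y \<in> cl x" for y
  proof -
    have "y \<in> thr A" using y rel_thr by blast
    then obtain p where "(p, y) \<in> chn A" using no y unfolding firsts_def by blast
    then show ?thesis using y chn_rel rel_sym rel_trans by blast
  qed
  have succ: "\<exists>p\<in>cl x. (y, p) \<in> chn A" if y: "y \<in> cl x" for y
  proof -
    have "y \<in> thr A" using y rel_thr by blast
    then obtain p where "(y, p) \<in> chn A" using nolast y unfolding lasts_def by blast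
    then show ?thesis using y chn_rel rel_sym rel_trans by blast
  qed
  show "y \<in> cl x \<longleftrightarrow> z \<in> cl x" if yz: "(y, z) \<in> A" for y z
  proof
    assume y: "y \<in> cl x"
    then obtain q where q: "q \<in> cl x" "(y, q) \<in> chn A" using succ by blast
    have "y \<in> thr A" using y cl_subset by blast
    then show "z \<in> cl x" using q yz by (auto simp: thr_def chn_def)
  next
    assume z: "z \<in> cl x"
    then obtain q where q: "q \<in> cl x" "(q, z) \<in> chn A" using pred by blast
    have "z \<in> thr A" using z cl_subset by blast
    then show "y \<in> cl x" using q yz by (auto simp: thr_def chn_def)
  qed
  show "cl x \<subseteq> thr A" by (rule cl_subset)
  fix y z assume yz: "y \<in> cl x" "z \<in> cl x"
  \<comment> \<open>The successor map permutes the finite set of vertices that \<open>y\<close>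
    reaches, so this set is closed under predecessors too and therefore exhausts the class.\<close>
  define Y where "Y = {z \<in> cl x. (y, z) \<in> (chn A)\<^sup>*}"
  obtain g where g: "\<And>u. u \<in> cl x \<Longrightarrow> g u \<in> cl x \<and> (u, g u) \<in> chn A" using succ by metis
  have "inj_on g Y"
    using g unfolding Y_def
    by (intro inj_onI) (metis (no_types, lifting) converse_iff mem_Collect_eq single_valuedD single_valued_chn_converse)
  moreover have "g ` Y \<subseteq> Y" using g by (auto simp: Y_def intro: rtrancl_into_rtrancl)
  moreover have "finite Y" unfolding Y_def by (rule finite_subset[OF _ finite_cl[of x]]) auto
  ultimately have Y: "g ` Y = Y" using endo_inj_surj by blast
  have backward: "u \<in> Y" if "(u, y) \<in> (chn A)\<^sup>*" for u
    using that
  proof (induction rule: converse_rtrancl_induct)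
    case base
    then show ?case using yz by (auto simp: Y_def)
  next
    case (step u v)
    then obtain t where t: "t \<in> Y" "v = g t" using Y by blast
    then have "(t, v) \<in> chn A" using g by (auto simp: Y_def)
    then have "t = u" using step single_valued_chn_converse
      by (metis converse_iff single_valuedD)
    then show ?case using t by simp
  qed
  have "(y, z) \<in> clsrel A" using yz rel_sym rel_trans by blast
  then show "(y, z) \<in> (chn A)\<^sup>*"
    using rel_comparable backward[of z] by (auto simp: Y_def)
qed

lemma branching_class: "(x, y) \<in> clsrel A \<Longrightarrow> x \<in> branching A \<longleftrightarrow> y \<in> branching A"
  unfolding branching_def using rel_sym rel_trans by blast

lemma leader_exists:
  assumes "cl x \<inter> Y \<noteq> {}"
  obtains c where "c \<in> cl x \<inter> Y" "c \<in> leaders A Y"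
proof -
  have fin: "finite (cl x \<inter> Y)" using finite_cl by blast
  have c: "Min (cl x \<inter> Y) \<in> cl x \<inter> Y" using fin assms by (rule Min_in)
  have "Min (cl x \<inter> Y) \<le> y" if "y \<in> Y" "(Min (cl x \<inter> Y), y) \<in> clsrel A" for y
    using that c rel_trans by (intro Min_le[OF fin]) blast
  then have "Min (cl x \<inter> Y) \<in> leaders A Y"
    using c rel_thr unfolding leaders_def by blast
  then show thesis using that c by blast
qed

lemmas leader_unique = leaders_unique[of _ A]

text \<open>A condition on the class of \<open>x\<close> only, so that normalising another class
  does not disturb it.\<close>

definition normal :: "'a \<Rightarrow> 'a set \<Rightarrow> bool" where
  "normal x S \<longleftrightarrow> S \<inter> cl x \<subseteq> candidates A P Q \<union> picks V A P Q \<and> picks V A P Q \<inter> cl x \<subseteq> S"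

lemma normalize_branching:
  assumes S: "finite S" "feasible V A P Q S" and x: "x \<in> branching A"
  obtains S' where "feasible V A P Q S'" "card S' \<le> card S" "S' - cl x = S - cl x" "normal x S'"
proof -
  obtain f e where ch: "chain A (cl x) f e" "f \<in> firsts A" "e \<in> lasts A"
  proof -
    obtain y where y: "y \<in> cl x" "y \<in> firsts A \<or> y \<in> lasts A"
      using x unfolding branching_def by blast
    then show thesis using first_chain[of y x] last_chain[of y x] that by metis
  qed
  have brn: "y \<in> branching A" if "y \<in> cl x" for y using branching_class that x by blast
  \<comment> \<open>The leading pivot depends on the class alone; if there is no pivot,
    \<open>c\<close> is arbitrary and disappears in the intersection with
    \<open>pivot A P Q\<close>.\<close>
  obtain c where c: "cl x \<inter> pivot A P Q \<noteq> {} \<Longrightarrow> c \<in> cl x \<inter> pivot A P Q \<and> c \<in> leaders A (pivot A P Q)"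
    using leader_exists by metis
  obtain S' where S': "feasible V A P Q S'" "card S' \<le> card S" "S' - cl x = S - cl x"
    "S' \<inter> cl x \<subseteq> {f, e} \<union> ({c} \<inter> pivot A P Q)"
    by (rule chain.exchange_branching[OF ch(1) S cl_subset(2)[of x] arcs loopless]) (use c in auto)
  have "picks V A P Q \<inter> cl x = {}" using brn by (auto simp: picks_def)
  moreover have "S' \<inter> cl x \<subseteq> candidates A P Q"
    using S'(4) brn c ch(2,3) unfolding candidates_def by blast
  ultimately have "normal x S'" by (auto simp: normal_def)
  then show thesis using that S'(1-3) by blast
qed

lemma normalize_source_sink:
  assumes S: "finite S" "feasible V A P Q S" and x: "x \<in> thr A" "x \<notin> branching A"
    and f: "f \<in> cl x" "f \<in> firsts A"
  obtains S' where "feasible V A P Q S'" "card S' \<le> card S" "S' - cl x = S - cl x" "normal x S'"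
proof -
  obtain e where ch: "chain A (cl x) f e" "e \<in> lasts A" using first_chain[OF f] .
  have e: "e \<in> cl x" using ch(1) by (rule chain.ends)
  have brn: "y \<notin> branching A" if "y \<in> cl x" for y using branching_class that x by blast
  obtain u w where u: "(u, f) \<in> A" and w: "(e, w) \<in> A"
    using f ch(2) by (auto simp: firsts_def lasts_def thr_def)
  have u': "\<And>z. (z, u) \<notin> A" using x f u unfolding branching_def by blast
  have w': "\<And>z. (w, z) \<notin> A" using x e w ch(2) unfolding branching_def by blast
  define U where "U = (if cl x \<subseteq> cov A P Q (forced V A P Q) then {} else {f})"
  have firsts: "y = f" if "y \<in> cl x" "y \<in> firsts A" for y
    using that chain.from_first[OF ch(1) that(1)] by (metis (no_types, lifting) firsts_def mem_Collect_eq rtranclE)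
  have nofirst: "cl y \<inter> firsts A \<noteq> {}" if "y \<in> cl x" for y
    using that f rel_class by blast
  have picks: "picks V A P Q \<inter> cl x = U"
  proof
    show "picks V A P Q \<inter> cl x \<subseteq> U"
    proof
      fix y assume y: "y \<in> picks V A P Q \<inter> cl x"
      then have "y \<in> firsts A" "\<not> cl y \<subseteq> cov A P Q (forced V A P Q)"
        using nofirst unfolding picks_def by blast+
      moreover have "cl y = cl x" using y rel_class by blast
      ultimately show "y \<in> U" using firsts y by (auto simp: U_def)
    qed
    have "f \<in> picks V A P Q" if "\<not> cl x \<subseteq> cov A P Q (forced V A P Q)"
    proof -
      have "cl f = cl x" using f rel_class by blast
      then show ?thesis using that f brn unfolding picks_def firsts_def by blast
    qed
    then show "U \<subseteq> picks V A P Q \<inter> cl x" using f by (auto simp: U_def)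
  qed
  have "feasible V A P Q ((S - cl x) \<union> U)"
    by (rule chain.exchange_source_sink[OF ch(1) u u' w w' arcs S(2)]) (use f in \<open>auto simp: U_def\<close>)
  moreover have "card ((S - cl x) \<union> U) \<le> card S"
  proof (cases "cl x \<subseteq> cov A P Q (forced V A P Q)")
    case True
    then show ?thesis using S by (auto simp: U_def intro: card_mono)
  next
    case False
    then have "S \<inter> cl x \<noteq> {}"
      using chain.uncovered_nonempty[OF ch(1) u u' w w' arcs S(2) cl_subset(2)] by blast
    then show ?thesis using chain.card_exchange[OF ch(1) S(1)] False by (simp add: U_def)
  qed
  moreover have "(S - cl x \<union> U) \<inter> cl x = U" "(S - cl x \<union> U) - cl x = S - cl x"
    using f by (auto simp: U_def)
  ultimately show thesis using that picks unfolding normal_def by (metis inf_le1 le_supI2 sup_ge2)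
qed

lemma normalize_cycle:
  assumes S: "finite S" "feasible V A P Q S" and x: "x \<in> thr A" and no: "cl x \<inter> firsts A = {}"
  obtains S' where "feasible V A P Q S'" "card S' \<le> card S" "S' - cl x = S - cl x" "normal x S'"
proof -
  note result = that
  interpret chain_cycle A "cl x" using x no by (rule cycle)
  let ?C = "cov A P Q (forced V A P Q)"
  have xx: "x \<in> cl x" using x rel_refl by blast
  have nolast: "cl x \<inter> lasts A = {}"
  proof (rule ccontr)
    assume "\<not> ?thesis"
    then obtain e where e: "e \<in> cl x" "e \<in> lasts A" by blast
    obtain f where "chain A (cl x) f e" "f \<in> firsts A" using last_chain[OF e] .
    then show False using chain.ends(1) no by fast
  qed
  have same: "cl y = cl x" if "y \<in> cl x" for y using that rel_class by blast
  have brn: "y \<notin> branching A" if "y \<in> cl x" for y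
    using no nolast same[OF that] unfolding branching_def by blast
  have picks: "picks V A P Q \<inter> cl x = (if cl x \<subseteq> ?C then {} else
      if cl x \<inter> pivot A P Q \<noteq> {} then leaders A (pivot A P Q) \<inter> cl x
      else {y \<in> cl x. y \<in> leaders A UNIV \<or> (\<exists>z \<in> leaders A UNIV. (z, y) \<in> A)})" (is "?L = ?R")
  proof (rule set_eqI)
    fix y
    show "y \<in> ?L \<longleftrightarrow> y \<in> ?R"
    proof (cases "y \<in> cl x")
      case True
      have y: "y \<in> thr A" "y \<notin> branching A" "y \<notin> firsts A"
        using True brn no rel_thr by blast+
      have "y \<in> picks V A P Q \<longleftrightarrow> \<not> cl y \<subseteq> ?C \<and> (y \<in> leaders A (pivot A P Q) \<or>
          cl y \<inter> pivot A P Q = {} \<and> (y \<in> leaders A UNIV \<or> (\<exists>z \<in> leaders A UNIV. (z, y) \<in> A)))"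
        using y no unfolding picks_def same[OF True, symmetric] by blast
      also have "cl y = cl x" by (rule same[OF True])
      finally have *: "y \<in> picks V A P Q \<longleftrightarrow> \<not> cl x \<subseteq> ?C \<and> (y \<in> leaders A (pivot A P Q) \<or>
          cl x \<inter> pivot A P Q = {} \<and> (y \<in> leaders A UNIV \<or> (\<exists>z \<in> leaders A UNIV. (z, y) \<in> A)))" .
      have "y \<in> leaders A (pivot A P Q) \<Longrightarrow> y \<in> cl x \<inter> pivot A P Q"
        using True by (auto simp: leaders_def)
      then show ?thesis using True * by auto
    qed auto
  qed
  have fin: "finite (S - cl x)" using S by blast
  have *: thesis if U: "U = picks V A P Q \<inter> cl x" and cU: "card ((S - cl x) \<union> U) \<le> card S"
    and cov: "cl x \<subseteq> cov A P Q ((S - cl x) \<union> U)" for U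
  proof -
    have "(S - cl x \<union> U) \<inter> cl x = U" "(S - cl x \<union> U) - cl x = S - cl x" using U by auto
    then show thesis
      using result[of "S - cl x \<union> U"] exchange_cycle[OF S(2) _ cov] cU U unfolding normal_def by auto
  qed
  have card1: "card ((S - cl x) \<union> {c}) \<le> card S" if ne: "S \<inter> cl x \<noteq> {}" for c
  proof -
    have "card (S - cl x) < card S" by (rule psubset_card_mono) (use S ne in auto)
    then show ?thesis by (simp add: card_insert_if fin)
  qed
  have cover: "cl x \<subseteq> cov A P Q U" if "(c, p) \<in> A" "c \<in> cl x" "p \<in> P \<union> U" "c \<in> Q \<union> U" for c p U
    using cover_cycle[OF that(1,2)] that(3,4) unfolding cov_def by blast
  show thesis
  proof (cases "cl x \<subseteq> ?C")
    case True
    show thesis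
    proof (rule *[of "{}"])
      show "card (S - cl x \<union> {}) \<le> card S" using S by (auto intro: card_mono)
      have "forced V A P Q \<subseteq> S - cl x \<union> {}"
        using forced_subset[OF S(2)] through by (auto simp: forced_def thr_def)
      then show "cl x \<subseteq> cov A P Q (S - cl x \<union> {})" using True cov_mono by blast
    qed (use picks True in auto)
  next
    case F: False
    then have ne: "S \<inter> cl x \<noteq> {}" using uncovered_nonempty[OF S(2) cl_subset(2)] by blast
    show thesis
    proof (cases "cl x \<inter> pivot A P Q = {}")
      case False
      then obtain c where c: "c \<in> cl x \<inter> pivot A P Q" "c \<in> leaders A (pivot A P Q)"
        using leader_exists by metis
      have "leaders A (pivot A P Q) \<inter> cl x = {c}"
        using leader_unique c rel_sym rel_trans by blast
      moreover obtain y where "(c, y) \<in> chn A \<and> y \<in> P \<or> (y, c) \<in> chn A \<and> y \<in> Q"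
        using c by (auto simp: pivot_def)
      then have "cl x \<subseteq> cov A P Q (S - cl x \<union> {c})"
        using cover[of c y "S - cl x \<union> {c}"] cover[of y c "S - cl x \<union> {c}"] c isolated
        by (auto simp: chn_def)
      ultimately show thesis using *[of "{c}"] picks F False card1[OF ne] by simp
    next
      case True
      obtain c where c: "c \<in> cl x" "c \<in> leaders A UNIV"
        using leader_exists[of x UNIV] xx by blast
      obtain d where d: "(c, d) \<in> A" using c through by (auto simp: thr_def)
      then have "d \<in> cl x" using c isolated by blast
      have pc: "p = d" if "(c, p) \<in> A" for p using that d c through by (auto simp: thr_def)
      have "y = c" if "y \<in> cl x" "y \<in> leaders A UNIV" for y
        using leader_unique c that rel_sym rel_trans by blast
      then have "{y \<in> cl x. y \<in> leaders A UNIV \<or> (\<exists>z \<in> leaders A UNIV. (z, y) \<in> A)} = {c, d}"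
        using c d pc \<open>d \<in> cl x\<close> isolated by blast
      moreover have "cl x \<subseteq> cov A P Q (S - cl x \<union> {c, d})"
        using d c by (intro cover) auto
      moreover have "card (S - cl x \<union> {c, d}) \<le> card S"
      proof -
        obtain s s' where s: "s \<in> S \<inter> cl x" "s' \<in> S \<inter> cl x" "s \<noteq> s'"
          using no_pivot_two[OF S(2) cl_subset(2) _ loopless True] xx by blast
        have "card {s, s'} \<le> card (S \<inter> cl x)" by (rule card_mono) (use S s in auto)
        then have "card (S - cl x) + 2 \<le> card S"
          using card_Int_Diff[OF S(1), of "cl x"] s by simp
        moreover have "card ((S - cl x) \<union> {c, d}) \<le> card (S - cl x) + card {c, d}" by (rule card_Un_le)
        moreover have "card {c, d} \<le> 2" by (simp add: card_insert_if)
        ultimately show ?thesis by linarith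
      qed
      ultimately show thesis using *[of "{c, d}"] picks F True by simp
    qed
  qed
qed

text \<open>The classes are treated one after another; vertices of one class share the condition,
  and vertices outside \<open>thr A\<close> are never touched.\<close>

lemma normalize:
  assumes S: "finite S" "feasible V A P Q S" and "finite W" "W \<subseteq> thr A"
  shows "\<exists>S'. finite S' \<and> feasible V A P Q S' \<and> card S' \<le> card S \<and> S' - thr A = S - thr A \<and>
    (\<forall>x\<in>W. normal x S')"
  using assms(3,4)
proof (induction W rule: finite_induct)
  case empty
  then show ?case using S by blast
next
  case (insert x W)
  then obtain S' where S': "finite S'" "feasible V A P Q S'" "card S' \<le> card S"
    "S' - thr A = S - thr A" "\<forall>x\<in>W. normal x S'" by auto
  have x: "x \<in> thr A" using insert by blast
  obtain S'' where S'': "feasible V A P Q S''" "card S'' \<le> card S'" "S'' - cl x = S' - cl x" "normal x S''"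
  proof (cases "x \<in> branching A")
    case True
    then show thesis using normalize_branching[OF S'(1,2)] that by blast
  next
    case False
    then show thesis
      using normalize_source_sink[OF S'(1,2) x False] normalize_cycle[OF S'(1,2) x] that by blast
  qed
  have "finite (S'' - cl x)" using S'(1) S''(3) by simp
  then have "finite S''" using finite_cl[of x] finite_Diff2 by blast
  moreover have "S'' - thr A = S - thr A" using S''(3) S'(4) cl_subset(1)[of x] by blast
  moreover have "normal y S''" if y: "y \<in> W" for y
  proof (cases "(x, y) \<in> clsrel A")
    case True
    then have "cl x = cl y" by (rule rel_class)
    then show ?thesis using S''(4) unfolding normal_def by simp
  next
    case False
    then have "cl y \<inter> cl x = {}" using rel_sym rel_trans by blast
    then show ?thesis using S'(5) S''(3) y unfolding normal_def by blast
  qed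
  ultimately show ?case using S'' S'(3) by (intro exI[of _ S'']) auto
qed

lemma sets_subset: "forced V A P Q \<subseteq> V" "picks V A P Q \<subseteq> V" "candidates A P Q \<subseteq> V"
  using thr_V arcs by (auto simp: forced_def picks_def candidates_def firsts_def lasts_def leaders_def)

text \<open>A minimum solution contains no removable vertex, so outside \<open>thr A\<close> it
  consists of forced vertices and candidates. Normalisation then changes only through vertices and
  does not increase the size.\<close>

theorem optimum_from_candidates:
  "(\<exists>S\<subseteq>V. feasible V A P Q S \<and> card S \<le> k) \<longleftrightarrow>
   (\<exists>T\<subseteq>candidates A P Q. feasible V A P Q (forced V A P Q \<union> picks V A P Q \<union> T) \<and>
      card (forced V A P Q \<union> picks V A P Q \<union> T) \<le> k)" (is "?L \<longleftrightarrow> ?R")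
proof
  assume ?R
  then obtain T where "T \<subseteq> candidates A P Q" "feasible V A P Q (forced V A P Q \<union> picks V A P Q \<union> T)"
      "card (forced V A P Q \<union> picks V A P Q \<union> T) \<le> k" by blast
  then show ?L using sets_subset by (intro exI[of _ "forced V A P Q \<union> picks V A P Q \<union> T"]) auto
next
  assume ?L
  then obtain S0 where S0: "S0 \<subseteq> V \<and> feasible V A P Q S0" "card S0 \<le> k" by blast
  define S where "S = arg_min card (\<lambda>S. S \<subseteq> V \<and> feasible V A P Q S)"
  have S: "S \<subseteq> V" "feasible V A P Q S"
    using arg_min_natI[of "\<lambda>S. S \<subseteq> V \<and> feasible V A P Q S", OF S0(1)] by (auto simp: S_def)
  have min: "card S \<le> card S'" if "S' \<subseteq> V" "feasible V A P Q S'" for S'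
    using arg_min_nat_le[of "\<lambda>S. S \<subseteq> V \<and> feasible V A P Q S" S' card] that by (auto simp: S_def)
  have fS: "finite S" using S(1) finite_V finite_subset by blast
  have out: "v \<in> forced V A P Q \<or> v \<in> candidates A P Q" if v: "v \<in> S" "v \<notin> thr A" for v
  proof (rule ccontr)
    assume "\<not> ?thesis"
    then have "v \<notin> forced V A P Q" "(\<forall>z. (z, v) \<notin> A) \<or> (\<forall>z. (v, z) \<notin> A)"
      using v by (auto simp: candidates_def)
    then have "feasible V A P Q (S - {v})"
      using feasible_remove[OF S(2) _ _ _ arcs] v S(1) by blast
    then have "card S \<le> card (S - {v})" using S(1) by (intro min) auto
    then show False using card_Diff1_less[OF fS v(1)] by simp
  qed
  obtain S' where S': "finite S'" "feasible V A P Q S'" "card S' \<le> card S" "S' - thr A = S - thr A"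
    "\<forall>x\<in>thr A. normal x S'"
    using normalize[OF fS S(2), of "thr A"] thr_V finite_V finite_subset by blast
  have n: "v \<in> S' \<longrightarrow> v \<in> candidates A P Q \<union> picks V A P Q" "v \<in> picks V A P Q \<longrightarrow> v \<in> S'"
    if "v \<in> thr A" for v
    using S'(5) rel_refl that unfolding normal_def by blast+
  have "picks V A P Q \<subseteq> S'" using n(2) by (auto simp: picks_def)
  moreover have "forced V A P Q \<subseteq> S'" using forced_subset[OF S'(2)] .
  moreover have "S' \<subseteq> forced V A P Q \<union> picks V A P Q \<union> candidates A P Q"
    using n(1) out S'(4) by blast
  ultimately have "forced V A P Q \<union> picks V A P Q \<union> (S' \<inter> candidates A P Q) = S'" by blast
  moreover have "card S' \<le> k" using S'(3) min[of S0] S0 by auto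
  ultimately show ?R using S'(2) by (intro exI[of _ "S' \<inter> candidates A P Q"]) auto
qed

end

section \<open>Cutting the digraph at its bridges\<close>

definition bridges :: "('a \<times> 'a) set \<Rightarrow> ('a \<times> 'a) set" where
  "bridges A = {a \<in> A. a \<notin> ((A - {a}) \<union> (A - {a})\<inverse>)\<^sup>*}"

abbreviation inner :: "('a \<times> 'a) set \<Rightarrow> ('a \<times> 'a) set" where
  "inner A \<equiv> A - bridges A"

text \<open>The component of the tail in the underlying graph without the arc; a bridge is the only
  arc that crosses its boundary, and only outwards.\<close>

definition side :: "('a \<times> 'a) set \<Rightarrow> 'a \<Rightarrow> 'a \<Rightarrow> 'a set" where
  "side A c y = {z. (c, z) \<in> ((A - {(c, y)}) \<union> (A - {(c, y)})\<inverse>)\<^sup>*}"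

lemma bridges_converse: "bridges (A\<inverse>) = (bridges A)\<inverse>"
proof -
  have "(y, x) \<in> bridges (A\<inverse>)" if "(x, y) \<in> bridges A" for x y and A :: "('a \<times> 'a) set"
  proof -
    let ?E = "(A - {(x, y)}) \<union> (A - {(x, y)})\<inverse>"
    have "A\<inverse> - {(y, x)} = (A - {(x, y)})\<inverse>" by auto
    then have E: "(A\<inverse> - {(y, x)}) \<union> (A\<inverse> - {(y, x)})\<inverse> = ?E" by (simp add: Un_commute)
    have "sym (?E\<^sup>*)" by (intro sym_rtrancl) (auto simp: sym_def)
    then have "(y, x) \<notin> ?E\<^sup>*" using that by (auto simp: bridges_def dest: symD)
    then show ?thesis using that unfolding bridges_def E mem_Collect_eq by simp
  qed
  from this[of _ _ A] this[of _ _ "A\<inverse>"] show ?thesis by auto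
qed

lemma side_arc: "(p, q) \<in> A \<Longrightarrow> (p, q) \<noteq> (c, y) \<Longrightarrow> p \<in> side A c y \<longleftrightarrow> q \<in> side A c y"
  unfolding side_def by (auto intro: rtrancl_into_rtrancl)

lemma side_tail: "c \<in> side A c y"
  by (simp add: side_def)

lemma side_head: "(c, y) \<in> bridges A \<Longrightarrow> y \<notin> side A c y"
  by (simp add: side_def bridges_def)

lemma outside_closed:
  assumes "(c, y) \<in> bridges A" "(s, t) \<in> A\<^sup>*" "t \<in> side A c y"
  shows "s \<in> side A c y"
  using assms(2,3)
proof (induction rule: converse_rtrancl_induct)
  case (step s z)
  then show ?case using side_arc[of s z A c y] side_tail by fast
qed

lemma via_bridge:
  assumes "(c, y) \<in> bridges A" "s \<in> side A c y" "t \<notin> side A c y"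
  shows "via A s y t"
  unfolding via_def
proof (intro allI impI)
  fix k assume "(s, t) \<in> A ^^ k"
  then show "\<exists>k1 k2. k = k1 + k2 \<and> (s, y) \<in> A ^^ k1 \<and> (y, t) \<in> A ^^ k2"
    using assms(2)
  proof (induction k arbitrary: s)
    case 0
    then show ?case using assms(3) by auto
  next
    case (Suc k)
    then obtain z where z: "(s, z) \<in> A" "(z, t) \<in> A ^^ k" by (meson relpow_Suc_D2)
    show ?case
    proof (cases "(s, z) = (c, y)")
      case True
      then show ?thesis using z by (intro exI[of _ 1] exI[of _ k]) auto
    next
      case False
      then have "z \<in> side A c y" using side_arc z Suc.prems by fast
      then obtain k1 k2 where "k = k1 + k2" "(z, y) \<in> A ^^ k1" "(y, t) \<in> A ^^ k2"
        using Suc.IH z by blast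
      then show ?thesis using relpow_Suc_I2[OF z(1)] by (intro exI[of _ "Suc k1"] exI[of _ k2]) auto
    qed
  qed
qed

lemma inner_reach: "(x, y) \<in> (inner A)\<^sup>* \<Longrightarrow> (x, y) \<in> A\<^sup>*"
  using rtrancl_mono[of "inner A" A] by blast

lemma inner_side:
  assumes "(c, y) \<in> bridges A" "(s, t) \<in> (inner A)\<^sup>*"
  shows "s \<in> side A c y \<longleftrightarrow> t \<in> side A c y"
  using assms(2)
proof (induction rule: rtrancl_induct)
  case (step u v)
  then show ?case using side_arc[of u v A c y] assms(1) by auto
qed simp

text \<open>A walk over a bridge changes sides for good, whereas a connection inside
  \<open>inner A\<close> shows that both ends lie on the same side of every bridge. So deleting the
  bridges changes no distance between vertices that stay connected.\<close>

lemma inner_walk: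
  assumes "(s, t) \<in> (inner A)\<^sup>*" "(s, t) \<in> A ^^ k"
  shows "(s, t) \<in> (inner A) ^^ k"
proof -
  obtain g where g: "g 0 = s" "g k = t" "\<And>i. i < k \<Longrightarrow> (g i, g (Suc i)) \<in> A"
    using assms(2) by (auto simp: relpow_fun_conv)
  have reach: "i \<le> j \<Longrightarrow> j \<le> k \<Longrightarrow> (g i, g j) \<in> A\<^sup>*" for i j
  proof (induction j)
    case (Suc j)
    then show ?case using g(3)[of j] by (cases "i = Suc j") (auto intro: rtrancl_into_rtrancl)
  qed simp
  have "(g i, g (Suc i)) \<in> inner A" if i: "i < k" for i
  proof (rule ccontr)
    assume "\<not> ?thesis"
    then have b: "(g i, g (Suc i)) \<in> bridges A" using g(3)[OF i] by blast
    have "(s, g i) \<in> A\<^sup>*" "(g (Suc i), t) \<in> A\<^sup>*" using reach[of 0 i] reach[of "Suc i" k] g i by auto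
    then have "s \<in> side A (g i) (g (Suc i))" "t \<notin> side A (g i) (g (Suc i))"
      using outside_closed[OF b] side_tail side_head[OF b] by fast+
    then show False using inner_side[OF b assms(1)] by blast
  qed
  then show ?thesis unfolding relpow_fun_conv using g by (intro exI[of _ g]) auto
qed

lemma relpow_mono:
  fixes A :: "('a \<times> 'a) set"
  shows "A \<subseteq> B \<Longrightarrow> (x, y) \<in> A ^^ k \<Longrightarrow> (x, y) \<in> B ^^ k"
  unfolding relpow_fun_conv by blast

lemma btw_inner: "btw (inner A) s w t \<longleftrightarrow> btw A s w t \<and> (s, w) \<in> (inner A)\<^sup>* \<and> (w, t) \<in> (inner A)\<^sup>*"
proof
  assume b: "btw (inner A) s w t"
  then have r: "(s, w) \<in> (inner A)\<^sup>* \<and> (w, t) \<in> (inner A)\<^sup>*" by (rule btw_reach)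
  then have st: "(s, t) \<in> (inner A)\<^sup>*" by auto
  obtain i j where ij: "(s, w) \<in> inner A ^^ i" "(w, t) \<in> inner A ^^ j"
      "\<And>k. (s, t) \<in> inner A ^^ k \<Longrightarrow> i + j \<le> k"
    using b unfolding btw_def by blast
  have "btw A s w t"
    unfolding btw_def using ij(1,2)[THEN relpow_mono[of "inner A" A, OF Diff_subset]] ij(3) inner_walk[OF st] by blast
  then show "btw A s w t \<and> (s, w) \<in> (inner A)\<^sup>* \<and> (w, t) \<in> (inner A)\<^sup>*" using r by blast
next
  assume b: "btw A s w t \<and> (s, w) \<in> (inner A)\<^sup>* \<and> (w, t) \<in> (inner A)\<^sup>*"
  then obtain i j where ij: "(s, w) \<in> A ^^ i" "(w, t) \<in> A ^^ j" "\<And>k. (s, t) \<in> A ^^ k \<Longrightarrow> i + j \<le> k"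
    unfolding btw_def by blast
  show "btw (inner A) s w t"
    unfolding btw_def using ij inner_walk b relpow_mono[of "inner A" A, OF Diff_subset] by metis
qed

lemma btw_step_start: "btw A s w t \<Longrightarrow> (s, w) \<in> A ^^ Suc i \<Longrightarrow>
    (\<And>k. (s, w) \<in> A ^^ k \<Longrightarrow> Suc i \<le> k) \<Longrightarrow> \<exists>z. (s, z) \<in> A \<and> (z, w) \<in> A ^^ i \<and> btw A z w t"
proof -
  assume b: "btw A s w t" and i: "(s, w) \<in> A ^^ Suc i" "\<And>k. (s, w) \<in> A ^^ k \<Longrightarrow> Suc i \<le> k"
  obtain z where z: "(s, z) \<in> A" "(z, w) \<in> A ^^ i" using i(1) by (meson relpow_Suc_D2)
  obtain i' j where ij: "(s, w) \<in> A ^^ i'" "(w, t) \<in> A ^^ j" "\<And>k. (s, t) \<in> A ^^ k \<Longrightarrow> i' + j \<le> k"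
    using b unfolding btw_def by blast
  have "i + j \<le> k" if "(z, t) \<in> A ^^ k" for k
    using ij(3)[OF relpow_Suc_I2[OF z(1) that]] i(2)[OF ij(1)] by simp
  then have "btw A z w t" using z(2) ij(2) unfolding btw_def by blast
  then show ?thesis using z by blast
qed

text \<open>The head of the last bridge before \<open>w\<close> can take the place of
  \<open>s\<close>. The induction is on the distance from \<open>s\<close> to
  \<open>w\<close>.\<close>

lemma inner_start:
  assumes "btw A s w t"
  shows "\<exists>s'\<in>{s} \<union> snd ` bridges A. btw A s' w t \<and> (s', w) \<in> (inner A)\<^sup>*"
proof -
  have "(s, w) \<in> A\<^sup>*" using assms btw_reach by fast
  then obtain i where i: "(s, w) \<in> A ^^ i" "\<And>k. (s, w) \<in> A ^^ k \<Longrightarrow> i \<le> k"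
    using shortest_walkE by metis
  show ?thesis using assms i
  proof (induction i arbitrary: s)
    case 0
    then show ?case by auto
  next
    case (Suc i)
    obtain z where z: "(s, z) \<in> A" "(z, w) \<in> A ^^ i" "btw A z w t"
      using btw_step_start[OF Suc.prems] by blast
    have "i \<le> k" if "(z, w) \<in> A ^^ k" for k
      using Suc.prems(3)[OF relpow_Suc_I2[OF z(1) that]] by simp
    then obtain s' where s': "s' \<in> {z} \<union> snd ` bridges A" "btw A s' w t" "(s', w) \<in> (inner A)\<^sup>*"
      using Suc.IH[OF z(3,2)] by blast
    show ?case
    proof (cases "s' \<in> snd ` bridges A")
      case False
      then have "s' = z" using s' by blast
      show ?thesis
      proof (cases "(s, z) \<in> bridges A")
        case True
        then have "z \<in> snd ` bridges A" by (metis image_eqI snd_conv)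
        then show ?thesis using s' \<open>s' = z\<close> by blast
      next
        case False
        then have "(s, w) \<in> (inner A)\<^sup>*" using z s' \<open>s' = z\<close> by (meson DiffI converse_rtrancl_into_rtrancl)
        then show ?thesis using Suc.prems by blast
      qed
    qed (use s' in blast)
  qed
qed

lemma snd_bridges_converse: "snd ` bridges (A\<inverse>) = fst ` bridges A"
  by (force simp: bridges_converse)

lemma inner_converse: "inner (A\<inverse>) = (inner A)\<inverse>"
  by (auto simp: bridges_converse)

lemma inner_end:
  assumes "btw A s w t"
  shows "\<exists>t'\<in>{t} \<union> fst ` bridges A. btw A s w t' \<and> (w, t') \<in> (inner A)\<^sup>*"
  using inner_start[of "A\<inverse>" t w s] assms
  unfolding snd_bridges_converse inner_converse rtrancl_converse btw_converse by simp

text \<open>In the cut digraph the tail \<open>c\<close> is covered from \<open>S\<close> or from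
  the head of another bridge. In the second case the tail of that bridge has strictly fewer
  ancestors than \<open>c\<close>, because \<open>c\<close> cannot go back over it; so the search
  ends in \<open>S\<close>.\<close>

lemma bridge_served:
  assumes A: "finite A" "A \<subseteq> V \<times> V"
    and S: "feasible V (inner A) (snd ` bridges A) (fst ` bridges A) S"
    and "(c, y) \<in> bridges A"
  shows "\<exists>a\<in>S. (a, c) \<in> A\<^sup>*"
  using assms(4)
proof (induction "card {z. (z, c) \<in> A\<^sup>*}" arbitrary: c y rule: less_induct)
  case less
  have "c \<in> V" using less.prems A by (auto simp: bridges_def)
  then obtain s t where st: "s \<in> S \<union> snd ` bridges A" "btw (inner A) s c t"
    using S unfolding feasible_def by blast
  have sc: "(s, c) \<in> A\<^sup>*" using st(2) btw_reach inner_reach by fast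
  show ?case
  proof (cases "s \<in> S")
    case True
    then show ?thesis using sc by blast
  next
    case False
    then obtain b where b: "(b, s) \<in> bridges A" using st by auto
    then have bs: "(b, s) \<in> A" by (simp add: bridges_def)
    have fin: "finite {z. (z, c) \<in> A\<^sup>*}"
    proof (rule finite_subset)
      show "{z. (z, c) \<in> A\<^sup>*} \<subseteq> insert c (Domain A)" by (auto elim: converse_rtranclE)
    qed (use A finite_Domain in auto)
    have "(c, b) \<notin> A\<^sup>*"
      using outside_closed[OF b, of s b] side_tail[of b A s] side_head[OF b] sc by (meson rtrancl_trans)
    then have "{z. (z, b) \<in> A\<^sup>*} \<subset> {z. (z, c) \<in> A\<^sup>*}"
      using bs sc by (auto intro: rtrancl_trans converse_rtrancl_into_rtrancl)
    then obtain a where "a \<in> S" "(a, b) \<in> A\<^sup>*"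
      using less.hyps[OF psubset_card_mono[OF fin] b] by blast
    then show ?thesis using bs sc by (meson rtrancl_trans converse_rtrancl_into_rtrancl)
  qed
qed

text \<open>The vertex of \<open>S\<close> that reaches the tail lies on the tail side and
  \<open>t\<close> on the head side, so the head \<open>y\<close> is unavoidable between
  them.\<close>

lemma extend_through_bridge:
  assumes "finite A" "A \<subseteq> V \<times> V" "feasible V (inner A) (snd ` bridges A) (fst ` bridges A) S"
    and "y \<in> snd ` bridges A" "btw A y w t"
  shows "\<exists>a\<in>S. btw A a w t"
proof -
  obtain c where c: "(c, y) \<in> bridges A" using assms(4) by auto
  obtain a where a: "a \<in> S" "(a, c) \<in> A\<^sup>*" using bridge_served[OF assms(1-3) c] by blast
  have "a \<in> side A c y" using outside_closed[OF c a(2)] side_tail by fast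
  moreover have "(y, t) \<in> A\<^sup>*" using btw_reach[OF assms(5)] by auto
  then have "t \<notin> side A c y" using outside_closed[OF c] side_head[OF c] by blast
  ultimately have "via A a y t" by (rule via_bridge[OF c])
  moreover have "(a, y) \<in> A\<^sup>*" using a c by (auto simp: bridges_def)
  ultimately show ?thesis using btw_extend_start[OF assms(5)] a by blast
qed

theorem feasible_inner:
  assumes A: "finite A" "A \<subseteq> V \<times> V"
  shows "feasible V (inner A) (snd ` bridges A) (fst ` bridges A) S \<longleftrightarrow> feasible V A {} {} S"
proof
  assume S: "feasible V A {} {} S"
  show "feasible V (inner A) (snd ` bridges A) (fst ` bridges A) S"
    unfolding feasible_def
  proof
    fix w assume "w \<in> V"
    then obtain s t where st: "s \<in> S" "t \<in> S" "btw A s w t" using S unfolding feasible_def by auto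
    obtain s' where s': "s' \<in> {s} \<union> snd ` bridges A" "btw A s' w t" "(s', w) \<in> (inner A)\<^sup>*"
      using inner_start[OF st(3)] by blast
    obtain t' where t': "t' \<in> {t} \<union> fst ` bridges A" "btw A s' w t'" "(w, t') \<in> (inner A)\<^sup>*"
      using inner_end[OF s'(2)] by blast
    have "btw (inner A) s' w t'" using s' t' by (simp add: btw_inner)
    then show "\<exists>s\<in>S \<union> snd ` bridges A. \<exists>t\<in>S \<union> fst ` bridges A. btw (inner A) s w t"
      using s' t' st by blast
  qed
next
  assume S: "feasible V (inner A) (snd ` bridges A) (fst ` bridges A) S"
  have A': "finite (A\<inverse>)" "A\<inverse> \<subseteq> V \<times> V" using A by auto
  have S': "feasible V (inner (A\<inverse>)) (snd ` bridges (A\<inverse>)) (fst ` bridges (A\<inverse>)) S"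
    using S feasible_converse[of V "inner A" "fst ` bridges A" "snd ` bridges A" S]
      snd_bridges_converse[of A] snd_bridges_converse[of "A\<inverse>"]
    by (simp add: inner_converse)
  show "feasible V A {} {} S"
    unfolding feasible_def
  proof
    fix w assume "w \<in> V"
    then obtain s t where st: "s \<in> S \<union> snd ` bridges A" "t \<in> S \<union> fst ` bridges A" "btw (inner A) s w t"
      using S unfolding feasible_def by blast
    have "btw A s w t" using st(3) btw_inner by fast
    then obtain a where a: "a \<in> S" "btw A a w t"
      using st(1) extend_through_bridge[OF A S] by blast
    have "\<exists>b\<in>S. btw A a w b"
    proof (cases "t \<in> S")
      case False
      then have "t \<in> snd ` bridges (A\<inverse>)" using st(2) unfolding snd_bridges_converse by blast
      then show ?thesis
        using extend_through_bridge[OF A' S', of t w a] a(2) by (simp add: btw_converse)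
    qed (use a in blast)
    then show "\<exists>s\<in>S \<union> {}. \<exists>t\<in>S \<union> {}. btw A s w t" using a by blast
  qed
qed

section \<open>Geodetic sets\<close>

lemma dwalk_relpow: "dwalk A xs \<Longrightarrow> i \<le> j \<Longrightarrow> j < length xs \<Longrightarrow> (xs ! i, xs ! j) \<in> A ^^ (j - i)"
  unfolding relpow_fun_conv dwalk_def by (intro exI[of _ "\<lambda>m. xs ! (i + m)"]) auto

lemma relpow_dwalk:
  assumes "(u, w) \<in> A ^^ i" "(w, v) \<in> A ^^ j"
  obtains xs where "dwalk A xs" "hd xs = u" "last xs = v" "length xs = Suc (i + j)" "w \<in> set xs"
proof -
  obtain f where f: "f 0 = u" "f i = w" "\<And>m. m < i \<Longrightarrow> (f m, f (Suc m)) \<in> A"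
    using assms(1) by (auto simp: relpow_fun_conv)
  obtain g where g: "g 0 = w" "g j = v" "\<And>m. m < j \<Longrightarrow> (g m, g (Suc m)) \<in> A"
    using assms(2) by (auto simp: relpow_fun_conv)
  define h where "h m = (if m \<le> i then f m else g (m - i))" for m
  define xs where "xs = map h [0..<Suc (i + j)]"
  have "(h m, h (Suc m)) \<in> A" if m: "m < i + j" for m
  proof -
    consider "m < i" | "m = i" | "m > i" by linarith
    then show ?thesis
    proof cases
      case 1
      then show ?thesis using f by (simp add: h_def)
    next
      case 2
      then show ?thesis using f g(1) g(3)[of 0] m by (simp add: h_def)
    next
      case 3
      then show ?thesis using g(3)[of "m - i"] m by (simp add: h_def Suc_diff_le)
    qed
  qed
  then have "dwalk A xs" unfolding dwalk_def xs_def by (simp del: upt_Suc)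
  moreover have "hd xs = u" using f by (simp add: xs_def hd_map h_def del: upt_Suc)
  moreover have "last xs = v" using f g by (auto simp: xs_def h_def)
  moreover have "w \<in> set xs" unfolding xs_def using f by (auto simp: h_def image_iff intro!: bexI[of _ i])
  ultimately show thesis using that by (simp add: xs_def)
qed

lemma interval_btw: "interval A u v = {w. btw A u w v}"
proof (intro set_eqI iffI)
  fix w assume "w \<in> interval A u v"
  then obtain xs where xs: "shortest_dpath A u v xs" "w \<in> set xs" by (auto simp: interval_def)
  then obtain i where i: "i < length xs" "w = xs ! i" by (metis in_set_conv_nth)
  have d: "dwalk A xs" "xs ! 0 = u" "xs ! (length xs - 1) = v"
    using xs(1) by (auto simp: shortest_dpath_def dwalk_def hd_conv_nth last_conv_nth)
  have "(u, w) \<in> A ^^ i" using dwalk_relpow[OF d(1), of 0 i] d i by simp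
  moreover have "(w, v) \<in> A ^^ (length xs - 1 - i)"
    using dwalk_relpow[OF d(1), of i "length xs - 1"] d i by simp
  moreover have "i + (length xs - 1 - i) \<le> k" if walk: "(u, v) \<in> A ^^ k" for k
  proof -
    obtain ys where ys: "dwalk A ys" "hd ys = u" "last ys = v" "length ys = Suc k"
      using relpow_dwalk[where u = u and w = u and i = 0 and v = v and j = k and A = A] walk by auto
    then show ?thesis using xs(1) i by (auto simp: shortest_dpath_def)
  qed
  ultimately show "w \<in> {w. btw A u w v}" unfolding btw_def by blast
next
  fix w assume "w \<in> {w. btw A u w v}"
  then obtain i j where ij: "(u, w) \<in> A ^^ i" "(w, v) \<in> A ^^ j" "\<And>k. (u, v) \<in> A ^^ k \<Longrightarrow> i + j \<le> k"
    unfolding btw_def by blast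
  obtain xs where xs: "dwalk A xs" "hd xs = u" "last xs = v" "length xs = Suc (i + j)" "w \<in> set xs"
    by (rule relpow_dwalk[OF ij(1,2)])
  have "length xs \<le> length ys" if ys: "dwalk A ys" "hd ys = u" "last ys = v" for ys
  proof -
    have "(u, v) \<in> A ^^ (length ys - 1)"
      using dwalk_relpow[OF ys(1), of 0 "length ys - 1"] ys
      by (auto simp: dwalk_def hd_conv_nth last_conv_nth)
    then show ?thesis using ij(3)[of "length ys - 1"] xs(4) ys(1) by (cases ys) (auto simp: dwalk_def)
  qed
  then show "w \<in> interval A u v" using xs by (auto simp: interval_def shortest_dpath_def)
qed

lemma geodetic_set_feasible:
  assumes "A \<subseteq> {0..<n} \<times> {0..<n}"
  shows "geodetic_set n A S \<longleftrightarrow> S \<subseteq> {0..<n} \<and> feasible {0..<n} A {} {} S"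
proof -
  have "interval_set A S \<subseteq> {0..<n}" if "S \<subseteq> {0..<n}"
  proof
    fix w assume "w \<in> interval_set A S"
    then obtain u where "u \<in> S" "(u, w) \<in> A\<^sup>*"
      unfolding interval_set_def interval_btw using btw_reach by fast
    moreover from this have "u \<in> {0..<n}" using that by blast
    ultimately show "w \<in> {0..<n}" using assms by (metis SigmaD2 rtranclE subsetD)
  qed
  moreover have "feasible {0..<n} A {} {} S \<longleftrightarrow> {0..<n} \<subseteq> interval_set A S"
    unfolding feasible_def interval_set_def interval_btw by blast
  ultimately show ?thesis by (auto simp: geodetic_set_def)
qed

text \<open>Covering is monotone, so a smaller solution can be filled up to exactly \<open>k\<close>
  vertices as long as \<open>k \<le> n\<close>.\<close>

lemma has_geodetic_set_of_size_feasible: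
  assumes A: "A \<subseteq> {0..<n} \<times> {0..<n}"
  shows "has_geodetic_set_of_size n A k \<longleftrightarrow> k \<le> n \<and> (\<exists>S\<subseteq>{0..<n}. feasible {0..<n} A {} {} S \<and> card S \<le> k)"
    (is "?L \<longleftrightarrow> ?R")
proof
  assume ?L
  then obtain S where "S \<subseteq> {0..<n}" "feasible {0..<n} A {} {} S" "card S = k"
    by (auto simp: has_geodetic_set_of_size_def geodetic_set_feasible[OF A])
  moreover from this have "k \<le> n" using card_mono[of "{0..<n}" S] by simp
  ultimately show ?R by auto
next
  assume ?R
  then obtain S where S: "S \<subseteq> {0..<n}" "feasible {0..<n} A {} {} S" "card S \<le> k" "k \<le> n" by blast
  then obtain S' where S': "S \<subseteq> S'" "S' \<subseteq> {0..<n}" "card S' = k"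
    using exists_subset_between[of S k "{0..<n}"] by auto
  have "feasible {0..<n} A {} {} S'"
    using S(2) cov_mono[OF S'(1)] unfolding feasible_cov by blast
  then show ?L using S' by (auto simp: has_geodetic_set_of_size_def geodetic_set_feasible[OF A])
qed

section \<open>The number of candidates\<close>

definition simple_edges :: "'a set \<Rightarrow> 'a set set \<Rightarrow> bool" where
  "simple_edges V E \<longleftrightarrow> (\<forall>e\<in>E. \<exists>u\<in>V. \<exists>v\<in>V. u \<noteq> v \<and> e = {u, v})"

definition upath :: "nat set set \<Rightarrow> nat list \<Rightarrow> bool" where
  "upath E xs \<longleftrightarrow> xs \<noteq> [] \<and> distinct xs \<and> (\<forall>i. Suc i < length xs \<longrightarrow> {xs ! i, xs ! Suc i} \<in> E)"

text \<open>The first vertex of a longest path has a neighbour other than the second vertex; by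
  maximality this neighbour lies on the path, and it closes a cycle.\<close>

lemma two_edges_cycle:
  assumes V: "finite V" "V \<noteq> {}" and E: "simple_edges V E"
    and two: "\<And>v x. v \<in> V \<Longrightarrow> \<exists>e\<in>E. v \<in> e \<and> x \<notin> e - {v}"
  shows "\<not> forest E"
proof -
  let ?P = "\<lambda>xs. upath E xs \<and> set xs \<subseteq> V"
  obtain v where v: "v \<in> V" using V by blast
  have "?P [v]" using v by (simp add: upath_def)
  moreover have "length xs < Suc (card V)" if "?P xs" for xs
    using that card_mono[OF V(1), of "set xs"] by (simp add: upath_def distinct_card)
  ultimately obtain xs where xs: "?P xs" and max: "\<And>ys. ?P ys \<Longrightarrow> length ys \<le> length xs"
    using ex_has_greatest_nat[of ?P "[v]" length "Suc (card V)"] by (metis less_imp_le)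
  define x where "x = xs ! 0"
  have ne: "xs \<noteq> []" using xs by (simp add: upath_def)
  then have xV: "x \<in> V" using xs by (auto simp: x_def)
  \<comment> \<open>For a path with one vertex \<open>xs ! 1\<close> is unspecified; this is
    harmless, because position 0 is excluded for \<open>y\<close> anyway.\<close>
  obtain e where e: "e \<in> E" "x \<in> e" "xs ! 1 \<notin> e - {x}" using two[OF xV, of "xs ! 1"] by blast
  obtain y where y: "y \<in> V" "y \<noteq> x" "e = {x, y}"
    using E e unfolding simple_edges_def by fast
  have y1: "y \<noteq> xs ! 1" using e y by auto
  have "y \<in> set xs"
  proof (rule ccontr)
    assume "y \<notin> set xs"
    then have "?P (y # xs)"
      using xs y e ne by (auto simp: upath_def nth_Cons x_def insert_commute split: nat.splits)
    then show False using max[of "y # xs"] by simp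
  qed
  then obtain j where j: "j < length xs" "y = xs ! j" by (metis in_set_conv_nth)
  have "j \<noteq> 0" using y(2) j by (metis x_def)
  moreover have "j \<noteq> 1" using y1 j by metis
  ultimately have j2: "2 \<le> j" by linarith
  have "ucycle E (take (Suc j) xs)"
    unfolding ucycle_def
  proof (intro conjI allI impI)
    show "3 \<le> length (take (Suc j) xs)" using j j2 by simp
    show "distinct (take (Suc j) xs)" using xs by (simp add: upath_def)
    fix i assume i: "i < length (take (Suc j) xs)"
    have len: "length (take (Suc j) xs) = Suc j" using j by simp
    show "{take (Suc j) xs ! i, take (Suc j) xs ! (Suc i mod length (take (Suc j) xs))} \<in> E"
    proof (cases "i = j")
      case True
      then show ?thesis using e y j by (simp add: len x_def insert_commute)
    next
      case False
      then have "i < j" using i len by simp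
      then show ?thesis using xs j unfolding len by (simp add: upath_def)
    qed
  qed
  then show ?thesis by (auto simp: forest_def)
qed

lemma forest_subset: "forest E \<Longrightarrow> E' \<subseteq> E \<Longrightarrow> forest E'"
  by (auto simp: forest_def ucycle_def)

text \<open>Some vertex has at most one edge, by \<open>two_edges_cycle\<close>; it is removed
  together with that edge. Without the usual -1 the bound also holds for the empty vertex
  set.\<close>

lemma card_forest:
  assumes "finite V" "simple_edges V E" "forest E"
  shows "card E \<le> card V"
  using assms
proof (induction "card V" arbitrary: V E rule: less_induct)
  case less
  show ?case
  proof (cases "V = {}")
    case True
    then have "E = {}" using less.prems by (auto simp: simple_edges_def)
    then show ?thesis by simp
  next
    case False
    then obtain v x where v: "v \<in> V" and x: "\<And>e. e \<in> E \<Longrightarrow> v \<in> e \<Longrightarrow> x \<in> e - {v}"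
      using two_edges_cycle[OF less.prems(1) False less.prems(2)] less.prems(3) by metis
    define E' where "E' = {e \<in> E. v \<notin> e}"
    have "E \<subseteq> insert {v, x} E'"
    proof
      fix e assume e: "e \<in> E"
      show "e \<in> insert {v, x} E'"
      proof (cases "v \<in> e")
        case True
        then have "x \<in> e - {v}" using x e by blast
        then have "e = {v, x}" using True e less.prems(2) unfolding simple_edges_def by fast
        then show ?thesis by simp
      qed (use e in \<open>simp add: E'_def\<close>)
    qed
    moreover have E': "simple_edges (V - {v}) E'"
      using less.prems(2) unfolding simple_edges_def E'_def by fast
    moreover have fin: "finite E'"
    proof (rule finite_subset)
      show "E' \<subseteq> Pow V" using E' by (auto simp: simple_edges_def)
    qed (use less.prems in simp)
    ultimately have "card E \<le> card (insert {v, x} E')" by (intro card_mono) auto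
    also have "\<dots> \<le> Suc (card E')" using fin by (simp add: card_insert_if)
    finally have "card E \<le> Suc (card E')" .
    moreover have "card E' \<le> card (V - {v})"
    proof (rule less.hyps)
      show "card (V - {v}) < card V" using v less.prems(1) by (rule card_Diff1_less[rotated])
      show "forest E'" using less.prems(3) by (rule forest_subset) (auto simp: E'_def)
    qed (use less.prems E' in auto)
    moreover have "Suc (card (V - {v})) = card V"
      using less.prems(1) v by (rule card_Suc_Diff1)
    ultimately show ?thesis by linarith
  qed
qed

section \<open>Degrees in the part without bridges\<close>

definition deg :: "('a \<times> 'a) set \<Rightarrow> 'a \<Rightarrow> nat" where
  "deg A v = card {a \<in> A. fst a = v} + card {a \<in> A. snd a = v}"

lemma sum_deg:
  assumes "finite A" "finite V" "A \<subseteq> V \<times> V"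
  shows "(\<Sum>v\<in>V. deg A v) = 2 * card A"
proof -
  have "(\<Sum>v\<in>V. card {a \<in> A. f a = v}) = card A" if "f ` A \<subseteq> V" for f
  proof -
    have "card (\<Union>v\<in>V. {a \<in> A. f a = v}) = (\<Sum>v\<in>V. card {a \<in> A. f a = v})"
      by (rule card_UN_disjoint) (use assms in auto)
    moreover have "(\<Union>v\<in>V. {a \<in> A. f a = v}) = A" using that by auto
    ultimately show ?thesis by simp
  qed
  from this[of fst] this[of snd] show ?thesis
    using assms(3) by (force simp: deg_def sum.distrib)
qed

text \<open>Cutting the connection after its last visit to \<open>p\<close> leaves a rest that
  avoids \<open>p\<close>.\<close>

lemma leave_once:
  assumes "(p, q) \<in> R\<^sup>*" "p \<noteq> q"
  obtains z where "(p, z) \<in> R" "(z, q) \<in> {(x, y) \<in> R. x \<noteq> p \<and> y \<noteq> p}\<^sup>*"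
proof -
  let ?R = "{(x, y) \<in> R. x \<noteq> p \<and> y \<noteq> p}"
  have no: "(p, q) \<notin> ?R\<^sup>*" using assms(2) by (auto elim: converse_rtranclE)
  have "(x, q) \<in> ?R\<^sup>* \<or> (\<exists>z. (p, z) \<in> R \<and> (z, q) \<in> ?R\<^sup>*)" if "(x, q) \<in> R\<^sup>*" for x
    using that
  proof (induction rule: converse_rtrancl_induct)
    case (step x y)
    show ?case
    proof (cases "(y, q) \<in> ?R\<^sup>*")
      case True
      then have "y \<noteq> p" using no by blast
      show ?thesis
      proof (cases "x = p")
        case True
        then show ?thesis using step.hyps \<open>(y, q) \<in> ?R\<^sup>*\<close> by blast
      next
        case False
        then have "(x, y) \<in> ?R" using step.hyps \<open>y \<noteq> p\<close> by blast
        then show ?thesis using True by (meson converse_rtrancl_into_rtrancl)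
      qed
    qed (use step.IH in blast)
  qed simp
  then show thesis using that no assms(1) by blast
qed

text \<open>A non-bridge lies on a cycle of the underlying graph, and the second edge of this cycle
  at \<open>p\<close> is not a bridge either. The cycle comes from a detour around the arc, cut
  after its last visit to \<open>p\<close>.\<close>

lemma second_inner_arc:
  assumes pq: "(p, q) \<in> inner A" and "p \<noteq> q"
  obtains a where "a \<in> inner A" "a \<noteq> (p, q)" "fst a = p \<or> snd a = p"
proof -
  let ?B = "A - {(p, q)}"
  have conn: "(p, q) \<in> (?B \<union> ?B\<inverse>)\<^sup>*" using pq by (auto simp: bridges_def)
  obtain z where z: "(p, z) \<in> ?B \<union> ?B\<inverse>"
    "(z, q) \<in> {(x, y) \<in> ?B \<union> ?B\<inverse>. x \<noteq> p \<and> y \<noteq> p}\<^sup>*" 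
    by (rule leave_once[OF conn assms(2)])
  \<comment> \<open>The first edge of the detour, with the orientation that it has in
    \<open>A\<close>.\<close>
  define a where "a = (if (p, z) \<in> ?B then (p, z) else (z, p))"
  have a: "a \<in> ?B" "a = (p, z) \<or> a = (z, p)" using z(1) by (auto simp: a_def)
  let ?C = "(A - {a}) \<union> (A - {a})\<inverse>"
  \<comment> \<open>The rest of the detour avoids \<open>p\<close> and hence \<open>a\<close>; the
    arc between \<open>p\<close> and \<open>q\<close> then connects the two ends of \<open>a\<close>
    without using \<open>a\<close>.\<close>
  have "{(x, y) \<in> ?B \<union> ?B\<inverse>. x \<noteq> p \<and> y \<noteq> p} \<subseteq> ?C" using a(2) by auto
  then have "(z, q) \<in> ?C\<^sup>*" using z(2) rtrancl_mono by blast
  moreover have "(q, p) \<in> ?C" using pq a(1) by auto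
  ultimately have zp: "(z, p) \<in> ?C\<^sup>*" by (rule rtrancl_into_rtrancl)
  moreover have "sym (?C\<^sup>*)" by (intro sym_rtrancl) (auto simp: sym_def)
  ultimately have "a \<in> ?C\<^sup>*" using a(2) by (metis symD)
  then have "a \<in> inner A" using a(1) by (auto simp: bridges_def)
  moreover have "a \<noteq> (p, q)" using a(1) by blast
  moreover have "fst a = p \<or> snd a = p" using a(2) by auto
  ultimately show thesis using that by blast
qed

lemma second_inner_arc':
  assumes pq: "(q, p) \<in> inner A" and "p \<noteq> q"
  obtains a where "a \<in> inner A" "a \<noteq> (q, p)" "fst a = p \<or> snd a = p"
proof -
  have "(p, q) \<in> inner (A\<inverse>)" using pq by (simp add: bridges_converse)
  then obtain a where "a \<in> inner (A\<inverse>)" "a \<noteq> (p, q)" "fst a = p \<or> snd a = p"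
    using second_inner_arc[OF _ assms(2)] by blast
  then show thesis using that[of "(snd a, fst a)"] by (cases a) (auto simp: bridges_converse)
qed

lemma deg_ge_card:
  assumes "finite A" "B \<subseteq> A" "\<And>a. a \<in> B \<Longrightarrow> fst a = v \<or> snd a = v"
  shows "card B \<le> deg A v"
proof -
  have "card B \<le> card ({a \<in> A. fst a = v} \<union> {a \<in> A. snd a = v})"
    using assms by (intro card_mono) auto
  also have "\<dots> \<le> deg A v" unfolding deg_def by (rule card_Un_le)
  finally show ?thesis .
qed

lemma deg_inner:
  assumes "finite A" "\<And>x. (x, x) \<notin> A" "v \<in> Field (inner A)"
  shows "2 \<le> deg (inner A) v"
proof -
  obtain b where b: "b \<in> inner A" "fst b = v \<or> snd b = v"
    using assms(3) by (auto simp: Field_def)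
  obtain a where a: "a \<in> inner A" "a \<noteq> b" "fst a = v \<or> snd a = v"
  proof (cases "fst b = v")
    case True
    then have "v \<noteq> snd b" "(v, snd b) \<in> inner A" using b assms(2) by (cases b; auto)+
    then show thesis using that second_inner_arc[of v "snd b" A] True by (cases b) auto
  next
    case False
    then have "v \<noteq> fst b" "(fst b, v) \<in> inner A" using b by (cases b; auto)+
    then show thesis using that second_inner_arc'[of "fst b" v A] b(2) False by (cases b) auto
  qed
  have "card {a, b} \<le> deg (inner A) v"
    using a b assms(1) by (intro deg_ge_card) auto
  then show ?thesis using a(2) by simp
qed

text \<open>Here 2-cycles matter: two opposite arcs would fall onto one edge, and edges could no
  longer bound the number of arcs.\<close>

lemma card_underlying_edges:
  assumes "\<And>x. (x, x) \<notin> A" "no_2cycle A"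
  shows "card (underlying_edges A) = card A"
proof -
  have "underlying_edges A = (\<lambda>(u, v). {u, v}) ` A" by (auto simp: underlying_edges_def)
  moreover have "inj_on (\<lambda>(u, v). {u, v}) A"
    using assms by (auto simp: inj_on_def no_2cycle_def doubleton_eq_iff)
  ultimately show ?thesis by (simp add: card_image)
qed

lemma feedback_edge_set_exists:
  obtains F where "F \<subseteq> E" "card F = feedback_edge_set_number E" "forest (E - F)"
proof -
  have "\<exists>m F. F \<subseteq> E \<and> card F = m \<and> forest (E - F)"
    by (intro exI[of _ "card E"] exI[of _ E]) (auto simp: forest_def ucycle_def intro!: exI[of _ "0::nat"])
  then show thesis
    using LeastI_ex[of "\<lambda>m. \<exists>F. F \<subseteq> E \<and> card F = m \<and> forest (E - F)"] that
    unfolding feedback_edge_set_number_def by blast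
qed

text \<open>Deleting a minimum feedback edge set leaves a forest, with at most as many edges as
  vertices. Only vertices on non-bridges are counted, as only these are known to have degree at
  least 2.\<close>

lemma card_inner:
  assumes A: "finite A" "\<And>x. (x, x) \<notin> A" "no_2cycle A"
  shows "card (inner A) \<le> card (Field (inner A)) + feedback_edge_set_number (underlying_edges A)"
proof -
  obtain F where F: "F \<subseteq> underlying_edges A" "card F = feedback_edge_set_number (underlying_edges A)"
    "forest (underlying_edges A - F)" by (rule feedback_edge_set_exists)
  let ?E = "underlying_edges (inner A)"
  have finE: "finite (underlying_edges A)"
  proof -
    have "underlying_edges A = (\<lambda>(u, v). {u, v}) ` A" by (auto simp: underlying_edges_def)
    then show ?thesis using A by simp
  qed
  have sub: "?E \<subseteq> underlying_edges A" by (auto simp: underlying_edges_def)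
  have "card (?E - F) \<le> card (Field (inner A))"
  proof (rule card_forest)
    show "finite (Field (inner A))" using A by (simp add: finite_Field)
    show "simple_edges (Field (inner A)) (?E - F)"
      unfolding simple_edges_def
    proof
      fix e assume "e \<in> ?E - F"
      then obtain u v where uv: "(u, v) \<in> inner A" "e = {u, v}" by (auto simp: underlying_edges_def)
      then have "u \<in> Field (inner A)" "v \<in> Field (inner A)" "u \<noteq> v" using A(2) by (auto simp: Field_def)
      then show "\<exists>u\<in>Field (inner A). \<exists>v\<in>Field (inner A). u \<noteq> v \<and> e = {u, v}" using uv by blast
    qed
    show "forest (?E - F)" using F(3) by (rule forest_subset) (use sub in auto)
  qed
  moreover have "card ?E \<le> card (?E - F) + card F"
    using diff_card_le_card_Diff[of F ?E] finite_subset[OF F(1) finE] by linarith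
  moreover have "card ?E = card (inner A)"
    using A by (intro card_underlying_edges) (auto simp: no_2cycle_def)
  ultimately show ?thesis using F(2) by linarith
qed

definition heavy :: "('a \<times> 'a) set \<Rightarrow> 'a set" where
  "heavy A = {v \<in> Field A. 3 \<le> deg A v}"

text \<open>From degree 3 on, a degree is at most three times its excess over 2. The total excess is
  twice the difference between the numbers of arcs and vertices, hence at most twice the feedback
  edge set number, which gives the factor 6.\<close>

lemma sum_deg_heavy:
  assumes A: "finite A" "\<And>x. (x, x) \<notin> A" "no_2cycle A"
  shows "(\<Sum>v\<in>heavy (inner A). deg (inner A) v) \<le> 6 * feedback_edge_set_number (underlying_edges A)"
proof -
  let ?V = "Field (inner A)" and ?d = "deg (inner A)"
  have fV: "finite ?V" using A by (simp add: finite_Field)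
  have d2: "2 \<le> ?d v" if "v \<in> ?V" for v using deg_inner[OF A(1,2) that] .
  have "(\<Sum>v\<in>heavy (inner A). ?d v) \<le> (\<Sum>v\<in>heavy (inner A). 3 * (?d v - 2))"
    by (rule sum_mono) (auto simp: heavy_def)
  also have "\<dots> \<le> (\<Sum>v\<in>?V. 3 * (?d v - 2))"
    using fV by (intro sum_mono2) (auto simp: heavy_def)
  also have "\<dots> = 3 * (\<Sum>v\<in>?V. ?d v - 2)" by (simp add: sum_distrib_left)
  also have "(\<Sum>v\<in>?V. ?d v - 2) = (\<Sum>v\<in>?V. ?d v) - (\<Sum>v\<in>?V. 2)"
    using d2 by (intro sum_subtractf_nat) auto
  also have "(\<Sum>v\<in>?V. ?d v) = 2 * card (inner A)"
    using A(1) fV by (intro sum_deg) (auto simp: Field_def)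
  also have "3 * (2 * card (inner A) - (\<Sum>v\<in>?V. 2)) \<le> 6 * feedback_edge_set_number (underlying_edges A)"
    using card_inner[OF A] by simp
  finally show ?thesis .
qed

lemma non_through_heavy:
  assumes "finite A" "(p, x) \<in> A" "(x, q) \<in> A" "x \<notin> thr A" "\<And>x. (x, x) \<notin> A"
  shows "x \<in> heavy A"
proof -
  obtain a where a: "a \<in> A" "a \<noteq> (p, x)" "a \<noteq> (x, q)" "fst a = x \<or> snd a = x"
  proof -
    have "(\<exists>p'. p' \<noteq> p \<and> (p', x) \<in> A) \<or> (\<exists>q'. q' \<noteq> q \<and> (x, q') \<in> A)"
      using assms(2-4) unfolding thr_def mem_Collect_eq by metis
    then show thesis
    proof (elim disjE exE conjE)
      fix p' assume "p' \<noteq> p" "(p', x) \<in> A"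
      then show thesis using that[of "(p', x)"] assms(5) by auto
    next
      fix q' assume "q' \<noteq> q" "(x, q') \<in> A"
      then show thesis using that[of "(x, q')"] assms(5) by auto
    qed
  qed
  have "p \<noteq> x" using assms by blast
  then have "card {a, (p, x), (x, q)} = 3" using a by auto
  moreover have "card {a, (p, x), (x, q)} \<le> deg A x"
    using assms a by (intro deg_ge_card) auto
  ultimately show ?thesis using assms(2) by (auto simp: heavy_def Field_def)
qed

text \<open>Every class is charged to an arc that joins one of its ends to a heavy vertex. Such an
  arc has only one end among the through vertices, so it determines the class, and the number of
  arcs at heavy vertices is at most their degree sum.\<close>

lemma card_branching_class:
  assumes A: "finite A" "\<And>x. (x, x) \<notin> A" and D: "D \<subseteq> branching A"
    and indep: "\<And>x y. x \<in> D \<Longrightarrow> y \<in> D \<Longrightarrow> (x, y) \<in> clsrel A \<Longrightarrow> x = y"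
  shows "card D \<le> (\<Sum>v\<in>heavy A. deg A v)"
proof -
  define H where "H = (\<Union>v\<in>heavy A. {a \<in> A. fst a = v} \<union> {a \<in> A. snd a = v})"
  define link where "link x a \<longleftrightarrow> (\<exists>y p. (x, y) \<in> clsrel A \<and> p \<notin> thr A \<and> (a = (p, y) \<or> a = (y, p)))" for x a
  have fh: "finite (heavy A)" using A(1) by (auto simp: heavy_def finite_Field)
  have fH: "finite H" unfolding H_def using A fh by auto
  have ex: "\<exists>a\<in>H. link x a" if x: "x \<in> D" for x
  proof -
    obtain y where y: "(x, y) \<in> clsrel A" and
      c: "y \<in> firsts A \<and> (\<exists>p q. (p, y) \<in> A \<and> (q, p) \<in> A) \<or> y \<in> lasts A \<and> (\<exists>p q. (y, p) \<in> A \<and> (p, q) \<in> A)"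
      using subsetD[OF D x] unfolding branching_def by blast
    from c show ?thesis
    proof
      assume "y \<in> firsts A \<and> (\<exists>p q. (p, y) \<in> A \<and> (q, p) \<in> A)"
      then obtain p q where pq: "y \<in> firsts A" "(p, y) \<in> A" "(q, p) \<in> A" by blast
      then have p: "p \<notin> thr A" by (auto simp: firsts_def chn_def)
      then have "p \<in> heavy A" using non_through_heavy A pq by metis
      then have "(p, y) \<in> H" using pq by (auto simp: H_def)
      moreover have "link x (p, y)" using y p by (auto simp: link_def)
      ultimately show ?thesis by blast
    next
      assume "y \<in> lasts A \<and> (\<exists>p q. (y, p) \<in> A \<and> (p, q) \<in> A)"
      then obtain p q where pq: "y \<in> lasts A" "(y, p) \<in> A" "(p, q) \<in> A" by blast
      then have p: "p \<notin> thr A" by (auto simp: lasts_def chn_def)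
      then have "p \<in> heavy A" using non_through_heavy A pq by metis
      then have "(y, p) \<in> H" using pq by (auto simp: H_def)
      moreover have "link x (y, p)" using y p by (auto simp: link_def)
      ultimately show ?thesis by blast
    qed
  qed
  then obtain h where h: "\<And>x. x \<in> D \<Longrightarrow> h x \<in> H \<and> link x (h x)" by metis
  have "inj_on h D"
  proof (rule inj_onI)
    fix x y assume xy: "x \<in> D" "y \<in> D" "h x = h y"
    then obtain u p w q where *: "(x, u) \<in> clsrel A" "p \<notin> thr A" "h x = (p, u) \<or> h x = (u, p)"
      "(y, w) \<in> clsrel A" "q \<notin> thr A" "h x = (q, w) \<or> h x = (w, q)"
      using h[of x] h[of y] unfolding link_def by metis
    have "u \<in> thr A" "w \<in> thr A" using * clsrel_thr by metis+
    then have "u = w" using * by auto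
    then have "(x, y) \<in> clsrel A" using * clsrel_sym clsrel_trans by metis
    then show "x = y" using indep xy by blast
  qed
  then have "card D \<le> card H" using h fH by (intro card_inj_on_le) auto
  also have "\<dots> \<le> (\<Sum>v\<in>heavy A. card ({a \<in> A. fst a = v} \<union> {a \<in> A. snd a = v}))"
    unfolding H_def by (rule card_UN_le[OF fh])
  also have "\<dots> \<le> (\<Sum>v\<in>heavy A. deg A v)"
    unfolding deg_def by (intro sum_mono card_Un_le)
  finally show ?thesis .
qed

lemma firsts_unique: "x \<in> firsts A \<Longrightarrow> y \<in> firsts A \<Longrightarrow> (x, y) \<in> clsrel A \<Longrightarrow> x = y"
  using clsrel_comparable[of x y A] by (auto simp: firsts_def elim: rtranclE)

lemma lasts_unique: "x \<in> lasts A \<Longrightarrow> y \<in> lasts A \<Longrightarrow> (x, y) \<in> clsrel A \<Longrightarrow> x = y"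
  using clsrel_comparable[of x y A] by (auto simp: lasts_def elim: converse_rtranclE)

text \<open>There are four families of candidates, each bounded by the degree sum of the heavy
  vertices: 24 is 4 times 6.\<close>

theorem card_candidates:
  assumes A: "finite A" "\<And>x. (x, x) \<notin> A" "no_2cycle A"
  shows "card (candidates (inner A) P Q) \<le> 24 * feedback_edge_set_number (underlying_edges A)"
proof -
  let ?B = "inner A" and ?h = "\<Sum>v\<in>heavy (inner A). deg (inner A) v"
  have B: "finite ?B" "\<And>x. (x, x) \<notin> ?B" using A by auto
  have c1: "card {x. x \<notin> thr ?B \<and> (\<exists>p. (p, x) \<in> ?B) \<and> (\<exists>q. (x, q) \<in> ?B)} \<le> ?h" (is "card ?C \<le> _")
  proof -
    have "?C \<subseteq> heavy ?B" using non_through_heavy[OF B(1) _ _ _ B(2)] by blast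
    moreover have "finite (heavy ?B)" using B(1) by (auto simp: heavy_def finite_Field)
    ultimately have "card ?C \<le> card (heavy ?B)" by (simp add: card_mono)
    also have "\<dots> = (\<Sum>v\<in>heavy ?B. 1)" by simp
    also have "\<dots> \<le> ?h" by (rule sum_mono) (auto simp: heavy_def)
    finally show ?thesis .
  qed
  have c2: "card (branching ?B \<inter> firsts ?B) \<le> ?h"
    by (rule card_branching_class[OF B]) (auto intro: firsts_unique)
  have c3: "card (branching ?B \<inter> lasts ?B) \<le> ?h"
    by (rule card_branching_class[OF B]) (auto intro: lasts_unique)
  have c4: "card (branching ?B \<inter> leaders ?B (pivot ?B P Q)) \<le> ?h"
    by (rule card_branching_class[OF B]) (auto intro: leaders_unique)
  have "candidates ?B P Q = (?C \<union> branching ?B \<inter> firsts ?B) \<union>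
      (branching ?B \<inter> lasts ?B \<union> branching ?B \<inter> leaders ?B (pivot ?B P Q))"
    unfolding candidates_def by blast
  then have "card (candidates ?B P Q) \<le> (card ?C + card (branching ?B \<inter> firsts ?B)) +
      (card (branching ?B \<inter> lasts ?B) + card (branching ?B \<inter> leaders ?B (pivot ?B P Q)))"
    by (simp only:) (intro order_trans[OF card_Un_le] add_mono card_Un_le)
  then show ?thesis using c1 c2 c3 c4 sum_deg_heavy[OF A] by linarith
qed

section \<open>A loop language compiled to the random access machine\<close>

datatype aexp = N nat | V nat | Plus aexp aexp | Minus aexp aexp | Arr nat aexp

text \<open>Loops have a limit known on entry, so every program terminates and its running time can
  be bounded by structural recursion.\<close>

datatype com =
    Assign nat aexp
  | Put nat aexp aexp
  | Seq com com
  | If aexp com com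
  | For nat nat com

type_synonym state = "(nat \<Rightarrow> nat) \<times> (nat \<Rightarrow> nat \<Rightarrow> nat)"

definition setv :: "nat \<Rightarrow> nat \<Rightarrow> state \<Rightarrow> state" where
  "setv x v s = ((fst s)(x := v), snd s)"

definition seta :: "nat \<Rightarrow> nat \<Rightarrow> nat \<Rightarrow> state \<Rightarrow> state" where
  "seta a i v s = (fst s, (snd s)(a := (snd s a)(i := v)))"

fun aval :: "aexp \<Rightarrow> state \<Rightarrow> nat" where
  "aval (N c) s = c"
| "aval (V x) s = fst s x"
| "aval (Plus e1 e2) s = aval e1 s + aval e2 s"
| "aval (Minus e1 e2) s = aval e1 s - aval e2 s"
| "aval (Arr a e) s = snd s a (aval e s)"

fun eval :: "com \<Rightarrow> state \<Rightarrow> state" where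
  "eval (Assign x e) s = setv x (aval e s) s"
| "eval (Put a i e) s = seta a (aval i s) (aval e s) s"
| "eval (Seq c d) s = eval d (eval c s)"
| "eval (If e c d) s = (if aval e s \<noteq> 0 then eval c s else eval d s)"
| "eval (For x y c) s = ((\<lambda>s. setv x (Suc (fst s x)) (eval c s)) ^^ fst s y) (setv x 0 s)"

fun wv :: "com \<Rightarrow> nat set" where
  "wv (Assign x e) = {x}"
| "wv (Put a i e) = {}"
| "wv (Seq c d) = wv c \<union> wv d"
| "wv (If e c d) = wv c \<union> wv d"
| "wv (For x y c) = insert x (wv c)"

fun wa :: "com \<Rightarrow> nat set" where
  "wa (Assign x e) = {}"
| "wa (Put a i e) = {a}"
| "wa (Seq c d) = wa c \<union> wa d"
| "wa (If e c d) = wa c \<union> wa d"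
| "wa (For x y c) = wa c"

lemma setv_simps [simp]: "fst (setv x v s) = (fst s)(x := v)" "snd (setv x v s) = snd s"
  by (simp_all add: setv_def)

lemma seta_simps [simp]: "fst (seta a i v s) = fst s" "snd (seta a i v s) = (snd s)(a := (snd s a)(i := v))"
  by (simp_all add: seta_def)

lemma eval_wv: "x \<notin> wv c \<Longrightarrow> fst (eval c s) x = fst s x"
proof (induction c arbitrary: s)
  case (For y z c)
  have "fst (((\<lambda>s. setv y (Suc (fst s y)) (eval c s)) ^^ k) s) x = fst s x" for k s
    by (induction k) (use For in auto)
  then show ?case using For.prems by simp
qed auto

lemma eval_wa: "a \<notin> wa c \<Longrightarrow> snd (eval c s) a = snd s a"
proof (induction c arbitrary: s)
  case (For y z c)
  have "snd (((\<lambda>s. setv y (Suc (fst s y)) (eval c s)) ^^ k) s) a = snd s a" for k s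
    by (induction k) (use For in auto)
  then show ?case by simp
qed auto

text \<open>Address arithmetic for interleaved arrays: entry \<open>i\<close> of array
  \<open>a\<close> lies at base + 32 i + a, with the base in cell 31. Interleaving gives each of the
  32 arrays unlimited length; five doublings replace the multiplication.\<close>

definition shift :: "nat \<Rightarrow> nat \<Rightarrow> instr list" where
  "shift d a = replicate 5 (Add d d d) @ [Const (Suc d) a, Add d d (Suc d), Add d d 31]"

fun acomp :: "aexp \<Rightarrow> nat \<Rightarrow> instr list" where
  "acomp (N c) d = [Const d c]"
| "acomp (V x) d = [Const d 0, Add d d x]"
| "acomp (Plus e1 e2) d = acomp e1 d @ acomp e2 (Suc d) @ [Add d d (Suc d)]"
| "acomp (Minus e1 e2) d = acomp e1 d @ acomp e2 (Suc d) @ [Sub d d (Suc d)]"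
| "acomp (Arr a e) d = acomp e d @ shift d a @ [Load d d]"

text \<open>Intermediate values live in the cells from \<open>d\<close> on; the limit 255 keeps the
  auxiliary cell \<open>Suc d\<close> of \<open>shift\<close> below 256, the least possible base of
  the arrays.\<close>

fun awf :: "aexp \<Rightarrow> nat \<Rightarrow> bool" where
  "awf (N c) d \<longleftrightarrow> d < 255"
| "awf (V x) d \<longleftrightarrow> d < 255 \<and> x < 32"
| "awf (Plus e1 e2) d \<longleftrightarrow> awf e1 d \<and> awf e2 (Suc d)"
| "awf (Minus e1 e2) d \<longleftrightarrow> awf e1 d \<and> awf e2 (Suc d)"
| "awf (Arr a e) d \<longleftrightarrow> a < 32 \<and> awf e d"

fun clen :: "com \<Rightarrow> nat" where
  "clen (Assign x e) = length (acomp e 32) + 2"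
| "clen (Put a i e) = length (acomp i 32) + 8 + length (acomp e 33) + 1"
| "clen (Seq c d) = clen c + clen d"
| "clen (If e c d) = length (acomp e 32) + 1 + clen c + 2 + clen d"
| "clen (For x y c) = 3 + clen c + 4"

text \<open>Moves and unconditional jumps are simulated: by the addition of 0, and by a test of a
  cell that was just set to 0. Jump targets are absolute, which is the reason for the argument
  \<open>pc\<close>.\<close>

fun ccomp :: "nat \<Rightarrow> com \<Rightarrow> instr list" where
  "ccomp pc (Assign x e) = acomp e 32 @ [Const 33 0, Add x 32 33]"
| "ccomp pc (Put a i e) = acomp i 32 @ shift 32 a @ acomp e 33 @ [Store 32 33]"
| "ccomp pc (Seq c d) = ccomp pc c @ ccomp (pc + clen c) d"
| "ccomp pc (If e c d) = (let n = pc + length (acomp e 32) in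
     acomp e 32 @ [Jz 32 (n + 1 + clen c + 2)] @ ccomp (n + 1) c @
     [Const 32 0, Jz 32 (n + 1 + clen c + 2 + clen d)] @ ccomp (n + 1 + clen c + 2) d)"
| "ccomp pc (For x y c) =
     [Const x 0, Sub 32 y x, Jz 32 (pc + 3 + clen c + 4)] @ ccomp (pc + 3) c @
     [Const 32 1, Add x x 32, Const 32 0, Jz 32 (pc + 1)]"

text \<open>The compiled loop compares \<open>x\<close> and \<open>y\<close> anew in each round,
  whereas \<open>eval\<close> fixes the number of rounds on entry; they agree because the body may
  write neither. Variable 31 holds the array base: it may be read but not assigned.\<close>

fun cwf :: "com \<Rightarrow> bool" where
  "cwf (Assign x e) \<longleftrightarrow> x < 31 \<and> awf e 32"
| "cwf (Put a i e) \<longleftrightarrow> a < 32 \<and> awf i 32 \<and> awf e 33"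
| "cwf (Seq c d) \<longleftrightarrow> cwf c \<and> cwf d"
| "cwf (If e c d) \<longleftrightarrow> awf e 32 \<and> cwf c \<and> cwf d"
| "cwf (For x y c) \<longleftrightarrow> x < 31 \<and> y < 32 \<and> x \<noteq> y \<and> x \<notin> wv c \<and> y \<notin> wv c \<and> cwf c"

text \<open>The exact number of machine steps, since \<open>run\<close> is applied to a definite
  number. The final 2 of a loop pays for the test that ends it.\<close>

fun cost :: "com \<Rightarrow> state \<Rightarrow> nat" where
  "cost (Assign x e) s = length (acomp e 32) + 2"
| "cost (Put a i e) s = length (acomp i 32) + 8 + length (acomp e 33) + 1"
| "cost (Seq c d) s = cost c s + cost d (eval c s)"
| "cost (If e c d) s = length (acomp e 32) + 1 + (if aval e s \<noteq> 0 then cost c s + 2 else cost d s)"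
| "cost (For x y c) s = 1 + (\<Sum>i<fst s y.
     2 + cost c (((\<lambda>s. setv x (Suc (fst s x)) (eval c s)) ^^ i) (setv x 0 s)) + 4) + 2"

lemma length_shift [simp]: "length (shift d a) = 8"
  by (simp add: shift_def)

lemma length_ccomp [simp]: "length (ccomp pc c) = clen c"
  by (induction c arbitrary: pc) (auto simp: Let_def)

definition code_at :: "instr list \<Rightarrow> nat \<Rightarrow> instr list \<Rightarrow> bool" where
  "code_at P pc is \<longleftrightarrow> (\<forall>j<length is. pc + j < length P \<and> P ! (pc + j) = is ! j)"

lemma code_at_Nil [simp]: "code_at P pc []"
  by (simp add: code_at_def)

lemma code_at_Cons [simp]: "code_at P pc (i # is) \<longleftrightarrow> pc < length P \<and> P ! pc = i \<and> code_at P (Suc pc) is"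
  by (auto simp: code_at_def All_less_Suc2)

lemma code_at_append [simp]:
  "code_at P pc (is @ js) \<longleftrightarrow> code_at P pc is \<and> code_at P (pc + length is) js"
  by (induction "is" arbitrary: pc) auto

lemma run_0 [simp]: "run P 0 c = c"
  by (simp add: run_def)

lemma run_add: "run P (t + u) c = run P u (run P t c)"
  by (simp add: run_def add.commute[of t u] funpow_add)

lemma run_Suc: "run P (Suc t) c = run P t (step P c)"
  by (simp add: run_def funpow_Suc_right del: funpow.simps)

lemma step_code: "pc < length P \<Longrightarrow> step P (pc, m) = exec (P ! pc) pc m"
  by (simp add: step_def)

definition mstep :: "instr \<Rightarrow> (nat \<Rightarrow> nat) \<Rightarrow> nat \<Rightarrow> nat" where
  "mstep i m = snd (exec i 0 m)"

lemma mstep_simps [simp]: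
  "mstep (Const r c) m = m(r := c)"
  "mstep (Add r a b) m = m(r := m a + m b)"
  "mstep (Sub r a b) m = m(r := m a - m b)"
  "mstep (Load r a) m = m(r := m (m a))"
  "mstep (Store a r) m = m(m a := m r)"
  by (simp_all add: mstep_def)

fun straight :: "instr \<Rightarrow> bool" where
  "straight (Jz r t) \<longleftrightarrow> False"
| "straight _ \<longleftrightarrow> True"

lemma run_straight:
  assumes "code_at P pc is" "\<forall>i\<in>set is. straight i"
  shows "run P (length is) (pc, m) = (pc + length is, fold mstep is m)"
  using assms
proof (induction "is" arbitrary: pc m)
  case (Cons i "is")
  have "exec i pc m = (Suc pc, mstep i m)" using Cons.prems(2) by (cases i) auto
  then show ?case using Cons by (simp add: run_Suc step_code)
qed simp

lemma straight_shift: "i \<in> set (shift d a) \<Longrightarrow> straight i"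
  by (auto simp: shift_def)

lemma straight_acomp: "i \<in> set (acomp e d) \<Longrightarrow> straight i"
  by (induction e d rule: acomp.induct) (auto dest: straight_shift)

text \<open>Expression evaluation at level \<open>d\<close> may touch only the cells from
  \<open>d\<close> to 255.\<close>

definition agree :: "nat \<Rightarrow> (nat \<Rightarrow> nat) \<Rightarrow> (nat \<Rightarrow> nat) \<Rightarrow> bool" where
  "agree d m m' \<longleftrightarrow> (\<forall>j. j < d \<or> 256 \<le> j \<longrightarrow> m' j = m j)"

definition represents :: "state \<Rightarrow> (nat \<Rightarrow> nat) \<Rightarrow> bool" where
  "represents s m \<longleftrightarrow> (\<forall>x<32. m x = fst s x) \<and>
     (\<forall>a<32. \<forall>i. m (fst s 31 + 32 * i + a) = snd s a i) \<and> 256 \<le> fst s 31"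

lemma agree_trans: "agree d m m' \<Longrightarrow> agree d' m' m'' \<Longrightarrow> d \<le> d' \<Longrightarrow> agree d m m''"
  by (auto simp: agree_def)

lemma represents_agree: "represents s m \<Longrightarrow> agree d m m' \<Longrightarrow> 32 \<le> d \<Longrightarrow> represents s m'"
  by (auto simp: represents_def agree_def)

lemma awf_bound: "awf e d \<Longrightarrow> d < 255"
  by (induction e d rule: awf.induct) auto

lemma fold_shift:
  assumes "32 \<le> d"
  shows "fold mstep (shift d a) m d = m 31 + 32 * m d + a"
    "j < d \<or> Suc d < j \<Longrightarrow> fold mstep (shift d a) m j = m j"
  using assms by (auto simp: shift_def eval_nat_numeral)

lemma acomp_correct:
  assumes "awf e d" "32 \<le> d" "represents s m"
  shows "fold mstep (acomp e d) m d = aval e s \<and> agree d m (fold mstep (acomp e d) m)"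
  using assms
proof (induction e arbitrary: d m)
  case (N c)
  then show ?case by (simp add: agree_def)
next
  case (V x)
  then show ?case by (auto simp: represents_def agree_def)
next
  case (Plus e1 e2)
  let ?m1 = "fold mstep (acomp e1 d) m" and ?m2 = "fold mstep (acomp e2 (Suc d)) (fold mstep (acomp e1 d) m)"
  have 1: "?m1 d = aval e1 s" "agree d m ?m1" using Plus by auto
  have "represents s ?m1" using 1 Plus represents_agree by blast
  then have 2: "?m2 (Suc d) = aval e2 s" "agree (Suc d) ?m1 ?m2" using Plus by auto
  then have "?m2 d = aval e1 s" using 1 by (auto simp: agree_def)
  moreover have "agree d m ?m2" using agree_trans[OF 1(2) 2(2)] by simp
  ultimately show ?case using 2 Plus.prems awf_bound[of e1 d] by (auto simp: agree_def)
next
  case (Minus e1 e2)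
  let ?m1 = "fold mstep (acomp e1 d) m" and ?m2 = "fold mstep (acomp e2 (Suc d)) (fold mstep (acomp e1 d) m)"
  have 1: "?m1 d = aval e1 s" "agree d m ?m1" using Minus by auto
  have "represents s ?m1" using 1 Minus represents_agree by blast
  then have 2: "?m2 (Suc d) = aval e2 s" "agree (Suc d) ?m1 ?m2" using Minus by auto
  then have "?m2 d = aval e1 s" using 1 by (auto simp: agree_def)
  moreover have "agree d m ?m2" using agree_trans[OF 1(2) 2(2)] by simp
  ultimately show ?case using 2 Minus.prems awf_bound[of e1 d] by (auto simp: agree_def)
next
  case (Arr a e)
  let ?m1 = "fold mstep (acomp e d) m" and ?m2 = "fold mstep (shift d a) (fold mstep (acomp e d) m)"
  have d: "d < 255" using Arr.prems awf_bound by auto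
  have 1: "?m1 d = aval e s" "agree d m ?m1" using Arr by auto
  have r: "represents s ?m1" using 1 Arr represents_agree by blast
  have 2: "?m2 d = ?m1 31 + 32 * ?m1 d + a" using fold_shift Arr by blast
  have ag: "agree d ?m1 ?m2" using fold_shift(2)[OF Arr.prems(2)] d by (auto simp: agree_def)
  have "represents s ?m2" using represents_agree[OF r ag] Arr by blast
  moreover have "?m2 d = fst s 31 + 32 * aval e s + a" using 2 1 r by (simp add: represents_def)
  ultimately have "?m2 (?m2 d) = snd s a (aval e s)" using Arr by (simp add: represents_def)
  moreover have "agree d m ?m2" using agree_trans[OF 1(2) ag] by simp
  ultimately show ?case using d by (auto simp: agree_def)
qed

lemma run_acomp:
  assumes "code_at P pc (acomp e d)" "awf e d" "32 \<le> d" "represents s m"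
  obtains m' where "run P (length (acomp e d)) (pc, m) = (pc + length (acomp e d), m')"
    "m' d = aval e s" "agree d m m'" "represents s m'"
  using run_straight[OF assms(1)] straight_acomp acomp_correct[OF assms(2-4)]
    represents_agree[OF assms(4) _ assms(3)] by blast

lemma represents_setv: "represents s m \<Longrightarrow> x < 31 \<Longrightarrow> represents (setv x v s) (m(x := v))"
  by (auto simp: represents_def)

lemma represents_seta:
  assumes "represents s m" "a < 32"
  shows "represents (seta a i v s) (m(fst s 31 + 32 * i + a := v))"
proof -
  have "b = a \<and> j = i" if "32 * j + b = 32 * i + a" "b < 32" for b j
  proof -
    have "(32 * j + b) div 32 = (32 * i + a) div 32" using that by simp
    then have "j = i" using that assms by simp
    then show ?thesis using that by simp
  qed
  then show ?thesis using assms unfolding represents_def by (auto simp: algebra_simps)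
qed

lemma run_trans: "run P t c = c' \<Longrightarrow> run P u c' = c'' \<Longrightarrow> run P (t + u) c = c''"
  by (simp add: run_add)

theorem ccomp_correct:
  assumes "code_at P pc (ccomp pc c)" "cwf c" "represents s m"
  shows "\<exists>m'. run P (cost c s) (pc, m) = (pc + clen c, m') \<and> represents (eval c s) m'"
  using assms
proof (induction c arbitrary: pc s m)
  case (Assign x e)
  then have code: "code_at P pc (acomp e 32)" "code_at P (pc + length (acomp e 32)) [Const 33 0, Add x 32 33]"
    by simp_all
  obtain m' where m': "run P (length (acomp e 32)) (pc, m) = (pc + length (acomp e 32), m')"
    "m' 32 = aval e s" "agree 32 m m'" "represents s m'"
    using run_acomp[OF code(1) _ _ Assign.prems(3)] Assign.prems(2) by auto
  have r: "run P 2 (pc + length (acomp e 32), m') = (pc + length (acomp e 32) + 2, m'(33 := 0, x := aval e s))"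
    using run_straight[OF code(2), of m'] m'(2) by (simp add: numeral_2_eq_2)
  have "represents s (m'(33 := 0))" using m'(4) by (rule represents_agree[of _ _ 32]) (auto simp: agree_def)
  then have "represents (setv x (aval e s) s) (m'(33 := 0, x := aval e s))"
    using Assign.prems by (intro represents_setv) auto
  moreover have "run P (cost (Assign x e) s) (pc, m) = (pc + clen (Assign x e), m'(33 := 0, x := aval e s))"
    using run_trans[OF m'(1) r] by (simp only: cost.simps clen.simps add.assoc)
  ultimately show ?case by auto
next
  case (Put a i e)
  let ?n1 = "length (acomp i 32)" and ?n2 = "length (acomp e 33)"
  have code: "code_at P pc (acomp i 32)" "code_at P (pc + ?n1) (shift 32 a)"
    "code_at P (pc + ?n1 + 8) (acomp e 33)" "code_at P (pc + ?n1 + 8 + ?n2) [Store 32 33]"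
    using Put.prems by (auto simp: add.assoc)
  obtain m1 where m1: "run P ?n1 (pc, m) = (pc + ?n1, m1)"
    "m1 32 = aval i s" "agree 32 m m1" "represents s m1"
    using run_acomp[OF code(1) _ _ Put.prems(3)] Put.prems(2) by auto
  define m2 where "m2 = fold mstep (shift 32 a) m1"
  have r2: "run P 8 (pc + ?n1, m1) = (pc + ?n1 + 8, m2)"
    using run_straight[OF code(2)] straight_shift by (simp add: m2_def)
  have m2: "m2 32 = fst s 31 + 32 * aval i s + a"
    using fold_shift(1)[of 32 a m1] m1 by (simp add: m2_def represents_def)
  have "agree 32 m1 m2" using fold_shift(2)[of 32 _ a m1] by (auto simp: m2_def agree_def)
  then have rep2: "represents s m2" using m1 represents_agree by blast
  obtain m3 where m3: "run P ?n2 (pc + ?n1 + 8, m2) = (pc + ?n1 + 8 + ?n2, m3)"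
    "m3 33 = aval e s" "agree 33 m2 m3" "represents s m3"
    using run_acomp[OF code(3) _ _ rep2] Put.prems(2) by auto
  have "m3 32 = fst s 31 + 32 * aval i s + a" using m2 m3(3) by (simp add: agree_def)
  then have "run P 1 (pc + ?n1 + 8 + ?n2, m3) =
      (pc + ?n1 + 8 + ?n2 + 1, m3(fst s 31 + 32 * aval i s + a := aval e s))"
    using run_straight[OF code(4), of m3] m3 by simp
  from run_trans[OF m1(1) run_trans[OF r2 run_trans[OF m3(1) this]]]
  have "run P (cost (Put a i e) s) (pc, m) =
      (pc + clen (Put a i e), m3(fst s 31 + 32 * aval i s + a := aval e s))"
    by (simp add: ac_simps)
  then show ?case using represents_seta[OF m3(4), of a] Put.prems by auto
next
  case (Seq c d)
  obtain m1 where m1: "run P (cost c s) (pc, m) = (pc + clen c, m1)" "represents (eval c s) m1"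
    using Seq.IH(1)[of pc s m] Seq.prems by auto
  obtain m2 where m2: "run P (cost d (eval c s)) (pc + clen c, m1) = (pc + clen c + clen d, m2)"
    "represents (eval d (eval c s)) m2"
    using Seq.IH(2)[of "pc + clen c" "eval c s" m1] Seq.prems m1 by auto
  show ?case using run_trans[OF m1(1) m2(1)] m2(2) by (auto simp: add.assoc)
next
  case (If e c d)
  let ?n = "length (acomp e 32)"
  have code: "code_at P pc (acomp e 32)" "code_at P (pc + ?n) [Jz 32 (pc + ?n + 1 + clen c + 2)]"
    "code_at P (pc + ?n + 1) (ccomp (pc + ?n + 1) c)"
    "code_at P (pc + ?n + 1 + clen c) [Const 32 0, Jz 32 (pc + ?n + 1 + clen c + 2 + clen d)]"
    "code_at P (pc + ?n + 1 + clen c + 2) (ccomp (pc + ?n + 1 + clen c + 2) d)"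
    using If.prems(1) by (auto simp: Let_def)
  obtain m1 where m1: "run P ?n (pc, m) = (pc + ?n, m1)"
    "m1 32 = aval e s" "agree 32 m m1" "represents s m1"
    using run_acomp[OF code(1) _ _ If.prems(3)] If.prems(2) by auto
  show ?case
  proof (cases "aval e s = 0")
    case True
    have j: "run P 1 (pc + ?n, m1) = (pc + ?n + 1 + clen c + 2, m1)"
      using code(2) m1(2) True by (simp add: run_Suc step_code)
    obtain m2 where m2: "run P (cost d s) (pc + ?n + 1 + clen c + 2, m1) =
        (pc + ?n + 1 + clen c + 2 + clen d, m2)" "represents (eval d s) m2"
      using If.IH(2)[OF code(5) _ m1(4)] If.prems by auto
    show ?thesis using run_trans[OF m1(1) run_trans[OF j m2(1)]] m2(2) True by (auto simp: add.assoc)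
  next
    case False
    have j: "run P 1 (pc + ?n, m1) = (pc + ?n + 1, m1)"
      using code(2) m1(2) False by (simp add: run_Suc step_code)
    obtain m2 where m2: "run P (cost c s) (pc + ?n + 1, m1) = (pc + ?n + 1 + clen c, m2)"
        "represents (eval c s) m2"
      using If.IH(1)[OF code(3) _ m1(4)] If.prems by auto
    have j2: "run P 2 (pc + ?n + 1 + clen c, m2) = (pc + ?n + 1 + clen c + 2 + clen d, m2(32 := 0))"
      using code(4) by (simp add: run_Suc step_code numeral_2_eq_2)
    have "represents (eval c s) (m2(32 := 0))"
      using m2(2) by (rule represents_agree[of _ _ 32]) (auto simp: agree_def)
    then show ?thesis
      using run_trans[OF m1(1) run_trans[OF j run_trans[OF m2(1) j2]]] False by (auto simp: add.assoc)
  qed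
next
  case (For x y c)
  let ?f = "\<lambda>s. setv x (Suc (fst s x)) (eval c s)" and ?end = "pc + 3 + clen c + 4"
  have code: "code_at P pc [Const x 0]" "code_at P (pc + 1) [Sub 32 y x, Jz 32 ?end]"
    "code_at P (pc + 3) (ccomp (pc + 3) c)"
    "code_at P (pc + 3 + clen c) [Const 32 1, Add x x 32, Const 32 0, Jz 32 (pc + 1)]"
    using For.prems(1) by (auto simp: eval_nat_numeral)
  have xy: "x < 31" "y < 32" "x \<noteq> y" "x \<notin> wv c" "y \<notin> wv c" "cwf c" using For.prems(2) by auto
  define s0 where "s0 = setv x 0 s"
  have vars: "fst ((?f ^^ i) s0) x = i \<and> fst ((?f ^^ i) s0) y = fst s y" for i
    by (induction i) (use xy in \<open>auto simp: s0_def eval_wv\<close>)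
  define m0 where "m0 = m(x := 0)"
  have init: "run P 1 (pc, m) = (pc + 1, m0)"
    using code(1) by (simp add: run_Suc step_code m0_def)
  have rep0: "represents s0 m0" unfolding s0_def m0_def using For.prems(3) xy(1) by (rule represents_setv)
  \<comment> \<open>The invariant is stated at the loop test, so the initialisation before it and
    the last test, which ends the loop, are accounted for separately.\<close>
  have loop: "i \<le> fst s y \<Longrightarrow> \<exists>m'. run P (\<Sum>j<i. 2 + cost c ((?f ^^ j) s0) + 4) (pc + 1, m0) = (pc + 1, m') \<and>
      represents ((?f ^^ i) s0) m'" for i
  proof (induction i)
    case 0
    then show ?case using rep0 by auto
  next
    case (Suc i)
    then obtain m1 where m1: "run P (\<Sum>j<i. 2 + cost c ((?f ^^ j) s0) + 4) (pc + 1, m0) = (pc + 1, m1)"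
      "represents ((?f ^^ i) s0) m1" by auto
    let ?s = "(?f ^^ i) s0"
    have "m1 x = i" "m1 y = fst s y" using m1(2) vars[of i] xy by (simp_all add: represents_def)
    then have t: "run P 2 (pc + 1, m1) = (pc + 3, m1(32 := fst s y - i))"
      using code(2) Suc.prems by (simp add: run_Suc step_code eval_nat_numeral)
    have "represents ?s (m1(32 := fst s y - i))"
      using m1(2) by (rule represents_agree[of _ _ 32]) (auto simp: agree_def)
    then obtain m2 where m2: "run P (cost c ?s) (pc + 3, m1(32 := fst s y - i)) = (pc + 3 + clen c, m2)"
      "represents (eval c ?s) m2"
      using For.IH[OF code(3) xy(6)] by blast
    have u: "run P 4 (pc + 3 + clen c, m2) = (pc + 1, m2(32 := 0, x := Suc (m2 x)))"
      using code(4) xy(1) by (auto simp: run_Suc step_code eval_nat_numeral)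
    have "m2 x = fst ?s x" using m2(2) xy by (simp add: represents_def eval_wv)
    moreover have "represents (eval c ?s) (m2(32 := 0))"
      using m2(2) by (rule represents_agree[of _ _ 32]) (auto simp: agree_def)
    then have "represents (setv x (Suc (fst ?s x)) (eval c ?s)) (m2(32 := 0, x := Suc (fst ?s x)))"
      using xy(1) by (rule represents_setv)
    ultimately have "represents ((?f ^^ Suc i) s0) (m2(32 := 0, x := Suc (m2 x)))" by simp
    moreover have "run P ((\<Sum>j<i. 2 + cost c ((?f ^^ j) s0) + 4) + (2 + (cost c ?s + 4))) (pc + 1, m0) =
      (pc + 1, m2(32 := 0, x := Suc (m2 x)))"
      by (rule run_trans[OF m1(1) run_trans[OF t run_trans[OF m2(1) u]]])
    ultimately show ?case by (auto simp: add.assoc)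
  qed
  obtain m1 where m1: "run P (\<Sum>j<fst s y. 2 + cost c ((?f ^^ j) s0) + 4) (pc + 1, m0) = (pc + 1, m1)"
    "represents ((?f ^^ fst s y) s0) m1" using loop[of "fst s y"] by auto
  have "m1 x = fst s y" "m1 y = fst s y" using m1(2) vars[of "fst s y"] xy by (simp_all add: represents_def)
  then have t: "run P 2 (pc + 1, m1) = (?end, m1(32 := 0))"
    using code(2) by (simp add: run_Suc step_code numeral_2_eq_2)
  have "represents ((?f ^^ fst s y) s0) (m1(32 := 0))"
    using m1(2) by (rule represents_agree[of _ _ 32]) (auto simp: agree_def)
  then show ?case
    using run_trans[OF init run_trans[OF m1(1) t]] by (auto simp: s0_def add.assoc)
qed

section \<open>A polynomial bound for programs with small loop limits\<close>

fun lv :: "com \<Rightarrow> nat set" where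
  "lv (Assign x e) = {}"
| "lv (Put a i e) = {}"
| "lv (Seq c d) = lv c \<union> lv d"
| "lv (If e c d) = lv c \<union> lv d"
| "lv (For x y c) = insert y (lv c)"

text \<open>\<open>B\<close> stands for a bound on all loop limits, so the value does not depend on
  the state. It is applied to everything but the loop over the sets of candidates, whose limit is
  exponential.\<close>

fun bnd :: "com \<Rightarrow> nat \<Rightarrow> nat" where
  "bnd (Assign x e) B = length (acomp e 32) + 2"
| "bnd (Put a i e) B = length (acomp i 32) + 8 + length (acomp e 33) + 1"
| "bnd (Seq c d) B = bnd c B + bnd d B"
| "bnd (If e c d) B = length (acomp e 32) + 3 + bnd c B + bnd d B"
| "bnd (For x y c) B = 3 + B * (6 + bnd c B)"

lemma cost_le_bnd: "(\<And>y. y \<in> lv c \<Longrightarrow> y \<notin> wv c \<and> fst s y \<le> B) \<Longrightarrow> cost c s \<le> bnd c B"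
proof (induction c arbitrary: s)
  case (Seq c d)
  have "cost d (eval c s) \<le> bnd d B"
    using Seq.prems by (intro Seq.IH) (auto simp: eval_wv)
  moreover have "cost c s \<le> bnd c B" using Seq.prems by (intro Seq.IH) auto
  ultimately show ?case by simp
next
  case (If e c d)
  have "cost d s \<le> bnd d B" "cost c s \<le> bnd c B" using If.prems by (intro If.IH; auto)+
  then show ?case by simp
next
  case (For x y c)
  let ?f = "\<lambda>s. setv x (Suc (fst s x)) (eval c s)"
  have inv: "fst ((?f ^^ i) (setv x 0 s)) z = fst s z" if "z \<in> lv (For x y c)" for i z
    by (induction i) (use For.prems[OF that] in \<open>auto simp: eval_wv\<close>)
  have "cost c ((?f ^^ i) (setv x 0 s)) \<le> bnd c B" for i
    using For.prems inv[of _ i] by (intro For.IH) auto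
  then have "2 + cost c ((?f ^^ i) (setv x 0 s)) + 4 \<le> 6 + bnd c B" for i
    by (simp add: add.commute)
  then have "(\<Sum>i<fst s y. 2 + cost c ((?f ^^ i) (setv x 0 s)) + 4) \<le> fst s y * (6 + bnd c B)"
    using sum_bounded_above[of "{..<fst s y}" _ "6 + bnd c B"] by simp
  also have "\<dots> \<le> B * (6 + bnd c B)" using For.prems[of y] by (intro mult_right_mono) auto
  finally show ?case by simp
qed auto

lemma bnd_polynomial: "\<exists>K d. \<forall>B. bnd c B \<le> K * (B + 2) ^ d"
proof -
  \<comment> \<open>The base \<open>B + 2\<close> is at least 1, so powers are monotone in the
    exponent and exponents may simply be added up.\<close>
  have le: "K * (B + 2) ^ d + K' * (B + 2) ^ d' + r \<le> (K + K' + r) * (B + 2) ^ (d + d')" for K K' d d' r B :: nat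
  proof -
    have 1: "(B + 2) ^ d \<le> (B + 2) ^ (d + d')" "(B + 2) ^ d' \<le> (B + 2) ^ (d + d')" "1 \<le> (B + 2) ^ (d + d')"
      by (intro power_increasing; simp)+ simp
    have "K * (B + 2) ^ d + K' * (B + 2) ^ d' + r * 1 \<le>
        K * (B + 2) ^ (d + d') + K' * (B + 2) ^ (d + d') + r * (B + 2) ^ (d + d')"
      using 1 by (intro add_mono mult_left_mono) auto
    then show ?thesis by (simp add: algebra_simps)
  qed
  show ?thesis
  proof (induction c)
    case (Assign x e)
    then show ?case by (intro exI[of _ "length (acomp e 32) + 2"] exI[of _ 0]) simp
  next
    case (Put a i e)
    then show ?case by (intro exI[of _ "length (acomp i 32) + 8 + length (acomp e 33) + 1"] exI[of _ 0]) simp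
  next
    case (Seq c d)
    then obtain K1 d1 K2 d2 where *: "\<And>B. bnd c B \<le> K1 * (B + 2) ^ d1" "\<And>B. bnd d B \<le> K2 * (B + 2) ^ d2"
      by blast
    have "bnd (Seq c d) B \<le> (K1 + K2 + 0) * (B + 2) ^ (d1 + d2)" for B
      using *(1)[of B] *(2)[of B] le[of K1 B d1 K2 d2 0] by simp
    then show ?case by blast
  next
    case (If e c d)
    then obtain K1 d1 K2 d2 where *: "\<And>B. bnd c B \<le> K1 * (B + 2) ^ d1" "\<And>B. bnd d B \<le> K2 * (B + 2) ^ d2"
      by blast
    have "bnd (If e c d) B \<le> (K1 + K2 + (length (acomp e 32) + 3)) * (B + 2) ^ (d1 + d2)" for B
      using *(1)[of B] *(2)[of B] le[of K1 B d1 K2 d2 "length (acomp e 32) + 3"] by simp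
    then show ?case by blast
  next
    case (For x y c)
    then obtain K d where *: "\<And>B. bnd c B \<le> K * (B + 2) ^ d" by blast
    have "bnd (For x y c) B \<le> (K + 6 + 3) * (B + 2) ^ (Suc d + 1)" for B
    proof -
      have "B * (6 + bnd c B) \<le> (B + 2) * (6 + K * (B + 2) ^ d)"
        using *[of B] by (intro mult_mono) auto
      also have "\<dots> = K * (B + 2) ^ Suc d + 6 * (B + 2) ^ 1" by (simp add: algebra_simps)
      finally show ?thesis using le[of K B "Suc d" 6 1 3] by simp
    qed
    then show ?case by blast
  qed
qed

section \<open>Freeing the registers\<close>

text \<open>Straight-line code, because no cell is free yet for a counter: cell 2 is the moving
  destination, and cell 0 holds the stride 32.\<close>

definition save_cells :: "nat \<Rightarrow> instr list" where
  "save_cells b = concat (map (\<lambda>j. [Add 2 2 0, Store 2 j]) [3..<b])"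

text \<open>Ten doublings turn the number M of arcs into the base 1024 M. When the cells below 256
  are saved, cell 2 points to the copy of cell 255, which is 32 times 255 = 8160 beyond the base;
  subtracting this recovers the base for cell 31.\<close>

definition relocate_low :: "instr list" where
  "relocate_low = replicate 10 (Add 2 2 2) @ [Store 2 0, Const 0 32, Add 2 2 0, Store 2 1, Add 2 2 0] @
     save_cells 256 @ [Const 1 8160, Sub 31 2 1, Const 3 256, Add 2 2 0, Const 4 1]"

text \<open>The jump targets are absolute: the loop starts at 527 = 1 + 526, behind the first test
  and the relocation, and the compiled program follows 8 instructions later at 535.\<close>

definition copy_loop :: "instr list" where
  "copy_loop = [Sub 5 31 3, Jz 5 535, Load 6 3, Store 2 6, Add 3 3 4, Add 2 2 0, Const 5 0, Jz 5 527]"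

text \<open>
  The input may occupy any given cell, so that initially no address is known to be free. The number
  of arcs, doubled ten times, is an address beyond the input; everything is copied there before the
  low cells serve as registers. If there is no arc, the last two instructions announce a fictitious
  one, which reads as a loop at vertex 0 and is discarded later.
\<close>

definition machine :: "com \<Rightarrow> instr list" where
  "machine c = [Jz 2 (537 + clen c)] @ relocate_low @ copy_loop @ ccomp 535 c @
     [Const 32 0, Jz 32 (539 + clen c)] @ [Const 2 1, Jz 3 1]"

lemma length_save_cells: "length (save_cells b) = 2 * (b - 3)"
  by (simp add: save_cells_def length_concat comp_def sum_list_triv)

lemma length_relocate_low: "length relocate_low = 526"
  by (simp add: relocate_low_def length_save_cells)

lemma save_cells_correct:
  assumes "3 \<le> b" "b \<le> 256" "m 0 = 32" "m 2 = p" "256 \<le> p"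
  shows "fold mstep (save_cells b) m 2 = p + 32 * (b - 3) \<and>
    (\<forall>j. 3 \<le> j \<and> j < b \<longrightarrow> fold mstep (save_cells b) m (p + 32 * (j - 2)) = m j) \<and>
    (\<forall>x. x \<noteq> 2 \<and> x \<le> p \<longrightarrow> fold mstep (save_cells b) m x = m x)"
  using assms(1,2)
proof (induction b rule: dec_induct)
  case base
  then show ?case using assms by (simp add: save_cells_def)
next
  case (step b)
  let ?m = "fold mstep (save_cells b) m"
  have IH: "?m 2 = p + 32 * (b - 3)" "\<And>j. 3 \<le> j \<Longrightarrow> j < b \<Longrightarrow> ?m (p + 32 * (j - 2)) = m j"
    "\<And>x. x \<noteq> 2 \<Longrightarrow> x \<le> p \<Longrightarrow> ?m x = m x" using step by auto
  have "save_cells (Suc b) = save_cells b @ [Add 2 2 0, Store 2 b]"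
    using step.hyps by (simp add: save_cells_def)
  moreover have "p + 32 * (b - 3) + 32 = p + 32 * (b - 2)" using step.hyps by simp
  ultimately have m': "fold mstep (save_cells (Suc b)) m =
      ?m(2 := p + 32 * (b - 2), p + 32 * (b - 2) := m b)"
    using IH(1) IH(3)[of 0] IH(3)[of b] assms step by auto
  have "p + 32 * (b - 2) \<noteq> 2" "p < p + 32 * (b - 2)" using assms step.hyps by auto
  moreover have "p + 32 * (j - 2) = p + 32 * (b - 2) \<longleftrightarrow> j = b" if "3 \<le> j" for j
    using that step.hyps by auto
  ultimately show ?case unfolding m' using IH step.hyps assms by (auto simp: less_Suc_eq)
qed

text \<open>Entry 2 of array 0 is left out: cell 2 served as the pointer from the start, and the
  number of arcs survives only in the base in cell 31. The cells from 256 up to the base are kept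
  intact as sources of the copy.\<close>

definition loaded :: "nat \<Rightarrow> (nat \<Rightarrow> nat) \<Rightarrow> nat \<Rightarrow> (nat \<Rightarrow> nat) \<Rightarrow> bool" where
  "loaded B m0 i m \<longleftrightarrow> m 0 = 32 \<and> m 31 = B \<and> m 4 = 1 \<and> m 3 = i \<and> m 2 = B + 32 * i \<and>
     (\<forall>x. 256 \<le> x \<and> x < B \<longrightarrow> m x = m0 x) \<and> (\<forall>j<i. j \<noteq> 2 \<longrightarrow> m (B + 32 * j) = m0 j)"

lemma relocate_low_correct:
  assumes "1 \<le> m 2"
  shows "loaded (1024 * m 2) m 256 (fold mstep relocate_low m)"
proof -
  define B where "B = 1024 * m 2"
  have B: "1024 \<le> B" using assms by (simp add: B_def)
  define m1 where "m1 = m(0 := 32, B := m 0, B + 32 := m 1, 2 := B + 64)"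
  have "fold mstep (replicate i (Add 2 2 2)) m = m(2 := 2 ^ i * m 2)" for i
    by (induction i) (auto simp: fun_eq_iff replicate_append_same[symmetric] simp del: replicate_append_same)
  from this[of 10] have "fold mstep (replicate 10 (Add 2 2 2)) m = m(2 := B)"
    by (simp add: B_def)
  then have "fold mstep (replicate 10 (Add 2 2 2) @ [Store 2 0, Const 0 32, Add 2 2 0, Store 2 1, Add 2 2 0]) m = m1"
    using B by (auto simp: m1_def fun_eq_iff)
  then have f: "fold mstep relocate_low m =
      fold mstep [Const 1 8160, Sub 31 2 1, Const 3 256, Add 2 2 0, Const 4 1] (fold mstep (save_cells 256) m1)"
    unfolding relocate_low_def by (metis append_assoc comp_apply fold_append)
  define m2 where "m2 = fold mstep (save_cells 256) m1"
  have m2: "m2 2 = B + 8160" "\<And>j. 3 \<le> j \<Longrightarrow> j < 256 \<Longrightarrow> m2 (B + 64 + 32 * (j - 2)) = m1 j"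
    "\<And>x. x \<noteq> 2 \<Longrightarrow> x \<le> B + 64 \<Longrightarrow> m2 x = m1 x"
    using save_cells_correct[of 256 m1 "B + 64"] B by (auto simp: m2_def m1_def)
  have "m2 (B + 32 * j) = m j" if "3 \<le> j" "j < 256" for j
  proof -
    have "B + 64 + 32 * (j - 2) = B + 32 * j" using that by simp
    then have "m2 (B + 32 * j) = m1 j" using m2(2)[of j] that by metis
    then show ?thesis using that B by (simp add: m1_def)
  qed
  moreover have "m2 B = m 0" "m2 (B + 32) = m 1" using m2(3) B by (auto simp: m1_def)
  ultimately have low: "m2 (B + 32 * j) = m j" if "j < 256" "j \<noteq> 2" for j
    using that by (cases "j = 0"; cases "j = 1") (auto simp: numeral_3_eq_3)
  have high: "m2 x = m x" if "256 \<le> x" "x < B" for x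
    using m2(3)[of x] that by (simp add: m1_def)
  have "m2 0 = 32" using m2(3)[of 0] B by (simp add: m1_def)
  then show ?thesis
    unfolding f loaded_def B_def[symmetric] m2_def[symmetric] using B low high m2(1) by auto
qed

text \<open>Copying cannot destroy what is still to be copied: destinations start at
  \<open>B\<close>, sources end below it. Each cell takes the 8 instructions of the loop, and the
  test that ends it takes 2.\<close>

lemma copy_loop_correct:
  assumes code: "code_at P 527 copy_loop" and m: "loaded B m0 256 m" and B: "1024 \<le> B"
  shows "\<exists>m'. run P (8 * (B - 256) + 2) (527, m) = (535, m') \<and> loaded B m0 B m'"
proof -
  have c: "P ! 527 = Sub 5 31 3" "P ! 528 = Jz 5 535" "P ! 529 = Load 6 3" "P ! 530 = Store 2 6"
    "P ! 531 = Add 3 3 4" "P ! 532 = Add 2 2 0" "P ! 533 = Const 5 0" "P ! 534 = Jz 5 527" "534 < length P"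
    using code by (auto simp: copy_loop_def)
  have loop: "\<exists>m'. run P (8 * i) (527, m) = (527, m') \<and> loaded B m0 (256 + i) m'" if "256 + i \<le> B" for i
    using that
  proof (induction i)
    case 0
    then show ?case using m by simp
  next
    case (Suc i)
    then obtain m1 where m1: "run P (8 * i) (527, m) = (527, m1)" "loaded B m0 (256 + i) m1" by auto
    define m2 where "m2 = m1(5 := 0, 6 := m1 (256 + i), 3 := 256 + i + 1,
      B + 32 * (256 + i) := m1 (256 + i), 2 := B + 32 * (256 + i) + 32)"
    have 8: "(8::nat) = Suc (Suc (Suc (Suc (Suc (Suc (Suc (Suc 0)))))))" by simp
    have regs: "m1 0 = 32" "m1 31 = B" "m1 4 = 1" "m1 3 = 256 + i" "m1 2 = B + 32 * (256 + i)"
      using m1(2) by (simp_all add: loaded_def)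
    have far: "B + 32 * (256 + i) \<noteq> r" if "r < 7" for r using that B by simp
    have "B - (256 + i) \<noteq> 0" using Suc.prems by simp
    then have "run P 8 (527, m1) = (527, m2)"
      unfolding 8 using regs far c by (simp add: run_Suc step_code m2_def) (auto simp: fun_eq_iff)
    then have "run P (8 * Suc i) (527, m) = (527, m2)"
      using run_trans[OF m1(1), of 8] by (simp add: add.commute)
    moreover have "loaded B m0 (256 + Suc i) m2"
    proof -
      have "m1 (256 + i) = m0 (256 + i)" using m1(2) Suc.prems by (simp add: loaded_def)
      moreover have "B + 32 * j = B + 32 * (256 + i) \<longleftrightarrow> j = 256 + i" for j by auto
      moreover have "B + 32 * j \<noteq> r" if "r < 7" for j r using that B by simp
      moreover have "m1 (B + 32 * j) = m0 j" if "j < 256 + i" "j \<noteq> 2" for j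
        using m1(2) that by (simp add: loaded_def)
      moreover have "m1 x = m0 x" if "256 \<le> x" "x < B" for x using m1(2) that by (simp add: loaded_def)
      ultimately show ?thesis
        unfolding loaded_def m2_def using regs B Suc.prems by (simp add: less_Suc_eq)
    qed
    ultimately show ?case by blast
  qed
  obtain m1 where m1: "run P (8 * (B - 256)) (527, m) = (527, m1)" "loaded B m0 B m1"
    using loop[of "B - 256"] B by auto
  have "run P 2 (527, m1) = (535, m1(5 := 0))"
    using m1(2) c by (simp add: run_Suc step_code numeral_2_eq_2 loaded_def)
  moreover have "loaded B m0 B (m1(5 := 0))" using m1(2) B by (auto simp: loaded_def)
  ultimately show ?thesis using run_trans[OF m1(1)] by blast
qed

lemma code_at_machine:
  "code_at (machine c) 0 [Jz 2 (537 + clen c)]"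
  "code_at (machine c) 1 relocate_low"
  "code_at (machine c) 527 copy_loop"
  "code_at (machine c) 535 (ccomp 535 c)"
  "code_at (machine c) (535 + clen c) [Const 32 0, Jz 32 (539 + clen c)]"
  "code_at (machine c) (537 + clen c) [Const 2 1, Jz 3 1]"
  "length (machine c) = 539 + clen c"
proof -
  have "code_at (machine c) 0 (machine c)" by (simp add: code_at_def)
  then have "code_at (machine c) 0 ([Jz 2 (537 + clen c)] @ relocate_low @ copy_loop @ ccomp 535 c @
     [Const 32 0, Jz 32 (539 + clen c)] @ [Const 2 1, Jz 3 1])" by (simp add: machine_def)
  then show "code_at (machine c) 0 [Jz 2 (537 + clen c)]"
    "code_at (machine c) 1 relocate_low"
    "code_at (machine c) 527 copy_loop"
    "code_at (machine c) 535 (ccomp 535 c)"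
    "code_at (machine c) (535 + clen c) [Const 32 0, Jz 32 (539 + clen c)]"
    "code_at (machine c) (537 + clen c) [Const 2 1, Jz 3 1]"
    unfolding code_at_append by (simp_all add: length_relocate_low copy_loop_def)
  show "length (machine c) = 539 + clen c"
    by (simp add: machine_def length_relocate_low copy_loop_def)
qed

lemma straight_relocate_low: "i \<in> set relocate_low \<Longrightarrow> straight i"
  by (auto simp: relocate_low_def save_cells_def)

theorem machine_correct:
  assumes "cwf c"
  obtains s t where
    "fst s 31 = 1024 * max 1 (length as)"
    "\<And>j. j < 1024 * max 1 (length as) \<Longrightarrow> j \<noteq> 2 \<Longrightarrow> snd s 0 j = input_mem n k as j"
    "t \<le> 8192 * (length as + 1) + 540 + cost c s"
    "halted (machine c) (run (machine c) t (0, input_mem n k as))"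
    "snd (run (machine c) t (0, input_mem n k as)) 0 = fst (eval c s) 0"
proof -
  let ?P = "machine c" and ?m = "input_mem n k as"
  define M where "M = max 1 (length as)"
  define B where "B = 1024 * M"
  define m0 where "m0 = ?m(2 := M)"
  have B: "1024 \<le> B" by (simp add: B_def M_def)
  note code = code_at_machine[of c]
  obtain t0 where t0: "t0 \<le> 3" "run ?P t0 (0, ?m) = (1, m0)"
  proof (cases "as = []")
    case True
    have "run ?P 1 (0, ?m) = (537 + clen c, ?m)"
      using code(1,7) True by (simp add: run_Suc step_code input_mem_def)
    \<comment> \<open>Without arcs cell 3 is 0 as well, so the last test always jumps back to the
      relocation.\<close>
    moreover have "run ?P 2 (537 + clen c, ?m) = (1, m0)"
      using code(6,7) True
      by (simp add: run_Suc step_code input_mem_def m0_def M_def numeral_2_eq_2)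
    ultimately have "run ?P (1 + 2) (0, ?m) = (1, m0)" by (rule run_trans)
    then show thesis using that[of 3] by (simp add: numeral_3_eq_3)
  next
    case False
    have "run ?P 1 (0, ?m) = (1, ?m)"
      using code(1,7) False by (simp add: run_Suc step_code input_mem_def)
    moreover have "M = length as" using False by (cases as) (auto simp: M_def)
    then have "m0 = ?m" by (auto simp: m0_def input_mem_def)
    ultimately show thesis using that[of 1] by simp
  qed
  define m1 where "m1 = fold mstep relocate_low m0"
  have r1: "run ?P 526 (1, m0) = (527, m1)"
    using run_straight[OF code(2)] straight_relocate_low by (simp add: length_relocate_low m1_def)
  have "1 \<le> m0 2" by (simp add: m0_def M_def)
  from relocate_low_correct[of m0, OF this] have "loaded B m0 256 m1" by (simp add: m0_def B_def m1_def)
  then obtain m2 where m2: "run ?P (8 * (B - 256) + 2) (527, m1) = (535, m2)" "loaded B m0 B m2"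
    using copy_loop_correct[OF code(3) _ B] by blast
  \<comment> \<open>The state is read off the memory as it is. Apart from the base and the input in
    array 0, nothing is claimed about its contents.\<close>
  define s where "s = (m2, \<lambda>a i. m2 (m2 31 + 32 * i + a))"
  have s31: "fst s 31 = B" using m2(2) by (simp add: s_def loaded_def)
  have "represents s m2" using s31 B by (simp add: represents_def s_def)
  then obtain m3 where m3: "run ?P (cost c s) (535, m2) = (535 + clen c, m3)" "represents (eval c s) m3"
    using ccomp_correct[OF code(4) assms] by blast
  have r4: "run ?P 2 (535 + clen c, m3) = (539 + clen c, m3(32 := 0))"
    using code(5,7) by (simp add: run_Suc step_code numeral_2_eq_2)
  have r: "run ?P (t0 + (526 + ((8 * (B - 256) + 2) + (cost c s + 2)))) (0, ?m) = (539 + clen c, m3(32 := 0))"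
    by (rule run_trans[OF t0(2) run_trans[OF r1 run_trans[OF m2(1) run_trans[OF m3(1) r4]]]])
  show thesis
  proof (rule that[of s "t0 + (526 + ((8 * (B - 256) + 2) + (cost c s + 2)))"])
    show "fst s 31 = 1024 * max 1 (length as)" using s31 by (simp add: B_def M_def)
    show "snd s 0 j = ?m j" if "j < 1024 * max 1 (length as)" "j \<noteq> 2" for j
      using m2(2) that by (auto simp: s_def loaded_def B_def M_def m0_def)
    have "B \<le> 1024 * (length as + 1)" by (auto simp: B_def M_def)
    then show "t0 + (526 + ((8 * (B - 256) + 2) + (cost c s + 2))) \<le> 8192 * (length as + 1) + 540 + cost c s"
      using t0 B by simp
    show "halted ?P (run ?P (t0 + (526 + ((8 * (B - 256) + 2) + (cost c s + 2)))) (0, ?m))"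
      unfolding r using code(7) by (simp add: halted_def)
    show "snd (run ?P (t0 + (526 + ((8 * (B - 256) + 2) + (cost c s + 2)))) (0, ?m)) 0 = fst (eval c s) 0"
      unfolding r using m3(2) by (simp add: represents_def)
  qed
qed

section \<open>Set comprehension by exhaustive search\<close>

text \<open>
  Sets of vertices and relations are stored in arrays, relations row by row. Variable 1 holds the
  number n of vertices, array 1 the offsets of the rows, array 7 the distances of the last call of
  the closure routine.
\<close>

definition ix :: "nat \<Rightarrow> nat \<Rightarrow> aexp" where
  "ix x y = Plus (Arr 1 (V x)) (V y)"

text \<open>Any positive number counts as true; truncated subtraction maps it to 0 and 0 to 1, and
  disjunction is plain addition.\<close>

definition NotE :: "aexp \<Rightarrow> aexp" where "NotE e = Minus (N 1) e"
definition AndE :: "aexp \<Rightarrow> aexp \<Rightarrow> aexp" where "AndE e f = NotE (Plus (NotE e) (NotE f))"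
definition LessE :: "aexp \<Rightarrow> aexp \<Rightarrow> aexp" where "LessE e f = Minus f e"
definition EqE :: "aexp \<Rightarrow> aexp \<Rightarrow> aexp" where "EqE e f = NotE (Plus (Minus e f) (Minus f e))"

lemma aval_bool [simp]:
  "0 < aval (NotE e) s \<longleftrightarrow> aval e s = 0"
  "0 < aval (AndE e f) s \<longleftrightarrow> 0 < aval e s \<and> 0 < aval f s"
  "0 < aval (LessE e f) s \<longleftrightarrow> aval e s < aval f s"
  "0 < aval (EqE e f) s \<longleftrightarrow> aval e s = aval f s"
  by (auto simp: NotE_def AndE_def LessE_def EqE_def)

datatype fm =
    Vec nat nat
  | Mat nat nat nat
  | Btw nat nat nat
  | Eqv nat nat
  | Lt nat nat
  | Neg fm
  | Conj fm fm
  | Disj fm fm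

fun cf :: "fm \<Rightarrow> aexp" where
  "cf (Vec a x) = Arr a (V x)"
| "cf (Mat a x y) = Arr a (ix x y)"
| "cf (Btw x y z) = AndE (EqE (Plus (Arr 7 (ix x y)) (Arr 7 (ix y z))) (Arr 7 (ix x z))) (LessE (Arr 7 (ix x z)) (V 1))"
| "cf (Eqv x y) = EqE (V x) (V y)"
| "cf (Lt x y) = LessE (V x) (V y)"
| "cf (Neg p) = NotE (cf p)"
| "cf (Conj p q) = AndE (cf p) (cf q)"
| "cf (Disj p q) = Plus (cf p) (cf q)"

fun fvars :: "fm \<Rightarrow> nat set" where
  "fvars (Vec a x) = {x}"
| "fvars (Mat a x y) = {x, y}"
| "fvars (Btw x y z) = {x, y, z}"
| "fvars (Eqv x y) = {x, y}"
| "fvars (Lt x y) = {x, y}"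
| "fvars (Neg p) = fvars p"
| "fvars (Conj p q) = fvars p \<union> fvars q"
| "fvars (Disj p q) = fvars p \<union> fvars q"

fun farrs :: "fm \<Rightarrow> nat set" where
  "farrs (Vec a x) = {a}"
| "farrs (Mat a x y) = {1, a}"
| "farrs (Btw x y z) = {1, 7}"
| "farrs (Eqv x y) = {}"
| "farrs (Lt x y) = {}"
| "farrs (Neg p) = farrs p"
| "farrs (Conj p q) = farrs p \<union> farrs q"
| "farrs (Disj p q) = farrs p \<union> farrs q"

fun sem :: "fm \<Rightarrow> (nat \<Rightarrow> nat) \<Rightarrow> (nat \<Rightarrow> nat set) \<Rightarrow> (nat \<Rightarrow> (nat \<times> nat) set) \<Rightarrow>
    (nat \<times> nat \<times> nat) set \<Rightarrow> bool" where
  "sem (Vec a x) f VV MM T \<longleftrightarrow> f x \<in> VV a"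
| "sem (Mat a x y) f VV MM T \<longleftrightarrow> (f x, f y) \<in> MM a"
| "sem (Btw x y z) f VV MM T \<longleftrightarrow> (f x, f y, f z) \<in> T"
| "sem (Eqv x y) f VV MM T \<longleftrightarrow> f x = f y"
| "sem (Lt x y) f VV MM T \<longleftrightarrow> f x < f y"
| "sem (Neg p) f VV MM T \<longleftrightarrow> \<not> sem p f VV MM T"
| "sem (Conj p q) f VV MM T \<longleftrightarrow> sem p f VV MM T \<and> sem q f VV MM T"
| "sem (Disj p q) f VV MM T \<longleftrightarrow> sem p f VV MM T \<or> sem q f VV MM T"

text \<open>A fixed division of the arrays: these numbers are read as relations, all others as
  vertex sets. With 1 and 7 among them, row offsets and distances cannot be addressed as vertex
  sets.\<close>

definition matrices :: "nat set" where
  "matrices = {1, 2, 3, 4, 5, 6, 7, 8, 9, 13}"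

fun kinds :: "fm \<Rightarrow> bool" where
  "kinds (Vec a x) \<longleftrightarrow> a \<notin> matrices"
| "kinds (Mat a x y) \<longleftrightarrow> a \<in> matrices"
| "kinds (Btw x y z) \<longleftrightarrow> True"
| "kinds (Eqv x y) \<longleftrightarrow> True"
| "kinds (Lt x y) \<longleftrightarrow> True"
| "kinds (Neg p) \<longleftrightarrow> kinds p"
| "kinds (Conj p q) \<longleftrightarrow> kinds p \<and> kinds q"
| "kinds (Disj p q) \<longleftrightarrow> kinds p \<and> kinds q"

definition vset :: "nat \<Rightarrow> state \<Rightarrow> nat \<Rightarrow> nat set" where
  "vset n s a = {v. v < n \<and> 0 < snd s a v}"

definition mset :: "nat \<Rightarrow> state \<Rightarrow> nat \<Rightarrow> (nat \<times> nat) set" where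
  "mset n s a = {(u, v). u < n \<and> v < n \<and> 0 < snd s a (u * n + v)}"

definition tset :: "nat \<Rightarrow> state \<Rightarrow> (nat \<times> nat \<times> nat) set" where
  "tset n s = {(u, v, w). u < n \<and> v < n \<and> w < n \<and>
     snd s 7 (u * n + v) + snd s 7 (v * n + w) = snd s 7 (u * n + w) \<and> snd s 7 (u * n + w) < n}"

definition framed :: "nat \<Rightarrow> state \<Rightarrow> bool" where
  "framed n s \<longleftrightarrow> fst s 1 = n \<and> (\<forall>u<n. snd s 1 u = u * n)"

text \<open>The abstract view of the memory in which the blocks of formulas are verified.
  \<open>T\<close> stands for the distances in array 7, which formulas access only to compare sums
  along a triple of vertices.\<close>

definition st :: "nat \<Rightarrow> state \<Rightarrow> (nat \<Rightarrow> nat set) \<Rightarrow> (nat \<Rightarrow> (nat \<times> nat) set) \<Rightarrow> (nat \<times> nat \<times> nat) set \<Rightarrow> bool" where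
  "st n s VV MM T \<longleftrightarrow> framed n s \<and> (\<forall>a. a \<notin> matrices \<longrightarrow> VV a = vset n s a) \<and>
     (\<forall>a\<in>matrices. MM a = mset n s a) \<and> T = tset n s"

lemma framed_eval: "framed n s \<Longrightarrow> 1 \<notin> wv c \<Longrightarrow> 1 \<notin> wa c \<Longrightarrow> framed n (eval c s)"
  by (simp add: framed_def eval_wv eval_wa)

lemma framed_setv [simp]: "x \<noteq> 1 \<Longrightarrow> framed n (setv x v s) \<longleftrightarrow> framed n s"
  by (simp add: framed_def)

lemma sets_setv [simp]: "vset n (setv x v s) a = vset n s a" "mset n (setv x v s) a = mset n s a"
  "tset n (setv x v s) = tset n s"
  by (simp_all add: vset_def mset_def tset_def)

lemma st_setv [simp]: "x \<noteq> 1 \<Longrightarrow> st n (setv x v s) VV MM T \<longleftrightarrow> st n s VV MM T"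
  by (simp add: st_def)

lemma cf_sem:
  assumes "st n s VV MM T" "kinds p" "\<And>x. x \<in> fvars p \<Longrightarrow> fst s x < n"
  shows "0 < aval (cf p) s \<longleftrightarrow> sem p (fst s) VV MM T"
  using assms(2,3)
proof (induction p)
  case (Btw x y z)
  then show ?case using assms(1) by (auto simp: st_def tset_def ix_def framed_def)
qed (use assms(1) in \<open>auto simp: st_def vset_def mset_def ix_def framed_def\<close>)

lemma cf_cong:
  assumes "\<forall>x\<in>fvars p \<union> {1}. fst s x = fst s' x" "\<forall>a\<in>farrs p. snd s a = snd s' a"
  shows "aval (cf p) s = aval (cf p) s'"
  using assms by (induction p) (auto simp: ix_def NotE_def AndE_def EqE_def LessE_def)

lemma sem_cong:
  "(\<And>x. x \<in> fvars p \<Longrightarrow> f x = g x) \<Longrightarrow> sem p f VV MM T \<longleftrightarrow> sem p g VV MM T"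
  by (induction p) auto

lemma For_invariant:
  assumes "x \<notin> wv c" "I 0 (setv x 0 s)"
    and step: "\<And>i t. i < fst s y \<Longrightarrow> I i t \<Longrightarrow> fst t x = i \<Longrightarrow> I (Suc i) (setv x (Suc i) (eval c t))"
  shows "I (fst s y) (eval (For x y c) s)"
proof -
  let ?f = "\<lambda>s. setv x (Suc (fst s x)) (eval c s)"
  have "i \<le> fst s y \<Longrightarrow> I i ((?f ^^ i) (setv x 0 s)) \<and> fst ((?f ^^ i) (setv x 0 s)) x = i" for i
  proof (induction i)
    case (Suc i)
    then show ?case using step[of i "(?f ^^ i) (setv x 0 s)"] assms(1) by (simp add: eval_wv)
  qed (use assms(2) in simp)
  then show ?thesis by simp
qed

text \<open>There are always two quantified variables, 5 and 6; a formula that mentions fewer of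
  them is not affected as long as there is a vertex at all. Deeper nesting is resolved by auxiliary
  arrays.\<close>

definition Exists :: "fm \<Rightarrow> com" where
  "Exists p = Seq (Assign 7 (N 0)) (For 5 1 (For 6 1 (If (cf p) (Assign 7 (N 1)) (Assign 7 (V 7)))))"

lemma writes_Exists [simp]: "wv (Exists p) = {5, 6, 7}" "wa (Exists p) = {}" "lv (Exists p) = {1}"
  by (auto simp: Exists_def)

lemma eval_Exists:
  assumes "7 \<notin> fvars p" "fst s 1 = n"
  shows "fst (eval (Exists p) s) 7 = of_bool (\<exists>x<n. \<exists>y<n. 0 < aval (cf p) (setv 6 y (setv 5 x s)))"
proof -
  let ?P = "\<lambda>x y. 0 < aval (cf p) (setv 6 y (setv 5 x s))"
  let ?body = "If (cf p) (Assign 7 (N 1)) (Assign 7 (V 7))"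
  let ?I = "\<lambda>i t. fst t 7 = of_bool (\<exists>x<i. \<exists>y<n. ?P x y) \<and> (\<forall>z. z \<notin> {5, 6, 7} \<longrightarrow> fst t z = fst s z) \<and> snd t = snd s"
  let ?J = "\<lambda>i j t. fst t 7 = of_bool ((\<exists>x<i. \<exists>y<n. ?P x y) \<or> (\<exists>y<j. ?P i y)) \<and>
     (\<forall>z. z \<notin> {5, 6, 7} \<longrightarrow> fst t z = fst s z) \<and> snd t = snd s \<and> fst t 5 = i"
  have inner: "?J i n (eval (For 6 1 ?body) t)" if t: "?I i t" "fst t 5 = i" for i t
  proof -
    have t1: "fst t 1 = n" using t assms(2) by simp
    have "?J i (fst t 1) (eval (For 6 1 ?body) t)"
    proof (rule For_invariant[where I = "?J i"])
      show "?J i 0 (setv 6 0 t)" using t by simp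
      fix j r assume r: "?J i j r" "fst r 6 = j"
      have "aval (cf p) r = aval (cf p) (setv 6 j (setv 5 i s))"
        by (rule cf_cong) (use r assms(1) in auto)
      then show "?J i (Suc j) (setv 6 (Suc j) (eval ?body r))"
        using r by (auto simp: less_Suc_eq)
    qed simp
    then show ?thesis unfolding t1 .
  qed
  have "?I (fst (setv 7 0 s) 1) (eval (For 5 1 (For 6 1 ?body)) (setv 7 0 s))"
  proof (rule For_invariant[where I = ?I])
    show "?I 0 (setv 5 0 (setv 7 0 s))" by simp
    fix i t assume "?I i t" "fst t 5 = i"
    from inner[OF this] show "?I (Suc i) (setv 5 (Suc i) (eval (For 6 1 ?body) t))"
      by (auto simp: Ex_less_Suc simp del: eval.simps)
  qed simp
  then show ?thesis using assms(2) by (simp add: Exists_def del: eval.simps(5))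
qed

definition VEC :: "nat \<Rightarrow> fm \<Rightarrow> com" where
  "VEC a p = For 3 1 (Seq (Exists p) (Put a (V 3) (V 7)))"

definition MAT :: "nat \<Rightarrow> fm \<Rightarrow> com" where
  "MAT a p = For 3 1 (For 4 1 (Seq (Exists p) (Put a (ix 3 4) (V 7))))"

lemma writes_VEC [simp]: "wv (VEC a p) = {3, 5, 6, 7}" "wa (VEC a p) = {a}" "lv (VEC a p) = {1}"
  by (auto simp: VEC_def)

lemma writes_MAT [simp]: "wv (MAT a p) = {3, 4, 5, 6, 7}" "wa (MAT a p) = {a}" "lv (MAT a p) = {1}"
  by (auto simp: MAT_def)

text \<open>\<open>t\<close> is a state in the middle of filling array \<open>a\<close>, and
  \<open>s\<close> the one before; as the formula does not read \<open>a\<close>, it has the same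
  value in both.\<close>

lemma sem_Exists:
  assumes st: "st n s VV MM T" and p: "kinds p" "7 \<notin> fvars p" "a \<notin> farrs p" "a \<noteq> 1"
    and vars: "\<And>z. z \<in> fvars p - {5, 6} \<Longrightarrow> fst t z = fst s z \<and> fst s z < n"
    and t: "fst t 1 = n" "\<And>b. b \<noteq> a \<Longrightarrow> snd t b = snd s b"
  shows "fst (eval (Exists p) t) 7 = of_bool (\<exists>x<n. \<exists>y<n. sem p ((fst s)(5 := x, 6 := y)) VV MM T)"
proof -
  have n: "fst s 1 = n" using st by (simp add: st_def framed_def)
  have "0 < aval (cf p) (setv 6 y (setv 5 x t)) \<longleftrightarrow> sem p ((fst s)(5 := x, 6 := y)) VV MM T"
    if "x < n" "y < n" for x y
  proof -
    have "aval (cf p) (setv 6 y (setv 5 x t)) = aval (cf p) (setv 6 y (setv 5 x s))"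
    proof (rule cf_cong; intro ballI)
      fix z assume "z \<in> fvars p \<union> {1}"
      then show "fst (setv 6 y (setv 5 x t)) z = fst (setv 6 y (setv 5 x s)) z"
        using vars[of z] t n p by auto
    next
      fix b assume "b \<in> farrs p"
      then have "b \<noteq> a" using p by blast
      then show "snd (setv 6 y (setv 5 x t)) b = snd (setv 6 y (setv 5 x s)) b" using t by simp
    qed
    moreover have "0 < aval (cf p) (setv 6 y (setv 5 x s)) \<longleftrightarrow> sem p (fst (setv 6 y (setv 5 x s))) VV MM T"
      by (rule cf_sem) (use st p that vars in auto)
    ultimately show ?thesis by simp
  qed
  then show ?thesis
    using eval_Exists[OF p(2) t(1)] by (auto cong: conj_cong)
qed

lemma st_VEC:
  assumes st: "st n s VV MM T" and a: "a \<notin> matrices" and p: "kinds p" "7 \<notin> fvars p" "a \<notin> farrs p"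
    and vars: "\<And>z. z \<in> fvars p - {3, 5, 6} \<Longrightarrow> fst s z < n"
  shows "st n (eval (VEC a p) s)
     (VV(a := {v. v < n \<and> (\<exists>x<n. \<exists>y<n. sem p ((fst s)(3 := v, 5 := x, 6 := y)) VV MM T)})) MM T"
    and "\<And>v. v < n \<Longrightarrow> snd (eval (VEC a p) s) a v =
      of_bool (\<exists>x<n. \<exists>y<n. sem p ((fst s)(3 := v, 5 := x, 6 := y)) VV MM T)"
proof -
  define G where "G v \<longleftrightarrow> (\<exists>x<n. \<exists>y<n. sem p ((fst s)(3 := v, 5 := x, 6 := y)) VV MM T)" for v
  let ?c = "Seq (Exists p) (Put a (V 3) (V 7))"
  let ?I = "\<lambda>i t. (\<forall>v<i. snd t a v = of_bool (G v)) \<and> (\<forall>z. z \<notin> {3, 5, 6, 7} \<longrightarrow> fst t z = fst s z) \<and>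
     (\<forall>b. b \<noteq> a \<longrightarrow> snd t b = snd s b)"
  have a1: "a \<noteq> 1" "a \<noteq> 7" using a by (auto simp: matrices_def)
  have n: "fst s 1 = n" using st by (simp add: st_def framed_def)
  have "?I (fst s 1) (eval (For 3 1 ?c) s)"
  proof (rule For_invariant[where I = ?I])
    show "?I 0 (setv 3 0 s)" by simp
    fix i t assume i: "i < fst s 1" and t: "?I i t" "fst t 3 = i"
    have "fst (eval (Exists p) t) 7 =
        of_bool (\<exists>x<n. \<exists>y<n. sem p ((fst (setv 3 i s))(5 := x, 6 := y)) VV MM T)"
    proof (rule sem_Exists[where a = a and s = "setv 3 i s"])
      fix z assume z: "z \<in> fvars p - {5, 6}"
      show "fst t z = fst (setv 3 i s) z \<and> fst (setv 3 i s) z < n"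
        using z t i n vars[of z] p(2) by (cases "z = 3") auto
    qed (use st p t n a1 in auto)
    then have "fst (eval (Exists p) t) 7 = of_bool (G i)" by (simp add: G_def)
    moreover have "fst (eval (Exists p) t) 3 = i" using t by (simp add: eval_wv)
    moreover have "snd (eval (Exists p) t) b = snd t b" for b by (simp add: eval_wa)
    moreover have "fst (eval (Exists p) t) z = fst t z" if "z \<notin> {3, 5, 6, 7}" for z
      using that by (simp add: eval_wv)
    ultimately show "?I (Suc i) (setv 3 (Suc i) (eval ?c t))"
      using t by (auto simp: less_Suc_eq)
  qed simp
  then have I: "?I n (eval (VEC a p) s)" by (simp only: n VEC_def)
  then show "snd (eval (VEC a p) s) a v =
      of_bool (\<exists>x<n. \<exists>y<n. sem p ((fst s)(3 := v, 5 := x, 6 := y)) VV MM T)" if "v < n" for v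
    using that unfolding G_def by blast
  have "framed n (eval (VEC a p) s)" using st a1 by (intro framed_eval) (auto simp: st_def)
  moreover have "vset n (eval (VEC a p) s) a = {v. v < n \<and> G v}"
    using I by (auto simp: vset_def)
  moreover have "b \<noteq> a \<Longrightarrow> vset n (eval (VEC a p) s) b = vset n s b"
    "b \<noteq> a \<Longrightarrow> mset n (eval (VEC a p) s) b = mset n s b" for b
    using I by (auto simp: vset_def mset_def)
  moreover have "tset n (eval (VEC a p) s) = tset n s" using I a1 by (simp add: tset_def)
  moreover have "b \<noteq> a" if "b \<in> matrices" for b using that a by blast
  ultimately show "st n (eval (VEC a p) s) (VV(a := {v. v < n \<and> (\<exists>x<n. \<exists>y<n. sem p ((fst s)(3 := v, 5 := x, 6 := y)) VV MM T)})) MM T"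
    using st unfolding st_def G_def by auto
qed

lemma row_index: "v < n \<Longrightarrow> v' < n \<Longrightarrow> u * n + v = u' * n + v' \<longleftrightarrow> u = u' \<and> v = (v'::nat)"
proof
  assume v: "v < n" "v' < n" and eq: "u * n + v = u' * n + v'"
  have "(u * n + v) div n = (u' * n + v') div n" using eq by simp
  then have "u = u'" using v by simp
  then show "u = u' \<and> v = v'" using eq by simp
qed simp

lemma For_For_invariant:
  assumes xy: "x \<notin> wv c" "z \<notin> wv c" "x \<noteq> z" "fst s y = n" "y \<noteq> x" "y \<noteq> z" "y \<notin> wv c"
    and I0: "I 0 0 s"
    and setv: "\<And>i j t v. I i j t \<Longrightarrow> I i j (setv x v t)" "\<And>i j t v. I i j t \<Longrightarrow> I i j (setv z v t)"
    and step: "\<And>i j t. i < n \<Longrightarrow> j < n \<Longrightarrow> I i j t \<Longrightarrow> fst t x = i \<Longrightarrow> fst t z = j \<Longrightarrow> fst t y = n \<Longrightarrow> I i (Suc j) (eval c t)"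
    and row: "\<And>i t. i < n \<Longrightarrow> I i n t \<Longrightarrow> I (Suc i) 0 t"
  shows "I n 0 (eval (For x y (For z y c)) s)"
proof -
  let ?J = "\<lambda>i t. I i 0 t \<and> fst t y = n"
  have "?J (fst s y) (eval (For x y (For z y c)) s)"
  proof (rule For_invariant[where I = ?J])
    show "x \<notin> wv (For z y c)" using xy by simp
    show "?J 0 (setv x 0 s)" using I0 setv xy by simp
    fix i t assume i: "i < fst s y" and t: "?J i t" "fst t x = i"
    let ?K = "\<lambda>j r. I i j r \<and> fst r y = n \<and> fst r x = i"
    have "?K (fst t y) (eval (For z y c) t)"
    proof (rule For_invariant[where I = ?K])
      show "?K 0 (setv z 0 t)" using t setv xy by simp
      fix j r assume "j < fst t y" "?K j r" "fst r z = j"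
      then show "?K (Suc j) (setv z (Suc j) (eval c r))"
        using step[of i j r] i t xy setv by (simp add: eval_wv)
    qed (use xy in simp)
    then show "?J (Suc i) (setv x (Suc i) (eval (For z y c) t))"
      using t row[of i] i setv xy by (simp del: eval.simps)
  qed
  then show ?thesis using xy by simp
qed

definition before :: "nat \<Rightarrow> nat \<Rightarrow> nat \<Rightarrow> nat \<Rightarrow> nat \<Rightarrow> bool" where
  "before n u v i j \<longleftrightarrow> u < n \<and> v < n \<and> (u < i \<or> u = i \<and> v < j)"

lemma before_simps [simp]:
  "\<not> before n u v 0 0"
  "before n u v i (Suc j) \<longleftrightarrow> before n u v i j \<or> u < n \<and> v < n \<and> u = i \<and> v = j"
  "before n u v i n \<longleftrightarrow> before n u v (Suc i) 0"
  "before n u v n 0 \<longleftrightarrow> u < n \<and> v < n"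
  by (auto simp: before_def)

lemma MAT_entries:
  assumes st: "st n s VV MM T" and a: "a \<in> matrices - {1}" and p: "kinds p" "7 \<notin> fvars p" "a \<notin> farrs p"
    and vars: "\<And>z. z \<in> fvars p - {3, 4, 5, 6} \<Longrightarrow> fst s z < n"
  shows "u < n \<Longrightarrow> v < n \<Longrightarrow> snd (eval (MAT a p) s) a (u * n + v) =
      of_bool (\<exists>x<n. \<exists>y<n. sem p ((fst s)(3 := u, 4 := v, 5 := x, 6 := y)) VV MM T)"
proof -
  define G where "G u v \<longleftrightarrow> (\<exists>x<n. \<exists>y<n. sem p ((fst s)(3 := u, 4 := v, 5 := x, 6 := y)) VV MM T)" for u v
  let ?c = "Seq (Exists p) (Put a (ix 3 4) (V 7))"
  let ?I = "\<lambda>i j t. (\<forall>u v. before n u v i j \<longrightarrow> snd t a (u * n + v) = of_bool (G u v)) \<and>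
     (\<forall>z. z \<notin> {3, 4, 5, 6, 7} \<longrightarrow> fst t z = fst s z) \<and> (\<forall>b. b \<noteq> a \<longrightarrow> snd t b = snd s b)"
  have n: "fst s 1 = n" and R: "\<And>u. u < n \<Longrightarrow> snd s 1 u = u * n" using st by (simp_all add: st_def framed_def)
  have "?I n 0 (eval (For 3 1 (For 4 1 ?c)) s)"
  proof (rule For_For_invariant[where n = n and I = ?I])
    fix i j t assume ij: "i < n" "j < n" and t: "?I i j t" "fst t 3 = i" "fst t 4 = j" "fst t 1 = n"
    have "fst (eval (Exists p) t) 7 =
        of_bool (\<exists>x<n. \<exists>y<n. sem p ((fst (setv 4 j (setv 3 i s)))(5 := x, 6 := y)) VV MM T)"
    proof (rule sem_Exists[where a = a and s = "setv 4 j (setv 3 i s)"])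
      fix z assume z: "z \<in> fvars p - {5, 6}"
      show "fst t z = fst (setv 4 j (setv 3 i s)) z \<and> fst (setv 4 j (setv 3 i s)) z < n"
        using z t ij n vars[of z] p(2) by (cases "z = 3"; cases "z = 4") auto
    qed (use st p t n a in auto)
    then have e: "fst (eval (Exists p) t) 7 = of_bool (G i j)" by (simp add: G_def)
    have "aval (ix 3 4) (eval (Exists p) t) = i * n + j"
      using t ij a R by (simp add: ix_def eval_wv eval_wa)
    then show "?I i (Suc j) (eval ?c t)"
      using t(1) ij e by (auto simp: row_index eval_wv eval_wa before_def)
  qed (use n in auto)
  then show "u < n \<Longrightarrow> v < n \<Longrightarrow> snd (eval (MAT a p) s) a (u * n + v) = of_bool (\<exists>x<n. \<exists>y<n. sem p ((fst s)(3 := u, 4 := v, 5 := x, 6 := y)) VV MM T)"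
    by (simp add: MAT_def G_def del: eval.simps)
qed

lemma st_MAT:
  assumes st: "st n s VV MM T" and a: "a \<in> matrices - {1, 7}" and p: "kinds p" "7 \<notin> fvars p" "a \<notin> farrs p"
    and vars: "\<And>z. z \<in> fvars p - {3, 4, 5, 6} \<Longrightarrow> fst s z < n"
  shows "st n (eval (MAT a p) s) VV
     (MM(a := {(u, v). u < n \<and> v < n \<and> (\<exists>x<n. \<exists>y<n. sem p ((fst s)(3 := u, 4 := v, 5 := x, 6 := y)) VV MM T)})) T"
proof -
  have other: "b \<noteq> a \<Longrightarrow> snd (eval (MAT a p) s) b = snd s b" for b by (simp add: eval_wa)
  have "framed n (eval (MAT a p) s)" using st a by (intro framed_eval) (auto simp: st_def)
  moreover have "mset n (eval (MAT a p) s) a =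
      {(u, v). u < n \<and> v < n \<and> (\<exists>x<n. \<exists>y<n. sem p ((fst s)(3 := u, 4 := v, 5 := x, 6 := y)) VV MM T)}"
  proof -
    define G where "G u v \<longleftrightarrow> (\<exists>x<n. \<exists>y<n. sem p ((fst s)(3 := u, 4 := v, 5 := x, 6 := y)) VV MM T)" for u v
    have "u < n \<Longrightarrow> v < n \<Longrightarrow> snd (eval (MAT a p) s) a (u * n + v) = of_bool (G u v)" for u v
      using MAT_entries[OF st _ p vars, of u v] a unfolding G_def by blast
    then show ?thesis unfolding G_def[symmetric] by (auto simp: mset_def)
  qed
  moreover have "vset n (eval (MAT a p) s) b = vset n s b" if "b \<notin> matrices" for b
  proof -
    have "b \<noteq> a" using that a by blast
    then show ?thesis using other[of b] by (simp add: vset_def)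
  qed
  moreover have "b \<noteq> a \<Longrightarrow> mset n (eval (MAT a p) s) b = mset n s b" for b
    using other by (auto simp: mset_def)
  moreover have "tset n (eval (MAT a p) s) = tset n s" using other[of 7] a by (simp add: tset_def)
  ultimately show ?thesis using st unfolding st_def by auto
qed

section \<open>Distances\<close>

text \<open>The distance truncated at \<open>m\<close>; for \<open>m = n\<close> the value
  \<open>n\<close> plays the role of infinity. This form matches a loop that adds 1 in each round in
  which the pair is not yet connected.\<close>

definition dcount :: "nat \<Rightarrow> (nat \<times> nat) set \<Rightarrow> nat \<Rightarrow> nat \<Rightarrow> nat" where
  "dcount m R u v = card {j. j < m \<and> (\<forall>k\<le>j. (u, v) \<notin> R ^^ k)}"

lemma dcount_0 [simp]: "dcount 0 R u v = 0"
  by (simp add: dcount_def)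

lemma dcount_Suc: "dcount (Suc m) R u v = dcount m R u v + of_bool (\<forall>k\<le>m. (u, v) \<notin> R ^^ k)"
proof -
  have "{j. j < Suc m \<and> (\<forall>k\<le>j. (u, v) \<notin> R ^^ k)} =
      {j. j < m \<and> (\<forall>k\<le>j. (u, v) \<notin> R ^^ k)} \<union> (if \<forall>k\<le>m. (u, v) \<notin> R ^^ k then {m} else {})"
    by (auto simp: less_Suc_eq)
  then show ?thesis by (auto simp: dcount_def)
qed

lemma shortest_walk_bound:
  assumes R: "R \<subseteq> {..<n} \<times> {..<n}" and u: "u < n" and d: "(u, v) \<in> R ^^ d" "\<And>k. (u, v) \<in> R ^^ k \<Longrightarrow> d \<le> k"
  shows "d < n"
proof -
  obtain g where g: "g 0 = u" "g d = v" "\<And>i. i < d \<Longrightarrow> (g i, g (Suc i)) \<in> R"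
    using d(1) by (auto simp: relpow_fun_conv)
  have walk: "i \<le> j \<Longrightarrow> j \<le> d \<Longrightarrow> (g i, g j) \<in> R ^^ (j - i)" for i j
    unfolding relpow_fun_conv using g(3) by (intro exI[of _ "\<lambda>m. g (i + m)"]) auto
  have "g i \<noteq> g j" if "i < j" "j \<le> d" for i j
  proof
    assume "g i = g j"
    then have "(u, v) \<in> R ^^ (i + (d - j))"
      using relpow_trans[where x = u and y = "g i" and z = v and i = i and j = "d - j" and A = R] walk[of 0 i] walk[of j d] that g by simp
    then show False using d(2) that by fastforce
  qed
  then have "inj_on g {..d}" by (intro inj_onI) (metis atMost_iff linorder_neqE_nat)
  moreover have "g ` {..d} \<subseteq> {..<n}"
  proof
    fix x assume "x \<in> g ` {..d}"
    then obtain i where "i \<le> d" "x = g i" by blast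
    then show "x \<in> {..<n}" using g(1) g(3)[of "i - 1"] R u by (cases i) auto
  qed
  ultimately have "card {..d} \<le> card {..<n}" using card_inj_on_le by blast
  then show ?thesis by simp
qed

lemma dcount_reachable:
  assumes R: "R \<subseteq> {..<n} \<times> {..<n}" and u: "u < n" and d: "(u, v) \<in> R ^^ d" "\<And>k. (u, v) \<in> R ^^ k \<Longrightarrow> d \<le> k"
  shows "dcount n R u v = d"
proof -
  have "d < n" using shortest_walk_bound[OF assms] .
  moreover have "(\<forall>k\<le>j. (u, v) \<notin> R ^^ k) \<longleftrightarrow> j < d" for j
    using d by (meson le_less_trans linorder_not_less order_refl)
  ultimately have "{j. j < n \<and> (\<forall>k\<le>j. (u, v) \<notin> R ^^ k)} = {..<d}" by auto
  then show ?thesis by (simp add: dcount_def)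
qed

lemma dcount_less_iff:
  assumes R: "R \<subseteq> {..<n} \<times> {..<n}" and u: "u < n"
  shows "dcount n R u v < n \<longleftrightarrow> (u, v) \<in> R\<^sup>*"
proof
  assume "(u, v) \<in> R\<^sup>*"
  then obtain d where "(u, v) \<in> R ^^ d" "\<And>k. (u, v) \<in> R ^^ k \<Longrightarrow> d \<le> k" by (elim shortest_walkE) blast
  then show "dcount n R u v < n" using dcount_reachable[OF assms] shortest_walk_bound[OF assms] by metis
next
  assume less: "dcount n R u v < n"
  show "(u, v) \<in> R\<^sup>*"
  proof (rule ccontr)
    assume "(u, v) \<notin> R\<^sup>*"
    then have "(u, v) \<notin> R ^^ k" for k using relpow_imp_rtrancl by blast
    then show False using less by (simp add: dcount_def)
  qed
qed

text \<open>Unreachable pairs have the value \<open>n\<close>, so a sum below \<open>n\<close>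
  certifies that all three pairs are reachable, and then the values are true distances.\<close>

lemma btw_dcount:
  assumes R: "R \<subseteq> {..<n} \<times> {..<n}" and uvw: "u < n" "v < n" "w < n"
  shows "btw R u v w \<longleftrightarrow> dcount n R u v + dcount n R v w = dcount n R u w \<and> dcount n R u w < n"
proof
  assume b: "btw R u v w"
  then have reach: "(u, v) \<in> R\<^sup>*" "(v, w) \<in> R\<^sup>*" by (auto dest: btw_reach)
  obtain i j where ij: "(u, v) \<in> R ^^ i" "(v, w) \<in> R ^^ j" "\<And>k. (u, w) \<in> R ^^ k \<Longrightarrow> i + j \<le> k"
    using b unfolding btw_def by blast
  have "i \<le> k" if "(u, v) \<in> R ^^ k" for k using ij(3)[OF relpow_trans[OF that ij(2)]] by simp
  then have 1: "dcount n R u v = i" using dcount_reachable[OF R uvw(1) ij(1)] by blast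
  have "j \<le> k" if "(v, w) \<in> R ^^ k" for k using ij(3)[OF relpow_trans[OF ij(1) that]] by simp
  then have 2: "dcount n R v w = j" using dcount_reachable[OF R uvw(2) ij(2)] by blast
  have "dcount n R u w = i + j"
    using dcount_reachable[OF R uvw(1) relpow_trans[OF ij(1,2)] ij(3)] .
  moreover have "(u, w) \<in> R\<^sup>*" using reach by auto
  ultimately show "dcount n R u v + dcount n R v w = dcount n R u w \<and> dcount n R u w < n"
    using 1 2 dcount_less_iff[OF R uvw(1)] by metis
next
  assume d: "dcount n R u v + dcount n R v w = dcount n R u w \<and> dcount n R u w < n"
  then have "dcount n R u v < n" "dcount n R v w < n" "dcount n R u w < n" by auto
  then have reach: "(u, v) \<in> R\<^sup>*" "(v, w) \<in> R\<^sup>*" "(u, w) \<in> R\<^sup>*"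
    using dcount_less_iff[OF R] uvw by blast+
  obtain i where i: "(u, v) \<in> R ^^ i" "\<And>k. (u, v) \<in> R ^^ k \<Longrightarrow> i \<le> k" using reach(1) by (elim shortest_walkE) blast
  obtain j where j: "(v, w) \<in> R ^^ j" "\<And>k. (v, w) \<in> R ^^ k \<Longrightarrow> j \<le> k" using reach(2) by (elim shortest_walkE) blast
  obtain l where l: "(u, w) \<in> R ^^ l" "\<And>k. (u, w) \<in> R ^^ k \<Longrightarrow> l \<le> k" using reach(3) by (elim shortest_walkE) blast
  have "i + j = l"
    using d dcount_reachable[OF R uvw(1) i] dcount_reachable[OF R uvw(2) j] dcount_reachable[OF R uvw(1) l] by simp
  then show "btw R u v w" unfolding btw_def using i j l by blast
qed

lemma ex_less_nat [simp]: "(\<exists>x. x < (n::nat)) \<longleftrightarrow> 0 < n"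
  by auto

definition ACC :: com where
  "ACC = For 3 1 (For 4 1 (Put 7 (ix 3 4) (Plus (Arr 7 (ix 3 4)) (Minus (N 1) (Arr 5 (ix 3 4))))))"

text \<open>After m rounds array 5 holds the pairs connected within m steps and array 7 the
  distances truncated at m. Array 6 is a buffer, since a formula must not read the array that it
  fills; \<open>Neg (Eqv 3 3)\<close> is the constant false and clears an array.\<close>

definition RTC :: "nat \<Rightarrow> com" where
  "RTC a = Seq (MAT 7 (Neg (Eqv 3 3))) (Seq (MAT 5 (Eqv 3 4)) (For 10 1 (Seq ACC
     (Seq (MAT 6 (Disj (Mat 5 3 4) (Conj (Mat 5 3 5) (Mat a 5 4)))) (MAT 5 (Mat 6 3 4))))))"

lemma writes_ACC [simp]: "wv ACC = {3, 4}" "wa ACC = {7}" "lv ACC = {1}"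
  by (auto simp: ACC_def)

lemma writes_RTC [simp]: "wv (RTC a) = {3, 4, 5, 6, 7, 10}" "wa (RTC a) = {5, 6, 7}" "lv (RTC a) = {1}"
  by (auto simp: RTC_def)

lemma st_other:
  assumes "st n s VV MM T" "framed n s'" "D \<subseteq> matrices" "\<And>b. b \<notin> D \<Longrightarrow> snd s' b = snd s b"
  shows "st n s' VV (\<lambda>b. if b \<in> D then mset n s' b else MM b) (tset n s')"
proof -
  have "vset n s' b = vset n s b" if "b \<notin> matrices" for b
  proof -
    have "b \<notin> D" using assms(3) that by blast
    then show ?thesis using assms(4)[of b] by (simp add: vset_def)
  qed
  moreover have "mset n s' b = mset n s b" if "b \<notin> D" for b
    using assms(4)[OF that] by (simp add: mset_def)
  ultimately show ?thesis using assms(1,2) by (auto simp: st_def)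
qed

lemma ACC_entries:
  assumes st: "framed n s"
  shows "u < n \<Longrightarrow> v < n \<Longrightarrow> snd (eval ACC s) 7 (u * n + v) =
     snd s 7 (u * n + v) + (1 - snd s 5 (u * n + v))"
proof -
  let ?c = "Put 7 (ix 3 4) (Plus (Arr 7 (ix 3 4)) (Minus (N 1) (Arr 5 (ix 3 4))))"
  let ?I = "\<lambda>i j t. (\<forall>u v. u < n \<and> v < n \<longrightarrow> snd t 7 (u * n + v) =
     snd s 7 (u * n + v) + (if before n u v i j then 1 - snd s 5 (u * n + v) else 0)) \<and>
     (\<forall>b. b \<noteq> 7 \<longrightarrow> snd t b = snd s b)"
  have n: "fst s 1 = n" and R: "\<And>u. u < n \<Longrightarrow> snd s 1 u = u * n" using st by (simp_all add: framed_def)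
  have "?I n 0 (eval (For 3 1 (For 4 1 ?c)) s)"
  proof (rule For_For_invariant[where n = n and I = ?I])
    fix i j and t :: state
    assume ij: "i < n" "j < n" and t: "?I i j t" "fst t 3 = i" "fst t 4 = j" "fst t 1 = n"
    have "aval (ix 3 4) t = i * n + j" using t ij R by (simp add: ix_def)
    then show "?I i (Suc j) (eval ?c t)"
      using t(1) ij by (auto simp: row_index) (auto simp: before_def)
  qed (use n in auto)
  then show "u < n \<Longrightarrow> v < n \<Longrightarrow> ?thesis"
    by (simp add: ACC_def del: eval.simps)
qed

lemma st_RTC:
  assumes st: "st n s VV MM T" and a: "a \<in> matrices - {1, 5, 6, 7}"
  shows "\<exists>MM'. st n (eval (RTC a) s) VV MM' {(u, v, w). u < n \<and> v < n \<and> w < n \<and> btw (MM a) u v w} \<and>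
    MM' 5 = {(u, v). u < n \<and> v < n \<and> (u, v) \<in> (MM a)\<^sup>*} \<and> (\<forall>b. b \<notin> {5, 6, 7} \<longrightarrow> MM' b = MM b)"
proof -
  define R where "R = MM a"
  have R: "R \<subseteq> {..<n} \<times> {..<n}" using st a by (auto simp: R_def st_def mset_def)
  let ?c = "Seq ACC (Seq (MAT 6 (Disj (Mat 5 3 4) (Conj (Mat 5 3 5) (Mat a 5 4)))) (MAT 5 (Mat 6 3 4)))"
  define I where "I m t \<longleftrightarrow> (\<exists>MM'. st n t VV MM' (tset n t) \<and> (\<forall>b. b \<notin> {5, 6, 7} \<longrightarrow> MM' b = MM b) \<and>
     MM' 5 = {(u, v). u < n \<and> v < n \<and> (\<exists>k\<le>m. (u, v) \<in> R ^^ k)} \<and>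
     (\<forall>u<n. \<forall>v<n. snd t 7 (u * n + v) = dcount m R u v))" for m t
  define s1 where "s1 = eval (MAT 7 (Neg (Eqv 3 3))) s"
  define s2 where "s2 = eval (MAT 5 (Eqv 3 4)) s1"
  have e1: "snd s1 7 (u * n + v) = 0" if "u < n" "v < n" for u v
    using MAT_entries[OF st, of 7 "Neg (Eqv 3 3)" u v] that by (simp add: s1_def matrices_def)
  have fr1: "framed n s1" using st by (auto simp: s1_def st_def intro!: framed_eval)
  have st1: "st n s1 VV (\<lambda>b. if b \<in> {7} then mset n s1 b else MM b) (tset n s1)"
    by (rule st_other[OF st fr1]) (auto simp: matrices_def s1_def eval_wa)
  have "st n s2 VV ((\<lambda>b. if b \<in> {7} then mset n s1 b else MM b)(5 := {(u, v). u < n \<and> v < n \<and>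
      (\<exists>x<n. \<exists>y<n. sem (Eqv 3 4) ((fst s1)(3 := u, 4 := v, 5 := x, 6 := y)) VV
        (\<lambda>b. if b \<in> {7} then mset n s1 b else MM b) (tset n s1))})) (tset n s1)"
    unfolding s2_def by (rule st_MAT[OF st1]) (auto simp: matrices_def)
  then have st2: "st n s2 VV ((\<lambda>b. if b \<in> {7} then mset n s1 b else MM b)(5 := {(u, v). u < n \<and> v < n \<and> u = v})) (tset n s1)"
    by (simp cong: conj_cong)
  have "tset n s2 = tset n s1" using st2 by (simp add: st_def)
  then have I0: "I 0 (setv 10 0 s2)"
    unfolding I_def using st2 e1
    by (intro exI[of _ "(\<lambda>b. if b \<in> {7} then mset n s1 b else MM b)(5 := {(u, v). u < n \<and> v < n \<and> u = v})"])
      (auto simp: s2_def eval_wa)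
  have n: "fst s2 1 = n" using st2 by (simp add: st_def framed_def)
  have "I (fst s2 1) (eval (For 10 1 ?c) s2)"
  proof (rule For_invariant)
    show "I 0 (setv 10 0 s2)" by (rule I0)
    fix m t assume "I m t"
    then obtain MM' where t: "st n t VV MM' (tset n t)" "\<And>b. b \<notin> {5, 6, 7} \<Longrightarrow> MM' b = MM b"
      "MM' 5 = {(u, v). u < n \<and> v < n \<and> (\<exists>k\<le>m. (u, v) \<in> R ^^ k)}"
      "\<And>u v. u < n \<Longrightarrow> v < n \<Longrightarrow> snd t 7 (u * n + v) = dcount m R u v" unfolding I_def by (elim exE conjE) simp
    define t1 where "t1 = eval ACC t"
    define t2 where "t2 = eval (MAT 6 (Disj (Mat 5 3 4) (Conj (Mat 5 3 5) (Mat a 5 4)))) t1"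
    define t3 where "t3 = eval (MAT 5 (Mat 6 3 4)) t2"
    have frt: "framed n t" using t by (simp add: st_def)
    have five: "0 < snd t 5 (u * n + v) \<longleftrightarrow> (\<exists>k\<le>m. (u, v) \<in> R ^^ k)" if "u < n" "v < n" for u v
    proof -
      have "MM' 5 = mset n t 5" using t(1) by (simp add: st_def matrices_def)
      then have "mset n t 5 = {(u, v). u < n \<and> v < n \<and> (\<exists>k\<le>m. (u, v) \<in> R ^^ k)}" using t(3) by (rule trans[OF sym])
      then have "(u, v) \<in> mset n t 5 \<longleftrightarrow> (\<exists>k\<le>m. (u, v) \<in> R ^^ k)" using that by simp
      then show ?thesis using that by (simp add: mset_def)
    qed
    have acc: "snd t1 7 (u * n + v) = dcount (Suc m) R u v" if "u < n" "v < n" for u v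
    proof -
      have "(1::nat) - snd t 5 (u * n + v) = of_bool (\<not> 0 < snd t 5 (u * n + v))" by auto
      then have "1 - snd t 5 (u * n + v) = of_bool (\<forall>k\<le>m. (u, v) \<notin> R ^^ k)" using five[OF that] by simp
      then show ?thesis using ACC_entries[OF frt that] t(4)[OF that] by (simp add: t1_def dcount_Suc)
    qed
    have fr1: "framed n t1" unfolding t1_def using frt by (rule framed_eval) auto
    have st1: "st n t1 VV (\<lambda>b. if b \<in> {7} then mset n t1 b else MM' b) (tset n t1)"
      by (rule st_other[OF t(1) fr1]) (auto simp: matrices_def t1_def eval_wa)
    define M1 where "M1 = (\<lambda>b. if b \<in> {7} then mset n t1 b else MM' b)"
    define M2 where "M2 = M1(6 := {(u, v). u < n \<and> v < n \<and> (\<exists>k\<le>Suc m. (u, v) \<in> R ^^ k)})"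
    have "st n t2 VV (M1(6 := {(u, v). u < n \<and> v < n \<and>
      (\<exists>x<n. \<exists>y<n. sem (Disj (Mat 5 3 4) (Conj (Mat 5 3 5) (Mat a 5 4)))
        ((fst t1)(3 := u, 4 := v, 5 := x, 6 := y)) VV M1 (tset n t1))})) (tset n t1)"
      unfolding t2_def by (rule st_MAT[OF st1[folded M1_def]]) (use a in \<open>auto simp: matrices_def\<close>)
    moreover have "(\<exists>x<n. \<exists>y<n. sem (Disj (Mat 5 3 4) (Conj (Mat 5 3 5) (Mat a 5 4)))
        ((fst t1)(3 := u, 4 := v, 5 := x, 6 := y)) VV M1 (tset n t1)) \<longleftrightarrow> (\<exists>k\<le>Suc m. (u, v) \<in> R ^^ k)"
      if uv: "u < n" "v < n" for u v
    proof -
      have Ma: "M1 a = R" using a t(2)[of a] by (auto simp: M1_def R_def)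
      have M5: "M1 5 = MM' 5" by (simp add: M1_def)
      have "(\<exists>x<n. \<exists>y<n. sem (Disj (Mat 5 3 4) (Conj (Mat 5 3 5) (Mat a 5 4)))
        ((fst t1)(3 := u, 4 := v, 5 := x, 6 := y)) VV M1 (tset n t1)) \<longleftrightarrow>
        ((u, v) \<in> MM' 5 \<or> (\<exists>x<n. (u, x) \<in> MM' 5 \<and> (x, v) \<in> R))"
        using uv by (auto simp: Ma M5)
      also have "\<dots> \<longleftrightarrow> (\<exists>k\<le>m. (u, v) \<in> R ^^ k) \<or> (\<exists>x. \<exists>k\<le>m. (u, x) \<in> R ^^ k \<and> (x, v) \<in> R)"
        using uv R by (auto simp: t(3))
      also have "(\<exists>x. \<exists>k\<le>m. (u, x) \<in> R ^^ k \<and> (x, v) \<in> R) \<longleftrightarrow> (\<exists>k\<le>m. (u, v) \<in> R ^^ Suc k)"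
        by (auto simp: relcomp_unfold)
      also have "(\<exists>k\<le>m. (u, v) \<in> R ^^ k) \<or> (\<exists>k\<le>m. (u, v) \<in> R ^^ Suc k) \<longleftrightarrow> (\<exists>k\<le>Suc m. (u, v) \<in> R ^^ k)"
      proof -
        have "(u, v) \<in> R ^^ k \<Longrightarrow> k \<le> Suc m \<Longrightarrow> \<not> k \<le> m \<Longrightarrow> \<exists>k\<le>m. (u, v) \<in> R ^^ Suc k" for k
          by (metis le_SucE order_refl)
        then show ?thesis by (meson Suc_le_mono le_SucI)
      qed
      finally show ?thesis .
    qed
    ultimately have st2: "st n t2 VV M2 (tset n t1)" by (simp add: M2_def cong: conj_cong)
    have "st n t3 VV (M2(5 := {(u, v). u < n \<and> v < n \<and>
      (\<exists>x<n. \<exists>y<n. sem (Mat 6 3 4) ((fst t2)(3 := u, 4 := v, 5 := x, 6 := y)) VV M2 (tset n t1))})) (tset n t1)"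
      unfolding t3_def by (rule st_MAT[OF st2]) (auto simp: matrices_def)
    moreover have "{(u, v). u < n \<and> v < n \<and>
      (\<exists>x<n. \<exists>y<n. sem (Mat 6 3 4) ((fst t2)(3 := u, 4 := v, 5 := x, 6 := y)) VV M2 (tset n t1))} = M2 6"
      by (auto simp: M2_def)
    ultimately have st3: "st n t3 VV (M2(5 := M2 6)) (tset n t1)" by simp
    have T3: "tset n t3 = tset n t1" using st3 by (simp add: st_def)
    have "snd t3 7 = snd t1 7" by (simp add: t3_def t2_def eval_wa)
    then have "I (Suc m) (setv 10 (Suc m) t3)"
      unfolding I_def using st3 acc t(2)
      by (intro exI[of _ "M2(5 := M2 6)"]) (auto simp: T3 M2_def M1_def)
    then show "I (Suc m) (setv 10 (Suc m) (eval ?c t))"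
      by (simp add: t3_def t2_def t1_def)
  qed simp
  then have "I n (eval (For 10 1 ?c) s2)" unfolding n .
  moreover have "eval (RTC a) s = eval (For 10 1 ?c) s2"
    by (simp add: RTC_def s1_def s2_def del: eval.simps(5))
  ultimately have "I n (eval (RTC a) s)" by simp
  then obtain MM' where t: "st n (eval (RTC a) s) VV MM' (tset n (eval (RTC a) s))"
      "\<And>b. b \<notin> {5, 6, 7} \<Longrightarrow> MM' b = MM b"
      "MM' 5 = {(u, v). u < n \<and> v < n \<and> (\<exists>k\<le>n. (u, v) \<in> R ^^ k)}"
      "\<And>u v. u < n \<Longrightarrow> v < n \<Longrightarrow> snd (eval (RTC a) s) 7 (u * n + v) = dcount n R u v" unfolding I_def by (elim exE conjE) simp
  have "tset n (eval (RTC a) s) = {(u, v, w). u < n \<and> v < n \<and> w < n \<and> btw R u v w}"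
    using t(4) btw_dcount[OF R] by (auto simp: tset_def)
  moreover have "(\<exists>k\<le>n. (u, v) \<in> R ^^ k) \<longleftrightarrow> (u, v) \<in> R\<^sup>*" if "u < n" for u v
  proof
    assume "(u, v) \<in> R\<^sup>*"
    then obtain d where d: "(u, v) \<in> R ^^ d" "\<And>k. (u, v) \<in> R ^^ k \<Longrightarrow> d \<le> k" by (elim shortest_walkE) blast
    then show "\<exists>k\<le>n. (u, v) \<in> R ^^ k" using shortest_walk_bound[OF R that d] by (intro exI[of _ d]) auto
  qed (auto dest: relpow_imp_rtrancl)
  then have "MM' 5 = {(u, v). u < n \<and> v < n \<and> (u, v) \<in> R\<^sup>*}" using t(3) by auto
  ultimately show ?thesis using t(1,2) unfolding R_def[symmetric] by (intro exI[of _ MM']) auto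
qed

definition vval :: "nat \<Rightarrow> fm \<Rightarrow> (nat \<Rightarrow> nat set) \<Rightarrow> (nat \<Rightarrow> (nat \<times> nat) set) \<Rightarrow> (nat \<times> nat \<times> nat) set \<Rightarrow> nat set" where
  "vval n p VV MM T = {v. v < n \<and> (\<exists>x<n. \<exists>y<n. sem p ((\<lambda>_. v)(5 := x, 6 := y)) VV MM T)}"

definition vok :: "nat \<Rightarrow> fm \<Rightarrow> bool" where
  "vok a p \<longleftrightarrow> a \<notin> matrices \<and> kinds p \<and> a \<notin> farrs p \<and> fvars p \<subseteq> {3, 5, 6}"

lemma st_vval:
  assumes "st n s VV MM T" "vok a p"
  shows "st n (eval (VEC a p) s) (VV(a := vval n p VV MM T)) MM T"
    "v < n \<Longrightarrow> snd (eval (VEC a p) s) a v = of_bool (v \<in> vval n p VV MM T)"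
proof -
  have "sem p ((fst s)(3 := v, 5 := x, 6 := y)) VV MM T \<longleftrightarrow> sem p ((\<lambda>_. v)(5 := x, 6 := y)) VV MM T" for v x y
    by (rule sem_cong) (use assms(2) in \<open>auto simp: vok_def\<close>)
  note this[symmetric, simp]
  have p: "a \<notin> matrices" "kinds p" "7 \<notin> fvars p" "a \<notin> farrs p" using assms(2) by (auto simp: vok_def)
  have v: "fst s z < n" if "z \<in> fvars p - {3, 5, 6}" for z using that assms(2) by (auto simp: vok_def)
  show "st n (eval (VEC a p) s) (VV(a := vval n p VV MM T)) MM T"
    using st_VEC(1)[OF assms(1) p v] by (simp add: vval_def)
  show "v < n \<Longrightarrow> snd (eval (VEC a p) s) a v = of_bool (v \<in> vval n p VV MM T)"
    using st_VEC(2)[OF assms(1) p v, of v] by (simp add: vval_def)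
qed

section \<open>The algorithm\<close>

definition INIT :: com where
  "INIT = Seq (Assign 1 (Arr 0 (N 0))) (Assign 2 (Arr 0 (N 1)))"

definition ROWS :: com where
  "ROWS = For 3 1 (Seq (Put 1 (V 3) (V 12)) (Assign 12 (Plus (V 12) (V 1))))"

text \<open>The number of arcs is known only through the base 1024 M in variable 31, so the counter
  12 advances in steps of 1024. The loop over all pairs is used merely for its n^2 rounds, enough
  for a list of distinct arcs.\<close>

definition READ :: com where
  "READ = For 3 1 (For 4 1 (Seq (If (LessE (V 12) (V 31))
      (Seq (Assign 13 (Arr 0 (V 11))) (Seq (Assign 14 (Arr 0 (Plus (V 11) (N 1)))) (Put 2 (ix 13 14) (N 1))))
      (Assign 13 (N 0)))
    (Seq (Assign 12 (Plus (V 12) (N 1024))) (Assign 11 (Plus (V 11) (N 2))))))"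

definition ARCS :: com where
  "ARCS = Seq (Assign 12 (N 0)) (Seq ROWS (Seq (MAT 2 (Neg (Eqv 3 3))) (Seq (Assign 11 (N 3))
     (Seq (Assign 12 (N 0)) (Seq READ (MAT 3 (Conj (Mat 2 3 4) (Neg (Eqv 3 4)))))))))"

text \<open>Each pair is tested by a closure computation of its own; array 8 receives the arcs that
  are not bridges.\<close>

definition BRIDGES :: com where
  "BRIDGES = For 8 1 (For 9 1 (Seq
     (MAT 4 (Disj (Conj (Mat 3 3 4) (Neg (Conj (Eqv 3 8) (Eqv 4 9)))) (Conj (Mat 3 4 3) (Neg (Conj (Eqv 4 8) (Eqv 3 9))))))
     (Seq (RTC 4) (Put 8 (ix 8 9) (cf (Conj (Mat 3 8 9) (Mat 5 8 9)))))))"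

lemma writes_INIT [simp]: "wv INIT = {1, 2}" "wa INIT = {}" "lv INIT = {}"
  by (auto simp: INIT_def)

lemma writes_ROWS [simp]: "wv ROWS = {3, 12}" "wa ROWS = {1}" "lv ROWS = {1}"
  by (auto simp: ROWS_def)

lemma writes_READ [simp]: "wv READ = {3, 4, 11, 12, 13, 14}" "wa READ = {2}" "lv READ = {1}"
  by (auto simp: READ_def)

lemma writes_ARCS [simp]: "wv ARCS = {3, 4, 5, 6, 7, 11, 12, 13, 14}" "wa ARCS = {1, 2, 3}" "lv ARCS = {1}"
  by (auto simp: ARCS_def)

lemma writes_BRIDGES [simp]: "wv BRIDGES = {3, 4, 5, 6, 7, 8, 9, 10}" "wa BRIDGES = {4, 5, 6, 7, 8}" "lv BRIDGES = {1}"
  by (auto simp: BRIDGES_def)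

lemma st_self: "framed n s \<Longrightarrow> st n s (vset n s) (mset n s) (tset n s)"
  by (simp add: st_def)

lemma ROWS_correct:
  assumes "fst s 1 = n" "fst s 12 = 0"
  shows "framed n (eval ROWS s)"
proof -
  let ?c = "Seq (Put 1 (V 3) (V 12)) (Assign 12 (Plus (V 12) (V 1)))"
  let ?I = "\<lambda>i t. fst t 1 = n \<and> fst t 12 = i * n \<and> (\<forall>u<i. snd t 1 u = u * n)"
  have "?I (fst s 1) (eval (For 3 1 ?c) s)"
    by (rule For_invariant[where I = ?I]) (use assms in \<open>auto simp: less_Suc_eq\<close>)
  then show ?thesis using assms unfolding ROWS_def framed_def by (simp del: eval.simps)
qed

lemma READ_correct:
  assumes fr: "framed n s" and vars: "fst s 11 = 3" "fst s 12 = 0" "fst s 31 = 1024 * length L"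
    and data: "\<And>q. q < length L \<Longrightarrow> snd s 0 (3 + 2 * q) = fst (L ! q) \<and> snd s 0 (4 + 2 * q) = snd (L ! q)"
    and L: "0 < n \<Longrightarrow> set L \<subseteq> {..<n} \<times> {..<n}" and empty: "mset n s 2 = {}"
  shows "mset n (eval READ s) 2 = set (take (n * n) L)"
proof -
  let ?c = "Seq (If (LessE (V 12) (V 31))
      (Seq (Assign 13 (Arr 0 (V 11))) (Seq (Assign 14 (Arr 0 (Plus (V 11) (N 1)))) (Put 2 (ix 13 14) (N 1))))
      (Assign 13 (N 0)))
    (Seq (Assign 12 (Plus (V 12) (N 1024))) (Assign 11 (Plus (V 11) (N 2))))"
  let ?I = "\<lambda>i j t. fst t 12 = 1024 * (i * n + j) \<and> fst t 11 = 3 + 2 * (i * n + j) \<and>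
     fst t 31 = 1024 * length L \<and> (\<forall>b. b \<noteq> 2 \<longrightarrow> snd t b = snd s b) \<and>
     mset n t 2 = set (take (i * n + j) L)"
  have n: "fst s 1 = n" and R: "\<And>u. u < n \<Longrightarrow> snd s 1 u = u * n" using fr by (simp_all add: framed_def)
  have "?I n 0 (eval (For 3 1 (For 4 1 ?c)) s)"
  proof (rule For_For_invariant[where n = n and I = ?I])
    fix i j and t :: state
    assume ij: "i < n" "j < n" and t: "?I i j t" "fst t 3 = i" "fst t 4 = j" "fst t 1 = n"
    define q where "q = i * n + j"
    have tq: "fst t 12 = 1024 * q" "fst t 11 = 3 + 2 * q" "fst t 31 = 1024 * length L"
      "\<And>b. b \<noteq> 2 \<Longrightarrow> snd t b = snd s b" "mset n t 2 = set (take q L)" using t(1) by (auto simp: q_def)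
    show "?I i (Suc j) (eval ?c t)"
    proof (cases "q < length L")
      case True
      define x y where "x = fst (L ! q)" "y = snd (L ! q)"
      have "L ! q \<in> set L" using True by simp
      then have xy: "x < n" "y < n" using L ij by (auto simp: x_y_def)
      define t1 where "t1 = setv 14 y (setv 13 x t)"
      have ix: "aval (ix 13 14) t1 = x * n + y" using tq(4) R xy by (simp add: ix_def t1_def)
      have d: "snd s 0 (3 + 2 * q) = x" "snd s 0 (4 + 2 * q) = y"
        using data[OF True] by (simp_all add: x_y_def)
      have e: "eval ?c t = setv 11 (5 + 2 * q) (setv 12 (1024 * q + 1024) (seta 2 (x * n + y) 1 t1))"
        using True tq d ix by (simp add: t1_def)
      have "mset n (eval ?c t) 2 = insert (x, y) (mset n t 2)"
        unfolding e using xy by (auto simp: mset_def t1_def row_index)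
      also have "\<dots> = set (take (Suc q) L)" using True tq(5) by (simp add: take_Suc_conv_app_nth x_y_def)
      finally have "mset n (eval ?c t) 2 = set (take (Suc q) L)" .
      then show ?thesis using tq unfolding e by (auto simp: q_def t1_def)
    next
      case False
      have e: "eval ?c t = setv 11 (5 + 2 * q) (setv 12 (1024 * q + 1024) (setv 13 0 t))"
        using False tq by simp
      show ?thesis using tq False unfolding e by (auto simp: q_def)
    qed
  next
    fix i j v and t :: state assume "?I i j t"
    then show "?I i j (setv 3 v t)" "?I i j (setv 4 v t)" by auto
  qed (use n vars empty in \<open>auto simp: algebra_simps\<close>)
  then show ?thesis by (simp add: READ_def del: eval.simps)
qed

lemma distinct_arcs_length:
  assumes "distinct as" "set as \<subseteq> {0..<n} \<times> {0..<n}"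
  shows "length as \<le> n * n"
  using card_mono[OF _ assms(2)] assms(1) by (simp add: distinct_card)

lemma ARCS_correct:
  assumes g: "distinct as" "digraph n (set as)"
    and s: "fst s 1 = n" "fst s 31 = 1024 * max 1 (length as)"
      "\<And>j. j < 1024 * max 1 (length as) \<Longrightarrow> j \<noteq> 2 \<Longrightarrow> snd s 0 j = input_mem n k as j"
  obtains VV MM T where "st n (eval ARCS s) VV MM T" "MM 3 = set as"
proof -
  define L where "L = (if as = [] then [(0, 0)] else as)"
  have len: "max 1 (length as) = length L" by (cases as) (auto simp: L_def)
  have arcs: "set as \<subseteq> {0..<n} \<times> {0..<n}" "\<And>v. (v, v) \<notin> set as" using g(2) by (auto simp: digraph_def)
  define s1 where "s1 = eval ROWS (setv 12 0 s)"
  define s2 where "s2 = eval (MAT 2 (Neg (Eqv 3 3))) s1"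
  define s3 where "s3 = setv 12 0 (setv 11 3 s2)"
  define s4 where "s4 = eval READ s3"
  have fr1: "framed n s1" unfolding s1_def by (rule ROWS_correct) (use s in auto)
  have st2: "st n s2 (vset n s1) ((mset n s1)(2 := {})) (tset n s1)"
    using st_MAT[OF st_self[OF fr1], of 2 "Neg (Eqv 3 3)"] by (simp add: s2_def matrices_def)
  have fr3: "framed n s3" using st2 by (simp add: s3_def st_def)
  have m3: "mset n s3 2 = {}" using st2 by (simp add: s3_def st_def matrices_def)
  have vars3: "fst s3 11 = 3" "fst s3 12 = 0" "fst s3 31 = 1024 * length L"
    using s(2) len by (simp_all add: s3_def s2_def s1_def eval_wv)
  have "snd s3 0 = snd s 0" by (simp add: s3_def s2_def s1_def eval_wa)
  then have data: "snd s3 0 (3 + 2 * q) = fst (L ! q) \<and> snd s3 0 (4 + 2 * q) = snd (L ! q)" if "q < length L" for q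
  proof -
    have "snd s3 0 j = input_mem n k as j" if "j < 1024 * length L" "j \<noteq> 2" for j
      using s(3)[of j] that \<open>snd s3 0 = snd s 0\<close> by (metis len)
    from this[of "3 + 2 * q"] this[of "4 + 2 * q"] show ?thesis
      using that by (auto simp: input_mem_def L_def)
  qed
  \<comment> \<open>For n = 0 the fictitious arc would be out of range, but then no round of the
    loop takes place.\<close>
  have "set L \<subseteq> {..<n} \<times> {..<n}" if "0 < n" using arcs that by (auto simp: L_def)
  from READ_correct[OF fr3 vars3 data this m3]
  have m4: "mset n s4 2 = set (take (n * n) L)" by (simp add: s4_def)
  have fr4: "framed n s4" unfolding s4_def using fr3 by (rule framed_eval) auto
  have lenL: "length L \<le> n * n \<or> n = 0" using distinct_arcs_length[OF g(1) arcs(1)] by (auto simp: L_def)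
  have "st n (eval (MAT 3 (Conj (Mat 2 3 4) (Neg (Eqv 3 4)))) s4) (vset n s4)
     ((mset n s4)(3 := {(u, v). u < n \<and> v < n \<and> (u, v) \<in> mset n s4 2 \<and> u \<noteq> v})) (tset n s4)"
    using st_MAT[OF st_self[OF fr4], of 3 "Conj (Mat 2 3 4) (Neg (Eqv 3 4))"]
    by (simp add: matrices_def cong: conj_cong)
  moreover have "eval (MAT 3 (Conj (Mat 2 3 4) (Neg (Eqv 3 4)))) s4 = eval ARCS s"
    by (simp add: ARCS_def s4_def s3_def s2_def s1_def)
  moreover have "{(u, v). u < n \<and> v < n \<and> (u, v) \<in> mset n s4 2 \<and> u \<noteq> v} = set as"
    using m4 lenL arcs by (auto simp: L_def split: if_splits)
  ultimately show thesis using that by simp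
qed

lemma BRIDGES_correct:
  assumes st: "st n s VV MM T" and A: "MM 3 = A"
  obtains MM' T' where "st n (eval BRIDGES s) VV MM' T'" "MM' 3 = A" "MM' 8 = inner A"
proof -
  define p where "p = Disj (Conj (Mat 3 3 4) (Neg (Conj (Eqv 3 8) (Eqv 4 9)))) (Conj (Mat 3 4 3) (Neg (Conj (Eqv 4 8) (Eqv 3 9))))"
  let ?q = "Conj (Mat 3 8 9) (Mat 5 8 9)"
  let ?c = "Seq (MAT 4 p) (Seq (RTC 4) (Put 8 (ix 8 9) (cf ?q)))"
  define I where "I i j t \<longleftrightarrow> (\<exists>MM'. st n t VV MM' (tset n t) \<and> MM' 3 = A \<and>
     (\<forall>u v. before n u v i j \<longrightarrow> ((u, v) \<in> MM' 8 \<longleftrightarrow> (u, v) \<in> inner A)))" for i j t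
  have n: "fst s 1 = n" using st by (simp add: st_def framed_def)
  have An: "A \<subseteq> {..<n} \<times> {..<n}" using st A by (auto simp: st_def mset_def matrices_def)
  have "I n 0 (eval (For 8 1 (For 9 1 ?c)) s)"
  proof (rule For_For_invariant[where n = n and I = I])
    show "I 0 0 s" using st A by (auto simp: I_def st_def)
    fix i j and t :: state
    assume ij: "i < n" "j < n" and t: "I i j t" "fst t 8 = i" "fst t 9 = j" "fst t 1 = n"
    obtain MM1 where M1: "st n t VV MM1 (tset n t)" "MM1 3 = A"
      "\<And>u v. before n u v i j \<Longrightarrow> (u, v) \<in> MM1 8 \<longleftrightarrow> (u, v) \<in> inner A"
      using t(1) unfolding I_def by blast
    let ?B = "A - {(i, j)}"
    define t1 where "t1 = eval (MAT 4 p) t"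
    define t2 where "t2 = eval (RTC 4) t1"
    have "st n t1 VV (MM1(4 := {(u, v). u < n \<and> v < n \<and> (\<exists>x<n. \<exists>y<n. sem p
        ((fst t)(3 := u, 4 := v, 5 := x, 6 := y)) VV MM1 (tset n t))})) (tset n t)"
      unfolding t1_def by (rule st_MAT[OF M1(1)]) (use t ij in \<open>auto simp: matrices_def p_def\<close>)
    moreover have "{(u, v). u < n \<and> v < n \<and> (\<exists>x<n. \<exists>y<n. sem p
        ((fst t)(3 := u, 4 := v, 5 := x, 6 := y)) VV MM1 (tset n t))} = ?B \<union> ?B\<inverse>"
      using An M1(2) t ij by (auto simp: p_def)
    ultimately have st1: "st n t1 VV (MM1(4 := ?B \<union> ?B\<inverse>)) (tset n t)" by simp
    obtain MM2 T2 where M2: "st n t2 VV MM2 T2" "MM2 5 = {(u, v). u < n \<and> v < n \<and> (u, v) \<in> (?B \<union> ?B\<inverse>)\<^sup>*}"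
      "\<And>b. b \<notin> {5, 6, 7} \<Longrightarrow> MM2 b = (MM1(4 := ?B \<union> ?B\<inverse>)) b"
      using st_RTC[OF st1, of 4] unfolding t2_def matrices_def by auto
    have v: "fst t2 8 = i" "fst t2 9 = j" using t by (simp_all add: t2_def t1_def eval_wv)
    have fr2: "framed n t2" using M2 by (simp add: st_def)
    have "0 < aval (cf ?q) t2 \<longleftrightarrow> sem ?q (fst t2) VV MM2 T2"
      by (rule cf_sem[OF M2(1)]) (use v ij in \<open>auto simp: matrices_def\<close>)
    also have "\<dots> \<longleftrightarrow> (i, j) \<in> inner A" using M2 M1(2) v ij by (auto simp: bridges_def)
    finally have q: "0 < aval (cf ?q) t2 \<longleftrightarrow> (i, j) \<in> inner A" .
    define t3 where "t3 = seta 8 (i * n + j) (aval (cf ?q) t2) t2"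
    have "aval (ix 8 9) t2 = i * n + j" using v fr2 ij by (simp add: ix_def framed_def)
    then have e: "eval ?c t = t3" by (simp add: t3_def t2_def t1_def)
    have fr3: "framed n t3" using fr2 by (simp add: t3_def framed_def)
    have st3: "st n t3 VV (\<lambda>b. if b \<in> {8} then mset n t3 b else MM2 b) (tset n t3)"
      by (rule st_other[OF M2(1) fr3]) (auto simp: t3_def matrices_def)
    have "mset n t2 8 = MM2 8" "MM2 8 = MM1 8" using M2 by (auto simp: st_def matrices_def)
    moreover have "mset n t3 8 = (if (i, j) \<in> inner A then insert (i, j) (mset n t2 8) else mset n t2 8 - {(i, j)})"
      using ij q by (auto simp: t3_def mset_def row_index)
    ultimately have "(u, v) \<in> mset n t3 8 \<longleftrightarrow> (u, v) \<in> inner A" if "before n u v i (Suc j)" for u v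
      using that M1(3)[of u v] ij by (auto split: if_splits)
    then show "I i (Suc j) (eval ?c t)"
      unfolding e I_def using st3 M2(3)[of 3] M1(2)
      by (intro exI[of _ "\<lambda>b. if b \<in> {8} then mset n t3 b else MM2 b"]) simp
  next
    fix i j v and t :: state assume "I i j t"
    then show "I i j (setv 8 v t)" "I i j (setv 9 v t)" by (auto simp: I_def)
  qed (use n in \<open>auto simp: I_def\<close>)
  then obtain MM' where M: "st n (eval BRIDGES s) VV MM' (tset n (eval BRIDGES s))" "MM' 3 = A"
     "\<And>u v. u < n \<Longrightarrow> v < n \<Longrightarrow> (u, v) \<in> MM' 8 \<longleftrightarrow> (u, v) \<in> inner A"
    unfolding I_def BRIDGES_def p_def before_simps by blast
  have "MM' 8 \<subseteq> {..<n} \<times> {..<n}" using M(1) by (auto simp: st_def mset_def matrices_def)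
  then have "MM' 8 = inner A" using M(3) An by auto
  then show thesis using that M by blast
qed

section \<open>Computing vertex sets by blocks of formulas\<close>

fun vecs :: "(nat \<times> fm) list \<Rightarrow> com" where
  "vecs [] = Assign 7 (N 0)"
| "vecs ((a, p) # l) = Seq (VEC a p) (vecs l)"

fun vrun :: "nat \<Rightarrow> (nat \<Rightarrow> (nat \<times> nat) set) \<Rightarrow> (nat \<times> nat \<times> nat) set \<Rightarrow> (nat \<times> fm) list \<Rightarrow>
    (nat \<Rightarrow> nat set) \<Rightarrow> nat \<Rightarrow> nat set" where
  "vrun n MM T [] VV = VV"
| "vrun n MM T ((a, p) # l) VV = vrun n MM T l (VV(a := vval n p VV MM T))"

lemma st_vecs:
  "st n s VV MM T \<Longrightarrow> \<forall>(a, p)\<in>set l. vok a p \<Longrightarrow> st n (eval (vecs l) s) (vrun n MM T l VV) MM T"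
proof (induction l arbitrary: s VV)
  case (Cons q l)
  obtain a p where q: "q = (a, p)" by fastforce
  have "st n (eval (VEC a p) s) (VV(a := vval n p VV MM T)) MM T"
    using Cons.prems by (intro st_vval(1)) (auto simp: q)
  then show ?case using Cons by (simp add: q)
qed simp

lemma writes_vecs: "wv (vecs l) \<subseteq> {3, 5, 6, 7}" "wa (vecs l) = fst ` set l" "lv (vecs l) \<subseteq> {1}"
  by (induction l rule: vecs.induct) auto

text \<open>Arrays 10 and 11 hold the free starts and ends, 28 and 29 the vertices with in-arcs and
  with out-arcs, 12 the through vertices. Arrays 30 and 31 are scratch space for subformulas with
  quantifiers of their own; later blocks overwrite them.\<close>

definition vertex_block :: "(nat \<times> fm) list" where
  "vertex_block =
    [(10, Conj (Mat 3 5 3) (Neg (Mat 8 5 3))),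
     (11, Conj (Mat 3 3 5) (Neg (Mat 8 3 5))),
     (28, Mat 8 5 3),
     (29, Mat 8 3 5),
     (30, Conj (Mat 8 5 3) (Conj (Mat 8 6 3) (Neg (Eqv 5 6)))),
     (31, Conj (Mat 8 3 5) (Conj (Mat 8 3 6) (Neg (Eqv 5 6)))),
     (12, Conj (Vec 28 3) (Conj (Vec 29 3) (Conj (Neg (Vec 30 3)) (Neg (Vec 31 3)))))]"

text \<open>The last closure is run for its side effect: it leaves the distances of the cut digraph
  in array 7, to which \<open>Btw\<close> refers from then on.\<close>

definition CLASSES :: com where
  "CLASSES = Seq (MAT 4 (Conj (Vec 12 3) (Conj (Vec 12 4) (Disj (Mat 8 3 4) (Mat 8 4 3))))) (Seq (RTC 4)
     (Seq (MAT 13 (Conj (Vec 12 3) (Mat 5 3 4))) (RTC 8)))"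

text \<open>The order matters, since 30 and 31 are refilled several times. Results: ends of chains
  in 14 and 15, pivots in 16, branching classes in 17, leaders among the pivots in 18 and among all
  in 19, candidates in 20, forced vertices in 21.\<close>

definition candidate_block :: "(nat \<times> fm) list" where
  "candidate_block =
    [(30, Conj (Mat 8 5 3) (Vec 12 5)),
     (31, Conj (Mat 8 3 5) (Vec 12 5)),
     (14, Conj (Vec 12 3) (Neg (Vec 30 3))),
     (15, Conj (Vec 12 3) (Neg (Vec 31 3))),
     (16, Conj (Vec 12 3) (Conj (Vec 12 5) (Disj (Conj (Mat 8 3 5) (Vec 10 5)) (Conj (Mat 8 5 3) (Vec 11 5))))),
     (30, Conj (Mat 8 5 3) (Mat 8 6 5)),
     (31, Conj (Mat 8 3 5) (Mat 8 5 6)),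
     (17, Conj (Mat 13 3 5) (Disj (Conj (Vec 14 5) (Vec 30 5)) (Conj (Vec 15 5) (Vec 31 5)))),
     (30, Conj (Mat 13 3 5) (Conj (Vec 16 5) (Lt 5 3))),
     (18, Conj (Vec 12 3) (Conj (Vec 16 3) (Neg (Vec 30 3)))),
     (31, Conj (Mat 13 3 5) (Lt 5 3)),
     (19, Conj (Vec 12 3) (Neg (Vec 31 3))),
     (20, Disj (Conj (Neg (Vec 12 3)) (Conj (Vec 28 3) (Vec 29 3)))
            (Conj (Vec 17 3) (Disj (Vec 14 3) (Disj (Vec 15 3) (Vec 18 3))))),
     (21, Disj (Conj (Neg (Vec 28 3)) (Neg (Vec 10 3))) (Conj (Neg (Vec 29 3)) (Neg (Vec 11 3))))]"

text \<open>It is used for the forced vertices in array 21 and again for each trial set in array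
  29.\<close>

definition cover_block :: "nat \<Rightarrow> (nat \<times> fm) list" where
  "cover_block a =
    [(22, Disj (Vec a 3) (Vec 10 3)),
     (23, Disj (Vec a 3) (Vec 11 3)),
     (24, Conj (Vec 22 5) (Conj (Vec 23 6) (Btw 5 3 6)))]"

text \<open>Each existential subformula of \<open>picks\<close> gets an array of its own. Array 28
  is finally reused for the vertices that belong to every trial set.\<close>

definition pick_block :: "(nat \<times> fm) list" where
  "pick_block =
    [(30, Conj (Mat 13 3 5) (Neg (Vec 24 5))),
     (31, Conj (Mat 13 3 5) (Vec 14 5)),
     (27, Conj (Mat 13 3 5) (Vec 16 5)),
     (26, Conj (Vec 19 5) (Mat 8 5 3)),
     (25, Conj (Vec 12 3) (Conj (Neg (Vec 17 3)) (Conj (Vec 30 3)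
            (Disj (Vec 14 3) (Conj (Neg (Vec 31 3)) (Disj (Vec 18 3) (Conj (Neg (Vec 27 3))
              (Disj (Vec 19 3) (Vec 26 3))))))))),
     (28, Disj (Vec 21 3) (Vec 25 3))]"

definition LABELS :: com where
  "LABELS = Seq (vecs vertex_block) (Seq CLASSES (vecs (candidate_block @ cover_block 21 @ pick_block)))"

lemma writes_LABELS: "wv LABELS \<subseteq> {3, 4, 5, 6, 7, 10}" "wa LABELS \<subseteq> - {0, 1, 2}" "lv LABELS \<subseteq> {1}"
  using writes_vecs(1,3)[of vertex_block] writes_vecs(1,3)[of "candidate_block @ cover_block 21 @ pick_block"]
  by (auto simp: LABELS_def CLASSES_def writes_vecs vertex_block_def candidate_block_def cover_block_def pick_block_def)

section \<open>The blocks compute the sets of the normal form\<close>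

context
  fixes n :: nat and A BB :: "(nat \<times> nat) set" and PP QQ :: "nat set"
  assumes A: "A \<subseteq> {..<n} \<times> {..<n}" and BB: "BB = inner A"
    and PP: "PP = snd ` bridges A" and QQ: "QQ = fst ` bridges A"
begin

abbreviation "TT \<equiv> {(u, v, w). u < n \<and> v < n \<and> w < n \<and> btw BB u v w}"

lemma B_bound: "(x, y) \<in> BB \<Longrightarrow> x < n" "(x, y) \<in> BB \<Longrightarrow> y < n"
  using A BB by auto

lemma A_bound: "(x, y) \<in> A \<Longrightarrow> x < n" "(x, y) \<in> A \<Longrightarrow> y < n"
  using A by auto

lemma thr_bound: "x \<in> thr BB \<Longrightarrow> x < n"
  unfolding thr_def using B_bound by blast

lemma clsrel_bound: "(x, y) \<in> clsrel BB \<Longrightarrow> x < n" "(x, y) \<in> clsrel BB \<Longrightarrow> y < n"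
  using clsrel_thr[of x y BB] thr_bound by blast+

lemma PQ_bound: "x \<in> PP \<Longrightarrow> x < n" "x \<in> QQ \<Longrightarrow> x < n"
  using A by (auto simp: PP QQ bridges_def)

lemmas bounds = A_bound B_bound thr_bound clsrel_bound PQ_bound

lemma PP_eq: "x \<in> PP \<longleftrightarrow> (\<exists>y. (y, x) \<in> A \<and> (y, x) \<notin> BB)"
  by (force simp: bridges_def BB PP QQ)

lemma QQ_eq: "x \<in> QQ \<longleftrightarrow> (\<exists>y. (x, y) \<in> A \<and> (x, y) \<notin> BB)"
  by (force simp: bridges_def BB PP QQ)

definition indom :: "nat set" where "indom = {v. \<exists>u. (u, v) \<in> BB}"
definition outdom :: "nat set" where "outdom = {v. \<exists>u. (v, u) \<in> BB}"
definition twoin :: "nat set" where "twoin = {v. \<exists>u w. (u, v) \<in> BB \<and> (w, v) \<in> BB \<and> u \<noteq> w}"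
definition twoout :: "nat set" where "twoout = {v. \<exists>u w. (v, u) \<in> BB \<and> (v, w) \<in> BB \<and> u \<noteq> w}"

lemma thr_eq: "thr BB = indom \<inter> outdom - twoin - twoout"
  unfolding thr_def indom_def outdom_def twoin_def twoout_def by blast

lemma vertex_block:
  fixes VV :: "nat \<Rightarrow> nat set" and T :: "(nat \<times> nat \<times> nat) set"
  assumes M: "MM 3 = A" "MM 8 = BB"
  defines "W \<equiv> vrun n MM T vertex_block VV"
  shows "W 10 = PP" "W 11 = QQ" "W 28 = indom" "W 29 = outdom" "W 12 = thr BB"
proof -
  have 1: "vval n (Conj (Mat 3 5 3) (Neg (Mat 8 5 3))) X MM T = PP" for X
  proof -
    have "vval n (Conj (Mat 3 5 3) (Neg (Mat 8 5 3))) X MM T = {v. v < n \<and> (\<exists>x<n. (x, v) \<in> A \<and> (x, v) \<notin> BB)}"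
      by (auto simp: vval_def M cong: conj_cong)
    moreover have "x \<in> PP \<longleftrightarrow> x < n \<and> (\<exists>y<n. (y, x) \<in> A \<and> (y, x) \<notin> BB)" for x
      unfolding PP_eq using A_bound by blast
    ultimately show ?thesis by blast
  qed
  have 2: "vval n (Conj (Mat 3 3 5) (Neg (Mat 8 3 5))) X MM T = QQ" for X
  proof -
    have "vval n (Conj (Mat 3 3 5) (Neg (Mat 8 3 5))) X MM T = {v. v < n \<and> (\<exists>x<n. (v, x) \<in> A \<and> (v, x) \<notin> BB)}"
      by (auto simp: vval_def M cong: conj_cong)
    moreover have "x \<in> QQ \<longleftrightarrow> x < n \<and> (\<exists>y<n. (x, y) \<in> A \<and> (x, y) \<notin> BB)" for x
      unfolding QQ_eq using A_bound by blast
    ultimately show ?thesis by blast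
  qed
  have 3: "vval n (Mat 8 5 3) X MM T = indom" for X
    by (auto simp: vval_def M indom_def intro: bounds cong: conj_cong)
  have 4: "vval n (Mat 8 3 5) X MM T = outdom" for X
    by (auto simp: vval_def M outdom_def intro: bounds cong: conj_cong)
  have 5: "vval n (Conj (Mat 8 5 3) (Conj (Mat 8 6 3) (Neg (Eqv 5 6)))) X MM T = twoin" for X
    unfolding vval_def twoin_def M sem.simps by (auto intro: bounds cong: conj_cong)
  have 6: "vval n (Conj (Mat 8 3 5) (Conj (Mat 8 3 6) (Neg (Eqv 5 6)))) X MM T = twoout" for X
    unfolding vval_def twoout_def M sem.simps by (auto intro: bounds cong: conj_cong)
  have 7: "vval n (Conj (Vec 28 3) (Conj (Vec 29 3) (Conj (Neg (Vec 30 3)) (Neg (Vec 31 3))))) X MM T = thr BB"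
    if "X 28 = indom" "X 29 = outdom" "X 30 = twoin" "X 31 = twoout" for X
    by (auto simp: vval_def that thr_eq intro: bounds cong: conj_cong)
  show "W 10 = PP" "W 11 = QQ" "W 28 = indom" "W 29 = outdom" "W 12 = thr BB"
    unfolding W_def vertex_block_def by (simp_all add: 1 2 3 4 5 6 7 del: sem.simps)
qed

lemma CLASSES_correct:
  assumes st: "st n s VV MM T" and V: "VV 12 = thr BB" and M: "MM 3 = A" "MM 8 = BB"
  obtains MM' where "st n (eval CLASSES s) VV MM' TT" "MM' 3 = A" "MM' 8 = BB" "MM' 13 = clsrel BB"
proof -
  let ?p = "Conj (Vec 12 3) (Conj (Vec 12 4) (Disj (Mat 8 3 4) (Mat 8 4 3)))"
  let ?q = "Conj (Vec 12 3) (Mat 5 3 4)"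
  let ?R = "chn BB \<union> (chn BB)\<inverse>"
  define s1 where "s1 = eval (MAT 4 ?p) s"
  define s2 where "s2 = eval (RTC 4) s1"
  define s3 where "s3 = eval (MAT 13 ?q) s2"
  have "st n s1 VV (MM(4 := {(u, v). u < n \<and> v < n \<and> (\<exists>x<n. \<exists>y<n. sem ?p
      ((fst s)(3 := u, 4 := v, 5 := x, 6 := y)) VV MM T)})) T"
    unfolding s1_def by (rule st_MAT[OF st]) (auto simp: matrices_def)
  moreover have "{(u, v). u < n \<and> v < n \<and> (\<exists>x<n. \<exists>y<n. sem ?p
      ((fst s)(3 := u, 4 := v, 5 := x, 6 := y)) VV MM T)} = ?R"
    by (auto simp: V M chn_def intro: bounds cong: conj_cong)
  ultimately have st1: "st n s1 VV (MM(4 := ?R)) T" by simp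
  obtain M2 T2 where M2: "st n s2 VV M2 T2" "M2 5 = {(u, v). u < n \<and> v < n \<and> (u, v) \<in> ?R\<^sup>*}"
    "\<And>b. b \<notin> {5, 6, 7} \<Longrightarrow> M2 b = (MM(4 := ?R)) b"
    using st_RTC[OF st1, of 4] unfolding s2_def matrices_def by auto
  have "st n s3 VV (M2(13 := {(u, v). u < n \<and> v < n \<and> (\<exists>x<n. \<exists>y<n. sem ?q
      ((fst s2)(3 := u, 4 := v, 5 := x, 6 := y)) VV M2 T2)})) T2"
    unfolding s3_def by (rule st_MAT[OF M2(1)]) (auto simp: matrices_def)
  moreover have "{(u, v). u < n \<and> v < n \<and> (\<exists>x<n. \<exists>y<n. sem ?q
      ((fst s2)(3 := u, 4 := v, 5 := x, 6 := y)) VV M2 T2)} = clsrel BB"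
    by (auto simp: V M2(2) clsrel_def intro: bounds cong: conj_cong)
  ultimately have st3: "st n s3 VV (M2(13 := clsrel BB)) T2" by simp
  have M8: "(M2(13 := clsrel BB)) 8 = BB" using M2(3)[of 8] M by simp
  have "8 \<in> matrices - {1, 5, 6, 7}" by (simp add: matrices_def)
  from st_RTC[OF st3 this] obtain M4 where M4: "st n (eval (RTC 8) s3) VV M4 TT"
    "\<And>b. b \<notin> {5, 6, 7} \<Longrightarrow> M4 b = (M2(13 := clsrel BB)) b"
    unfolding M8 by blast
  moreover have "eval (RTC 8) s3 = eval CLASSES s" by (simp add: CLASSES_def s3_def s2_def s1_def)
  moreover have "M4 3 = A" "M4 8 = BB" "M4 13 = clsrel BB" using M4(2) M2(3) M by simp_all
  ultimately show thesis using that by simp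
qed

lemma branching_bound: "x \<in> branching BB \<Longrightarrow> x < n"
  by (auto simp: branching_def intro: bounds)

lemma candidate_block:
  fixes VV :: "nat \<Rightarrow> nat set" and T :: "(nat \<times> nat \<times> nat) set"
  assumes M: "MM 3 = A" "MM 8 = BB" "MM 13 = clsrel BB"
    and V: "VV 10 = PP" "VV 11 = QQ" "VV 28 = indom" "VV 29 = outdom" "VV 12 = thr BB"
  defines "W \<equiv> vrun n MM T candidate_block VV"
  shows "W 10 = PP" "W 11 = QQ" "W 12 = thr BB" "W 14 = firsts BB" "W 16 = pivot BB PP QQ"
    "W 17 = branching BB" "W 18 = leaders BB (pivot BB PP QQ)" "W 19 = leaders BB UNIV"
    "W 20 = candidates BB PP QQ" "W 21 = forced {..<n} BB PP QQ"
proof -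
  define D1 D2 D3 D4 L1 L2 where "D1 = {v. \<exists>x. (x, v) \<in> BB \<and> x \<in> thr BB}"
    and "D2 = {v. \<exists>x. (v, x) \<in> BB \<and> x \<in> thr BB}"
    and "D3 = {v. \<exists>x y. (x, v) \<in> BB \<and> (y, x) \<in> BB}"
    and "D4 = {v. \<exists>x y. (v, x) \<in> BB \<and> (x, y) \<in> BB}"
    and "L1 = {v. \<exists>x. (v, x) \<in> clsrel BB \<and> x \<in> pivot BB PP QQ \<and> x < v}"
    and "L2 = {v. \<exists>x. (v, x) \<in> clsrel BB \<and> x < v}"
  have 1: "vval n (Conj (Mat 8 5 3) (Vec 12 5)) X MM T = D1" if "X 12 = thr BB" for X
    unfolding vval_def D1_def M sem.simps that by (auto intro: bounds cong: conj_cong)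
  have 2: "vval n (Conj (Mat 8 3 5) (Vec 12 5)) X MM T = D2" if "X 12 = thr BB" for X
    unfolding vval_def D2_def M sem.simps that by (auto intro: bounds cong: conj_cong)
  have 3: "vval n (Conj (Vec 12 3) (Neg (Vec 30 3))) X MM T = firsts BB" if "X 12 = thr BB" "X 30 = D1" for X
    by (auto simp: vval_def that firsts_def chn_def D1_def intro: bounds cong: conj_cong)
  have 4: "vval n (Conj (Vec 12 3) (Neg (Vec 31 3))) X MM T = lasts BB" if "X 12 = thr BB" "X 31 = D2" for X
    by (auto simp: vval_def that lasts_def chn_def D2_def intro: bounds cong: conj_cong)
  have 5: "vval n (Conj (Vec 12 3) (Conj (Vec 12 5) (Disj (Conj (Mat 8 3 5) (Vec 10 5)) (Conj (Mat 8 5 3) (Vec 11 5)))))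
      X MM T = pivot BB PP QQ" if "X 12 = thr BB" "X 10 = PP" "X 11 = QQ" for X
    unfolding vval_def pivot_def chn_def M sem.simps that by (auto intro: bounds cong: conj_cong)
  have 6: "vval n (Conj (Mat 8 5 3) (Mat 8 6 5)) X MM T = D3" for X
    unfolding vval_def D3_def M sem.simps by (auto intro: bounds cong: conj_cong)
  have 7: "vval n (Conj (Mat 8 3 5) (Mat 8 5 6)) X MM T = D4" for X
    unfolding vval_def D4_def M sem.simps by (auto intro: bounds cong: conj_cong)
  have 8: "vval n (Conj (Mat 13 3 5) (Disj (Conj (Vec 14 5) (Vec 30 5)) (Conj (Vec 15 5) (Vec 31 5)))) X MM T = branching BB"
    if "X 14 = firsts BB" "X 15 = lasts BB" "X 30 = D3" "X 31 = D4" for X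
    unfolding vval_def branching_def M sem.simps that D3_def D4_def by (auto intro: bounds cong: conj_cong)
  have 9: "vval n (Conj (Mat 13 3 5) (Conj (Vec 16 5) (Lt 5 3))) X MM T = L1" if "X 16 = pivot BB PP QQ" for X
    unfolding vval_def L1_def M sem.simps that by (auto intro: bounds cong: conj_cong)
  have 10: "vval n (Conj (Vec 12 3) (Conj (Vec 16 3) (Neg (Vec 30 3)))) X MM T = leaders BB (pivot BB PP QQ)"
    if "X 12 = thr BB" "X 16 = pivot BB PP QQ" "X 30 = L1" for X
    unfolding vval_def leaders_def sem.simps that L1_def by (auto simp: not_less intro: bounds cong: conj_cong)
  have 11: "vval n (Conj (Mat 13 3 5) (Lt 5 3)) X MM T = L2" for X
    unfolding vval_def L2_def M sem.simps by (auto intro: bounds cong: conj_cong)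
  have 12: "vval n (Conj (Vec 12 3) (Neg (Vec 31 3))) X MM T = leaders BB UNIV"
    if "X 12 = thr BB" "X 31 = L2" for X
    unfolding vval_def leaders_def sem.simps that L2_def by (auto simp: not_less intro: bounds cong: conj_cong)
  have 13: "vval n (Disj (Conj (Neg (Vec 12 3)) (Conj (Vec 28 3) (Vec 29 3)))
      (Conj (Vec 17 3) (Disj (Vec 14 3) (Disj (Vec 15 3) (Vec 18 3))))) X MM T = candidates BB PP QQ"
    if "X 12 = thr BB" "X 28 = indom" "X 29 = outdom" "X 17 = branching BB" "X 14 = firsts BB"
      "X 15 = lasts BB" "X 18 = leaders BB (pivot BB PP QQ)" for X
    unfolding vval_def candidates_def sem.simps that indom_def outdom_def
    by (auto intro: branching_bound intro: bounds cong: conj_cong)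
  have 14: "vval n (Disj (Conj (Neg (Vec 28 3)) (Neg (Vec 10 3))) (Conj (Neg (Vec 29 3)) (Neg (Vec 11 3)))) X MM T =
      forced {..<n} BB PP QQ" if "X 28 = indom" "X 29 = outdom" "X 10 = PP" "X 11 = QQ" for X
    unfolding vval_def forced_def sem.simps that indom_def outdom_def by (auto intro: bounds cong: conj_cong)
  show "W 10 = PP" "W 11 = QQ" "W 12 = thr BB" "W 14 = firsts BB" "W 16 = pivot BB PP QQ"
    "W 17 = branching BB" "W 18 = leaders BB (pivot BB PP QQ)" "W 19 = leaders BB UNIV"
    "W 20 = candidates BB PP QQ" "W 21 = forced {..<n} BB PP QQ"
    unfolding W_def candidate_block_def
    by (simp_all add: V 1 2 3 4 5 6 7 8 9 10 11 12 13 14 del: sem.simps)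
qed

lemma cover_block:
  assumes V: "VV 10 = PP" "VV 11 = QQ" "VV a = S" and S: "S \<subseteq> {..<n}" and a: "a \<notin> {22, 23}"
  shows "vrun n MM TT (cover_block a) VV =
    VV(22 := S \<union> PP, 23 := S \<union> QQ, 24 := cov BB PP QQ S \<inter> {..<n})"
proof -
  have 1: "vval n (Disj (Vec a 3) (Vec 10 3)) X MM T = S \<union> PP" if "X a = S" "X 10 = PP" for X T
    unfolding vval_def sem.simps that using S by (auto intro: bounds cong: conj_cong)
  have 2: "vval n (Disj (Vec a 3) (Vec 11 3)) X MM T = S \<union> QQ" if "X a = S" "X 11 = QQ" for X T
    unfolding vval_def sem.simps that using S by (auto intro: bounds cong: conj_cong)
  have 3: "vval n (Conj (Vec 22 5) (Conj (Vec 23 6) (Btw 5 3 6))) X MM T = cov BB PP QQ S \<inter> {..<n}"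
    if "X 22 = S \<union> PP" "X 23 = S \<union> QQ" "T = TT" for X T
  proof -
    have "x < n" if "x \<in> S \<union> PP \<or> x \<in> S \<union> QQ" for x using that S PQ_bound by blast
    then show ?thesis unfolding vval_def sem.simps that cov_def by (auto cong: conj_cong)
  qed
  show ?thesis unfolding cover_block_def using a by (simp add: V 1 2 3 del: sem.simps)
qed

lemma pick_block:
  fixes VV :: "nat \<Rightarrow> nat set" and T :: "(nat \<times> nat \<times> nat) set"
  assumes M: "MM 3 = A" "MM 8 = BB" "MM 13 = clsrel BB"
    and V: "VV 12 = thr BB" "VV 14 = firsts BB" "VV 16 = pivot BB PP QQ" "VV 17 = branching BB"
      "VV 18 = leaders BB (pivot BB PP QQ)" "VV 19 = leaders BB UNIV" "VV 21 = forced {..<n} BB PP QQ"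
      "VV 24 = cov BB PP QQ (forced {..<n} BB PP QQ) \<inter> {..<n}"
  defines "W \<equiv> vrun n MM T pick_block VV"
  shows "W 28 = forced {..<n} BB PP QQ \<union> picks {..<n} BB PP QQ" "W 10 = VV 10" "W 11 = VV 11" "W 20 = VV 20"
proof -
  define D1 D2 D3 D4 where "D1 = {v. \<exists>x. (v, x) \<in> clsrel BB \<and> x \<notin> cov BB PP QQ (forced {..<n} BB PP QQ)}"
    and "D2 = {v. \<exists>x. (v, x) \<in> clsrel BB \<and> x \<in> firsts BB}"
    and "D3 = {v. \<exists>x. (v, x) \<in> clsrel BB \<and> x \<in> pivot BB PP QQ}"
    and "D4 = {v. \<exists>x. x \<in> leaders BB UNIV \<and> (x, v) \<in> BB}"
  have 1: "vval n (Conj (Mat 13 3 5) (Neg (Vec 24 5))) X MM T = D1"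
    if "X 24 = cov BB PP QQ (forced {..<n} BB PP QQ) \<inter> {..<n}" for X
    unfolding vval_def D1_def M sem.simps that by (auto intro: bounds cong: conj_cong)
  have 2: "vval n (Conj (Mat 13 3 5) (Vec 14 5)) X MM T = D2" if "X 14 = firsts BB" for X
    unfolding vval_def D2_def M sem.simps that by (auto intro: bounds cong: conj_cong)
  have 3: "vval n (Conj (Mat 13 3 5) (Vec 16 5)) X MM T = D3" if "X 16 = pivot BB PP QQ" for X
    unfolding vval_def D3_def M sem.simps that by (auto intro: bounds cong: conj_cong)
  have 4: "vval n (Conj (Vec 19 5) (Mat 8 5 3)) X MM T = D4" if "X 19 = leaders BB UNIV" for X
    unfolding vval_def D4_def M sem.simps that by (auto intro: bounds cong: conj_cong)
  have 5: "vval n (Conj (Vec 12 3) (Conj (Neg (Vec 17 3)) (Conj (Vec 30 3)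
            (Disj (Vec 14 3) (Conj (Neg (Vec 31 3)) (Disj (Vec 18 3) (Conj (Neg (Vec 27 3))
              (Disj (Vec 19 3) (Vec 26 3))))))))) X MM T = picks {..<n} BB PP QQ"
    if "X 12 = thr BB" "X 17 = branching BB" "X 30 = D1" "X 14 = firsts BB" "X 31 = D2"
      "X 18 = leaders BB (pivot BB PP QQ)" "X 27 = D3" "X 19 = leaders BB UNIV" "X 26 = D4" for X
  proof -
    have "picks {..<n} BB PP QQ = {v. v \<in> thr BB \<and> v \<notin> branching BB \<and> v \<in> D1 \<and>
       (v \<in> firsts BB \<or> v \<notin> D2 \<and> (v \<in> leaders BB (pivot BB PP QQ) \<or> v \<notin> D3 \<and> (v \<in> leaders BB UNIV \<or> v \<in> D4)))}"
      unfolding picks_def D1_def D2_def D3_def D4_def by blast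
    then show ?thesis unfolding vval_def sem.simps that by (auto intro: bounds cong: conj_cong)
  qed
  have "forced {..<n} BB PP QQ \<subseteq> {..<n}" "picks {..<n} BB PP QQ \<subseteq> {..<n}"
    by (auto simp: forced_def picks_def intro: bounds cong: conj_cong)
  then have 6: "vval n (Disj (Vec 21 3) (Vec 25 3)) X MM T = forced {..<n} BB PP QQ \<union> picks {..<n} BB PP QQ"
    if "X 21 = forced {..<n} BB PP QQ" "X 25 = picks {..<n} BB PP QQ" for X
    unfolding vval_def sem.simps that by auto
  show "W 28 = forced {..<n} BB PP QQ \<union> picks {..<n} BB PP QQ" "W 10 = VV 10" "W 11 = VV 11" "W 20 = VV 20"
    unfolding W_def pick_block_def by (simp_all add: V 1 2 3 4 5 6 del: sem.simps)
qed

lemma vrun_append: "vrun n MM T (l @ l') VV = vrun n MM T l' (vrun n MM T l VV)"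
  by (induction l arbitrary: VV rule: vecs.induct) auto

theorem LABELS_correct:
  assumes st: "st n s VV MM T" and M: "MM 3 = A" "MM 8 = BB"
  obtains W MM' where "st n (eval LABELS s) W MM' TT" "W 10 = PP" "W 11 = QQ"
    "W 20 = candidates BB PP QQ" "W 28 = forced {..<n} BB PP QQ \<union> picks {..<n} BB PP QQ"
proof -
  define s1 where "s1 = eval (vecs vertex_block) s"
  define W1 where "W1 = vrun n MM T vertex_block VV"
  have st1: "st n s1 W1 MM T"
    unfolding s1_def W1_def by (rule st_vecs[OF st]) (auto simp: vertex_block_def vok_def matrices_def)
  note W1 = vertex_block[OF M, of T VV, folded W1_def]
  obtain MM' where M': "st n (eval CLASSES s1) W1 MM' TT" "MM' 3 = A" "MM' 8 = BB" "MM' 13 = clsrel BB"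
    using CLASSES_correct[OF st1 W1(5) M] .
  define W2 where "W2 = vrun n MM' TT candidate_block W1"
  note W2 = candidate_block[OF M'(2-4) W1, of TT, folded W2_def]
  define W3 where "W3 = vrun n MM' TT (cover_block 21) W2"
  have F: "forced {..<n} BB PP QQ \<subseteq> {..<n}" by (auto simp: forced_def)
  have W3: "W3 = W2(22 := forced {..<n} BB PP QQ \<union> PP, 23 := forced {..<n} BB PP QQ \<union> QQ,
      24 := cov BB PP QQ (forced {..<n} BB PP QQ) \<inter> {..<n})"
    unfolding W3_def by (rule cover_block) (use W2 F in auto)
  define W4 where "W4 = vrun n MM' TT pick_block W3"
  have W4: "W4 28 = forced {..<n} BB PP QQ \<union> picks {..<n} BB PP QQ" "W4 10 = W3 10" "W4 11 = W3 11" "W4 20 = W3 20"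
    unfolding W4_def by (rule pick_block[OF M'(2-4)]; simp add: W3 W2)+
  have "st n (eval (vecs (candidate_block @ cover_block 21 @ pick_block)) (eval CLASSES s1))
      (vrun n MM' TT (candidate_block @ cover_block 21 @ pick_block) W1) MM' TT"
    by (rule st_vecs[OF M'(1)])
      (auto simp: candidate_block_def cover_block_def pick_block_def vok_def matrices_def)
  moreover have "vrun n MM' TT (candidate_block @ cover_block 21 @ pick_block) W1 = W4"
    by (simp add: vrun_append W2_def W3_def W4_def)
  moreover have "eval (vecs (candidate_block @ cover_block 21 @ pick_block)) (eval CLASSES s1) = eval LABELS s"
    by (simp add: LABELS_def s1_def)
  ultimately have "st n (eval LABELS s) W4 MM' TT" by simp
  then show thesis using that W4 W3 W2 by simp
qed

end

section \<open>Enumeration of all sets of candidates\<close>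

definition WEIGHTS :: com where
  "WEIGHTS = Seq (Assign 15 (N 1)) (For 3 1 (Seq (Put 26 (V 3) (V 15))
     (If (Arr 20 (V 3)) (Assign 15 (Plus (V 15) (V 15))) (Assign 15 (V 15)))))"

text \<open>Round i of the enumeration selects the set of candidates whose binary code is i.\<close>

definition SELECT :: com where
  "SELECT = Seq (Assign 17 (V 16)) (For 3 1 (Seq (Assign 4 (Minus (Minus (V 1) (N 1)) (V 3)))
     (If (AndE (Arr 20 (V 4)) (LessE (Arr 26 (V 4)) (Plus (V 17) (N 1))))
       (Seq (Assign 17 (Minus (V 17) (Arr 26 (V 4)))) (Put 27 (V 4) (N 1)))
       (Put 27 (V 4) (N 0)))))"

definition SIZE :: com where
  "SIZE = Seq (Assign 19 (N 0)) (For 3 1 (Assign 19 (Plus (V 19) (Arr 29 (V 3)))))"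

definition TEST :: com where
  "TEST = Seq (VEC 29 (Disj (Vec 28 3) (Vec 27 3))) (Seq (vecs (cover_block 29))
     (Seq (Exists (Neg (Vec 24 5))) (Seq (Assign 18 (V 7)) (Seq SIZE
       (If (AndE (NotE (V 18)) (LessE (V 19) (Plus (V 2) (N 1)))) (Assign 20 (N 1)) (Assign 20 (V 20)))))))"

definition PREPARE :: com where
  "PREPARE = Seq ARCS (Seq BRIDGES (Seq LABELS (Seq WEIGHTS (Assign 20 (N 0)))))"

definition SOLVE :: com where
  "SOLVE = Seq INIT (Seq PREPARE (Seq (For 16 15 (Seq SELECT TEST))
     (Assign 0 (AndE (V 20) (LessE (V 2) (Plus (V 1) (N 1)))))))"

lemma writes_WEIGHTS [simp]: "wv WEIGHTS = {3, 15}" "wa WEIGHTS = {26}" "lv WEIGHTS = {1}"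
  by (auto simp: WEIGHTS_def)

lemma writes_SELECT [simp]: "wv SELECT = {3, 4, 17}" "wa SELECT = {27}" "lv SELECT = {1}"
  by (auto simp: SELECT_def)

lemma writes_SIZE [simp]: "wv SIZE = {3, 19}" "wa SIZE = {}" "lv SIZE = {1}"
  by (auto simp: SIZE_def)

lemma writes_TEST: "wv TEST \<subseteq> {3, 5, 6, 7, 18, 19, 20}" "wa TEST = {22, 23, 24, 29}" "lv TEST \<subseteq> {1}"
  using writes_vecs(1,3)[of "cover_block 29"] by (auto simp: TEST_def writes_vecs cover_block_def)

lemma st_vector:
  assumes "st n s VV MM T" "D \<inter> matrices = {}" "fst s' 1 = fst s 1" "\<And>b. b \<notin> D \<Longrightarrow> snd s' b = snd s b"
  shows "st n s' (\<lambda>b. if b \<in> D then vset n s' b else VV b) MM T"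
proof -
  have "b \<notin> D" if "b \<in> matrices" for b using assms(2) that by blast
  then have *: "snd s' b = snd s b" if "b \<in> matrices" for b using assms(4) that by blast
  have "mset n s' b = mset n s b" if "b \<in> matrices" for b using *[OF that] by (simp add: mset_def)
  moreover have "tset n s' = tset n s" using *[of 7] by (simp add: tset_def matrices_def)
  moreover have "framed n s'" using assms(1,3) *[of 1] by (simp add: st_def framed_def matrices_def)
  moreover have "vset n s' b = vset n s b" if "b \<notin> D" for b using assms(4)[OF that] by (simp add: vset_def)
  ultimately show ?thesis using assms(1) by (auto simp: st_def)
qed

text \<open>The place value of a candidate is determined by its rank among the candidates; the codes
  of sets of candidates thus stay below \<open>2 ^ card C\<close>, however sparse the candidates
  are.\<close>

definition weight :: "nat set \<Rightarrow> nat \<Rightarrow> nat" where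
  "weight C v = 2 ^ card (C \<inter> {..<v})"

definition code :: "nat set \<Rightarrow> nat set \<Rightarrow> nat" where
  "code C T = (\<Sum>u\<in>T. weight C u)"

lemma lessThan_Int_Suc: "C \<inter> {..<Suc v} = (if v \<in> C then insert v (C \<inter> {..<v}) else C \<inter> {..<v})"
  by (auto simp: lessThan_Suc)

lemma weight_Suc: "weight C (Suc v) = (if v \<in> C then 2 * weight C v else weight C v)"
  by (simp add: weight_def lessThan_Int_Suc)

lemma code_Int_Suc: "code C (T \<inter> {..<Suc v}) = (if v \<in> T then weight C v + code C (T \<inter> {..<v}) else code C (T \<inter> {..<v}))"
  by (simp add: code_def lessThan_Int_Suc)

text \<open>The place value of \<open>v\<close> exceeds everything below it; so comparing the
  remaining code with \<open>weight C v\<close> tells whether \<open>v\<close> belongs to the set,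
  and decoding may proceed greedily from the top.\<close>

lemma code_less: "T \<subseteq> C \<Longrightarrow> code C (T \<inter> {..<v}) < weight C v"
proof (induction v)
  case 0
  then show ?case by (simp add: code_def weight_def)
next
  case (Suc v)
  then show ?case by (auto simp: code_Int_Suc weight_Suc)
qed

lemma WEIGHTS_correct:
  assumes n: "fst s 1 = n" and C: "vset n s 20 = C" "C \<subseteq> {..<n}"
  shows "fst (eval WEIGHTS s) 15 = 2 ^ card C" "v < n \<Longrightarrow> snd (eval WEIGHTS s) 26 v = weight C v"
proof -
  let ?c = "Seq (Put 26 (V 3) (V 15)) (If (Arr 20 (V 3)) (Assign 15 (Plus (V 15) (V 15))) (Assign 15 (V 15)))"
  let ?I = "\<lambda>i t. fst t 15 = weight C i \<and> (\<forall>v<i. snd t 26 v = weight C v) \<and> snd t 20 = snd s 20"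
  have C': "0 < snd s 20 v \<longleftrightarrow> v \<in> C" if "v < n" for v using C(1) that by (auto simp: vset_def)
  have "?I (fst (setv 15 1 s) 1) (eval (For 3 1 ?c) (setv 15 1 s))"
  proof (rule For_invariant[where I = ?I])
    show "?I 0 (setv 3 0 (setv 15 1 s))" by (simp add: weight_def)
    fix i and t :: state assume "i < fst (setv 15 1 s) 1" "?I i t" "fst t 3 = i"
    then show "?I (Suc i) (setv 3 (Suc i) (eval ?c t))"
      using C'[of i] n by (auto simp: weight_Suc less_Suc_eq)
  qed simp
  then have I: "?I n (eval WEIGHTS s)" using n by (simp add: WEIGHTS_def del: eval.simps(5))
  have "C \<inter> {..<n} = C" using C by blast
  then show "fst (eval WEIGHTS s) 15 = 2 ^ card C" using I by (simp add: weight_def)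
  show "v < n \<Longrightarrow> snd (eval WEIGHTS s) 26 v = weight C v" using I by blast
qed

text \<open>Two halves suffice: every round yields some set of candidates, and the round numbered
  \<open>code C T\<close> yields \<open>T\<close>. That each number is the code of some set need not
  be shown.\<close>

lemma SELECT_correct:
  assumes n: "fst s 1 = n" and C: "vset n s 20 = C" "C \<subseteq> {..<n}"
    and w: "\<And>v. v < n \<Longrightarrow> snd s 26 v = weight C v"
  shows "vset n (eval SELECT s) 27 \<subseteq> C"
    and "T \<subseteq> C \<Longrightarrow> fst s 16 = code C T \<Longrightarrow> vset n (eval SELECT s) 27 = T"
proof -
  let ?c = "Seq (Assign 4 (Minus (Minus (V 1) (N 1)) (V 3)))
     (If (AndE (Arr 20 (V 4)) (LessE (Arr 26 (V 4)) (Plus (V 17) (N 1))))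
       (Seq (Assign 17 (Minus (V 17) (Arr 26 (V 4)))) (Put 27 (V 4) (N 1)))
       (Put 27 (V 4) (N 0)))"
  have C': "0 < snd s 20 v \<longleftrightarrow> v \<in> C" if "v < n" for v using C(1) that by (auto simp: vset_def)
  let ?s = "setv 17 (fst s 16) s"
  let ?I = "\<lambda>i t. (\<forall>v<n. n - i \<le> v \<longrightarrow> 0 < snd t 27 v \<longrightarrow> v \<in> C) \<and> snd t 20 = snd s 20 \<and> snd t 26 = snd s 26 \<and> fst t 1 = n"
  let ?J = "\<lambda>T i t. fst t 17 = code C (T \<inter> {..<n - i}) \<and> (\<forall>v<n. n - i \<le> v \<longrightarrow> (0 < snd t 27 v \<longleftrightarrow> v \<in> T)) \<and>
     snd t 20 = snd s 20 \<and> snd t 26 = snd s 26 \<and> fst t 1 = n"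
  have rest: "n - Suc i \<le> v \<longleftrightarrow> v = n - 1 - i \<or> n - i \<le> v" if "i < n" for i v using that by auto
  have "?I (fst ?s 1) (eval (For 3 1 ?c) ?s)"
  proof (rule For_invariant[where I = ?I])
    fix i and t :: state assume "i < fst ?s 1" "?I i t" "fst t 3 = i"
    then show "?I (Suc i) (setv 3 (Suc i) (eval ?c t))"
      using C'[of "n - 1 - i"] n by (auto simp: rest)
  qed (use n in auto)
  then have "?I n (eval SELECT s)" using n by (simp add: SELECT_def del: eval.simps(5))
  then show "vset n (eval SELECT s) 27 \<subseteq> C" by (auto simp: vset_def)
  assume T: "T \<subseteq> C" "fst s 16 = code C T"
  have Tn: "T \<inter> {..<n} = T" using T C by blast
  \<comment> \<open>Variable 17 holds the code of the part of \<open>T\<close> that is not yet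
    decoded; round \<open>i\<close> treats the vertex n - 1 - i.\<close>
  have "?J T (fst ?s 1) (eval (For 3 1 ?c) ?s)"
  proof (rule For_invariant[where I = "?J T"])
    show "?J T 0 (setv 3 0 ?s)" using T n by (simp add: Tn)
    fix i and t :: state assume i: "i < fst ?s 1" and t: "?J T i t" "fst t 3 = i"
    define v where "v = n - 1 - i"
    have v: "v < n" "n - i = Suc v" "n - Suc i = v" using i n by (auto simp: v_def)
    have "weight C v \<le> fst t 17 \<longleftrightarrow> v \<in> T"
      using t(1) code_less[OF T(1), of v] by (auto simp: v code_Int_Suc)
    moreover have "v \<in> C" if "v \<in> T" using T that by blast
    moreover have "fst t 17 = code C (T \<inter> {..<Suc v})" using t v by simp
    moreover have "n - Suc 0 - i = v" by (simp add: v_def)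
    ultimately show "?J T (Suc i) (setv 3 (Suc i) (eval ?c t))"
      using t v C'[OF v(1)] w[OF v(1)] by (auto simp: code_Int_Suc less_Suc_eq_le Suc_le_eq dest: le_neq_implies_less)
  qed simp
  then have "?J T n (eval SELECT s)" using n by (simp add: SELECT_def del: eval.simps(5))
  then show "vset n (eval SELECT s) 27 = T" using Tn by (auto simp: vset_def)
qed

lemma SIZE_correct:
  assumes n: "fst s 1 = n" and S: "S \<subseteq> {..<n}" "\<And>v. v < n \<Longrightarrow> snd s 29 v = of_bool (v \<in> S)"
  shows "fst (eval SIZE s) 19 = card S"
proof -
  let ?I = "\<lambda>i t. fst t 19 = card (S \<inter> {..<i}) \<and> snd t 29 = snd s 29"
  have "?I (fst (setv 19 0 s) 1) (eval (For 3 1 (Assign 19 (Plus (V 19) (Arr 29 (V 3))))) (setv 19 0 s))"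
  proof (rule For_invariant[where I = ?I])
    fix i and t :: state assume "i < fst (setv 19 0 s) 1" "?I i t" "fst t 3 = i"
    then show "?I (Suc i) (setv 3 (Suc i) (eval (Assign 19 (Plus (V 19) (Arr 29 (V 3)))) t))"
      using S(2)[of i] n by (simp add: lessThan_Int_Suc)
  qed simp_all
  then have "?I n (eval SIZE s)" using n by (simp add: SIZE_def del: eval.simps(5))
  moreover have "S \<inter> {..<n} = S" using S by blast
  ultimately show ?thesis by simp
qed

lemma TEST_correct:
  assumes A: "A \<subseteq> {..<n} \<times> {..<n}" and B: "B = inner A" "P = snd ` bridges A" "Q = fst ` bridges A"
    and st: "st n s VV MM {(u, v, w). u < n \<and> v < n \<and> w < n \<and> btw B u v w}"
    and V: "VV 10 = P" "VV 11 = Q" "VV 28 \<union> VV 27 = S" and S: "S \<subseteq> {..<n}"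
  obtains VV' where "st n (eval TEST s) VV' MM {(u, v, w). u < n \<and> v < n \<and> w < n \<and> btw B u v w}"
    "\<And>b. b \<notin> {22, 23, 24, 29} \<Longrightarrow> VV' b = VV b"
    "fst (eval TEST s) 20 = (if {..<n} \<subseteq> cov B P Q S \<and> card S \<le> fst s 2 then 1 else fst s 20)"
proof -
  define T where "T = {(u, v, w). u < n \<and> v < n \<and> w < n \<and> btw B u v w}"
  let ?p = "Disj (Vec 28 3) (Vec 27 3)"
  define s1 where "s1 = eval (VEC 29 ?p) s"
  define s2 where "s2 = eval (vecs (cover_block 29)) s1"
  define s3 where "s3 = setv 18 (fst (eval (Exists (Neg (Vec 24 5))) s2) 7) (eval (Exists (Neg (Vec 24 5))) s2)"
  define s4 where "s4 = eval SIZE s3"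
  note stT = st[folded T_def]
  have vp: "vval n ?p VV MM T = S"
    using V(3) S by (auto simp: vval_def cong: conj_cong)
  have ok: "vok 29 ?p" by (auto simp: vok_def matrices_def)
  have st1: "st n s1 (VV(29 := S)) MM T"
    using st_vval(1)[OF stT ok] by (simp add: s1_def vp)
  have arr1: "v < n \<Longrightarrow> snd s1 29 v = of_bool (v \<in> S)" for v
    using st_vval(2)[OF stT ok] by (simp add: s1_def vp)
  define W where "W = (VV(29 := S))(22 := S \<union> P, 23 := S \<union> Q, 24 := cov B P Q S \<inter> {..<n})"
  have "st n s2 (vrun n MM T (cover_block 29) (VV(29 := S))) MM T"
    unfolding s2_def by (rule st_vecs[OF st1]) (auto simp: cover_block_def vok_def matrices_def)
  moreover have "vrun n MM T (cover_block 29) (VV(29 := S)) = W"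
    unfolding T_def W_def by (rule cover_block[OF A B]) (use V S in auto)
  ultimately have st2: "st n s2 W MM T" by simp
  have arr2: "snd s2 29 = snd s1 29" by (simp add: s2_def eval_wa writes_vecs cover_block_def)
  have n2: "fst s2 1 = n" using st2 by (simp add: st_def framed_def)
  \<comment> \<open>No array is being filled here; 0 merely stands for one that the formula does not
    read.\<close>
  have "fst (eval (Exists (Neg (Vec 24 5))) s2) 7 =
      of_bool (\<exists>x<n. \<exists>y<n. sem (Neg (Vec 24 5)) ((fst s2)(5 := x, 6 := y)) W MM T)"
    by (rule sem_Exists[OF st2, where a = 0]) (use n2 in \<open>auto simp: matrices_def\<close>)
  also have "(\<exists>x<n. \<exists>y<n. sem (Neg (Vec 24 5)) ((fst s2)(5 := x, 6 := y)) W MM T) \<longleftrightarrow> \<not> {..<n} \<subseteq> cov B P Q S"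
    by (auto simp: W_def cong: conj_cong)
  finally have bad: "fst s3 18 = of_bool (\<not> {..<n} \<subseteq> cov B P Q S)" by (simp add: s3_def)
  have arr3: "snd s3 b = snd s2 b" for b by (simp add: s3_def eval_wa)
  have size: "fst s4 19 = card S"
    unfolding s4_def by (rule SIZE_correct[OF _ S]) (use n2 arr1 arr2 arr3 in \<open>auto simp: s3_def eval_wv\<close>)
  have v4: "fst s4 18 = fst s3 18" "fst s4 2 = fst s 2" "fst s4 20 = fst s 20"
  proof -
    have "2 \<notin> wv (vecs (cover_block 29))" "20 \<notin> wv (vecs (cover_block 29))"
      using writes_vecs(1)[of "cover_block 29"] by auto
    then show "fst s4 18 = fst s3 18" "fst s4 2 = fst s 2" "fst s4 20 = fst s 20"
      by (simp_all add: s4_def s3_def s2_def s1_def eval_wv)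
  qed
  have e: "eval TEST s = setv 20 (if {..<n} \<subseteq> cov B P Q S \<and> card S \<le> fst s 2 then 1 else fst s 20) s4"
  proof -
    have "eval TEST s = eval (If (AndE (NotE (V 18)) (LessE (V 19) (Plus (V 2) (N 1)))) (Assign 20 (N 1)) (Assign 20 (V 20))) s4"
      by (simp add: TEST_def s4_def s3_def s2_def s1_def del: eval.simps(4))
    then show ?thesis using bad size v4 by (simp add: less_Suc_eq_le)
  qed
  have "st n (setv 20 x s4) W MM T" for x
  proof -
    have "st n (setv 20 x s4) (\<lambda>b. if b \<in> {} then vset n (setv 20 x s4) b else W b) MM T"
      by (rule st_vector[OF st2]) (auto simp: s4_def s3_def eval_wv eval_wa)
    then show ?thesis by simp
  qed
  then show thesis using that[of W] unfolding e T_def by (simp add: W_def)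
qed

text \<open>Rounds overwrite scratch arrays, so the invariant leaves the abstract contents open and
  fixes only the arrays that later rounds read. Variable 20 is raised to 1 by the first good set and
  never lowered.\<close>

lemma ENUMERATE_correct:
  assumes A: "A \<subseteq> {..<n} \<times> {..<n}" and B: "B = inner A" "P = snd ` bridges A" "Q = fst ` bridges A"
    and st: "st n s VV MM {(u, v, w). u < n \<and> v < n \<and> w < n \<and> btw B u v w}"
    and V: "VV 10 = P" "VV 11 = Q" "VV 20 = C" "VV 28 = D" and C: "C \<subseteq> {..<n}" "D \<subseteq> {..<n}"
    and w: "\<And>v. v < n \<Longrightarrow> snd s 26 v = weight C v" and init: "fst s 20 = 0" "fst s 15 = 2 ^ card C"
  shows "fst (eval (For 16 15 (Seq SELECT TEST)) s) 20 =
    of_bool (\<exists>T\<subseteq>C. {..<n} \<subseteq> cov B P Q (D \<union> T) \<and> card (D \<union> T) \<le> fst s 2)"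
proof -
  define TT where "TT = {(u, v, w). u < n \<and> v < n \<and> w < n \<and> btw B u v w}"
  define good where "good T \<longleftrightarrow> {..<n} \<subseteq> cov B P Q (D \<union> T) \<and> card (D \<union> T) \<le> fst s 2" for T
  define I where "I i t \<longleftrightarrow> (\<exists>VV MM. st n t VV MM TT \<and> VV 10 = P \<and> VV 11 = Q \<and> VV 20 = C \<and> VV 28 = D) \<and>
     (\<forall>v<n. snd t 26 v = weight C v) \<and> fst t 2 = fst s 2 \<and> fst t 20 \<le> 1 \<and>
     (fst t 20 = 1 \<longrightarrow> (\<exists>T\<subseteq>C. good T)) \<and> (\<forall>T\<subseteq>C. code C T < i \<longrightarrow> good T \<longrightarrow> fst t 20 = 1)" for i t
  have "I (fst s 15) (eval (For 16 15 (Seq SELECT TEST)) s)"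
  proof (rule For_invariant[where I = I])
    show "16 \<notin> wv (Seq SELECT TEST)" using writes_TEST(1) by auto
    show "I 0 (setv 16 0 s)" unfolding I_def using st V w init by (auto simp: TT_def)
    fix i t assume It: "I i t" and i: "fst t 16 = i"
    obtain V1 M1 where t: "st n t V1 M1 TT" "V1 10 = P" "V1 11 = Q" "V1 20 = C" "V1 28 = D"
      "\<And>v. v < n \<Longrightarrow> snd t 26 v = weight C v" "fst t 2 = fst s 2" "fst t 20 \<le> 1"
      "fst t 20 = 1 \<longrightarrow> (\<exists>T\<subseteq>C. good T)" "\<And>T. T \<subseteq> C \<Longrightarrow> code C T < i \<Longrightarrow> good T \<Longrightarrow> fst t 20 = 1"
      using It unfolding I_def by (elim exE conjE) simp
    define t1 where "t1 = eval SELECT t"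
    define T where "T = vset n t1 27"
    have n: "fst t 1 = n" and V20: "vset n t 20 = C" using t by (auto simp: st_def framed_def matrices_def)
    have T: "T \<subseteq> C" unfolding T_def t1_def by (rule SELECT_correct(1)[OF n V20 C(1) t(6)])
    have T': "U = T" if "U \<subseteq> C" "code C U = i" for U
      unfolding T_def t1_def using SELECT_correct(2)[OF n V20 C(1) t(6)] that i by simp
    have "st n t1 (\<lambda>b. if b \<in> {27} then vset n t1 b else V1 b) M1 TT"
      by (rule st_vector[OF t(1)]) (auto simp: t1_def eval_wv eval_wa matrices_def)
    then obtain V2 where V2: "st n (eval TEST t1) V2 M1 TT"
      "\<And>b. b \<notin> {22, 23, 24, 29} \<Longrightarrow> V2 b = (if b \<in> {27} then vset n t1 b else V1 b)"
      "fst (eval TEST t1) 20 = (if {..<n} \<subseteq> cov B P Q (D \<union> T) \<and> card (D \<union> T) \<le> fst t1 2 then 1 else fst t1 20)"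
      unfolding TT_def by (rule TEST_correct[OF A B, where S = "D \<union> T"]) (use t T C in \<open>auto simp: T_def\<close>)
    have "fst t1 2 = fst s 2" "fst t1 20 = fst t 20" using t by (simp_all add: t1_def eval_wv)
    then have f: "fst (eval TEST t1) 20 = (if good T then 1 else fst t 20)" using V2(3) by (simp add: good_def)
    have "fst (eval TEST t1) 2 = fst s 2" using t writes_TEST(1) by (subst eval_wv) (auto simp: t1_def eval_wv)
    moreover have "snd (eval TEST t1) 26 = snd t 26" by (simp add: t1_def eval_wa writes_TEST)
    moreover have "fst (eval TEST t1) 20 = 1" if "U \<subseteq> C" "code C U < Suc i" "good U" for U
      using t(10)[OF that(1) _ that(3)] T'[OF that(1)] that f by (auto simp: less_Suc_eq)
    ultimately show "I (Suc i) (setv 16 (Suc i) (eval (Seq SELECT TEST) t))"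
      unfolding I_def using V2(1,2) t T f by (auto simp: t1_def[symmetric] split: if_splits)
  qed
  moreover have "code C T < 2 ^ card C" if "T \<subseteq> C" for T
  proof -
    have "T \<inter> {..<n} = T" "C \<inter> {..<n} = C" using that C by auto
    then show ?thesis using code_less[OF that, of n] by (simp add: weight_def)
  qed
  ultimately have "fst (eval (For 16 15 (Seq SELECT TEST)) s) 20 = of_bool (\<exists>T\<subseteq>C. good T)"
    unfolding I_def init by (auto simp: le_Suc_eq)
  then show ?thesis by (simp add: good_def)
qed

lemma writes_PREPARE: "1 \<notin> wv PREPARE" "2 \<notin> wv PREPARE" "lv PREPARE \<subseteq> {1}"
  using writes_LABELS by (auto simp: PREPARE_def)

lemma PREPARE_correct:
  assumes g: "distinct as" "digraph n (set as)"
    and s: "fst s 1 = n" "fst s 31 = 1024 * max 1 (length as)"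
      "\<And>j. j < 1024 * max 1 (length as) \<Longrightarrow> j \<noteq> 2 \<Longrightarrow> snd s 0 j = input_mem n k as j"
    and B: "B = inner (set as)" "P = snd ` bridges (set as)" "Q = fst ` bridges (set as)"
  obtains VV MM where
    "st n (eval PREPARE s) VV MM {(u, v, w). u < n \<and> v < n \<and> w < n \<and> btw B u v w}"
    "VV 10 = P" "VV 11 = Q" "VV 20 = candidates B P Q" "VV 28 = forced {..<n} B P Q \<union> picks {..<n} B P Q"
    "\<And>v. v < n \<Longrightarrow> snd (eval PREPARE s) 26 v = weight (candidates B P Q) v"
    "fst (eval PREPARE s) 20 = 0" "fst (eval PREPARE s) 15 = 2 ^ card (candidates B P Q)"
proof -
  have A: "set as \<subseteq> {..<n} \<times> {..<n}" using g(2) by (auto simp: digraph_def)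
  define s1 where "s1 = eval ARCS s"
  define s2 where "s2 = eval BRIDGES s1"
  define s3 where "s3 = eval LABELS s2"
  define s4 where "s4 = eval WEIGHTS s3"
  obtain V1 M1 T1 where st1: "st n s1 V1 M1 T1" "M1 3 = set as"
    using ARCS_correct[OF g s] unfolding s1_def .
  obtain M2 T2 where st2: "st n s2 V1 M2 T2" "M2 3 = set as" "M2 8 = B"
    using BRIDGES_correct[OF st1] unfolding s2_def B by blast
  obtain V3 M3 where st3: "st n s3 V3 M3 {(u, v, w). u < n \<and> v < n \<and> w < n \<and> btw B u v w}"
    "V3 10 = P" "V3 11 = Q" "V3 20 = candidates B P Q" "V3 28 = forced {..<n} B P Q \<union> picks {..<n} B P Q"
    using LABELS_correct[OF A B st2] unfolding s3_def by blast
  have n3: "fst s3 1 = n" "vset n s3 20 = candidates B P Q"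
    using st3 by (auto simp: st_def framed_def matrices_def)
  then have C: "candidates B P Q \<subseteq> {..<n}" by (auto simp: vset_def)
  note w = WEIGHTS_correct[OF n3 C, folded s4_def]
  have "st n s4 (\<lambda>b. if b \<in> {26} then vset n s4 b else V3 b) M3 {(u, v, w). u < n \<and> v < n \<and> w < n \<and> btw B u v w}"
    by (rule st_vector[OF st3(1)]) (auto simp: s4_def eval_wv eval_wa matrices_def)
  moreover have "eval PREPARE s = setv 20 0 s4" by (simp add: PREPARE_def s4_def s3_def s2_def s1_def)
  ultimately show thesis using that[of "\<lambda>b. if b \<in> {26} then vset n s4 b else V3 b" M3] st3 w by simp
qed

section \<open>The program as a whole and its running time\<close>

lemma cwf_VEC: "awf (cf p) 32 \<Longrightarrow> a < 32 \<Longrightarrow> cwf (VEC a p)"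
  by (simp add: VEC_def Exists_def)

lemma cwf_MAT: "awf (cf p) 32 \<Longrightarrow> a < 32 \<Longrightarrow> cwf (MAT a p)"
  by (simp add: MAT_def Exists_def ix_def)

lemma cwf_RTC: "a < 32 \<Longrightarrow> cwf (RTC a)"
  by (simp add: RTC_def ACC_def ix_def cwf_MAT NotE_def AndE_def EqE_def)

lemma cwf_SOLVE: "cwf SOLVE"
proof -
  note expr = ix_def NotE_def AndE_def LessE_def EqE_def
  have "cwf INIT" by (simp add: INIT_def)
  moreover have "cwf ARCS" by (simp add: ARCS_def ROWS_def READ_def cwf_MAT expr)
  moreover have "cwf BRIDGES" by (simp add: BRIDGES_def cwf_MAT cwf_RTC expr)
  moreover have "cwf LABELS"
    by (simp add: LABELS_def CLASSES_def cwf_MAT cwf_RTC cwf_VEC vertex_block_def candidate_block_def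
        cover_block_def pick_block_def expr)
  moreover have "cwf WEIGHTS" by (simp add: WEIGHTS_def)
  moreover have "cwf SELECT" by (simp add: SELECT_def expr)
  moreover have "cwf TEST"
    by (simp add: TEST_def SIZE_def cwf_VEC cover_block_def Exists_def expr)
  ultimately show ?thesis
    using writes_TEST(1) by (auto simp: SOLVE_def PREPARE_def expr)
qed

lemma SOLVE_output:
  assumes g: "distinct as" "digraph n (set as)"
    and s: "fst s 31 = 1024 * max 1 (length as)"
      "\<And>j. j < 1024 * max 1 (length as) \<Longrightarrow> j \<noteq> 2 \<Longrightarrow> snd s 0 j = input_mem n k as j"
  shows "fst (eval SOLVE s) 0 = of_bool (has_geodetic_set_of_size n (set as) k)"
    and "cost SOLVE s \<le> 40 + length (acomp (AndE (V 20) (LessE (V 2) (Plus (V 1) (N 1)))) 32) + bnd PREPARE n +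
      2 ^ card (candidates (inner (set as)) (snd ` bridges (set as)) (fst ` bridges (set as))) *
        (6 + bnd (Seq SELECT TEST) n)"
proof -
  define A where "A = set as"
  define B P Q where "B = inner A" and "P = snd ` bridges A" and "Q = fst ` bridges A"
  define C where "C = candidates B P Q"
  define D where "D = forced {..<n} B P Q \<union> picks {..<n} B P Q"
  have A: "A \<subseteq> {..<n} \<times> {..<n}" "\<And>x. (x, x) \<notin> A" using g(2) by (auto simp: digraph_def A_def)
  interpret geodetic_instance "{..<n}" B P Q
    by unfold_locales (use A in \<open>auto simp: B_def\<close>)
  define s1 where "s1 = eval INIT s"
  define s2 where "s2 = eval PREPARE s1"
  define s3 where "s3 = eval (For 16 15 (Seq SELECT TEST)) s2"
  have "snd s 0 0 = n" "snd s 0 1 = k" using s(2)[of 0] s(2)[of 1] by (auto simp: input_mem_def)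
  then have s1: "fst s1 1 = n" "fst s1 2 = k" "fst s1 31 = fst s 31" "snd s1 = snd s"
    by (simp_all add: s1_def INIT_def)
  obtain VV MM where prep:
    "st n s2 VV MM {(u, v, w). u < n \<and> v < n \<and> w < n \<and> btw B u v w}"
    "VV 10 = P" "VV 11 = Q" "VV 20 = C" "VV 28 = D"
    "\<And>v. v < n \<Longrightarrow> snd s2 26 v = weight C v" "fst s2 20 = 0" "fst s2 15 = 2 ^ card C"
    using PREPARE_correct[OF g s1(1), of k B P Q] s s1(3,4)
    unfolding s2_def B_def P_def Q_def C_def D_def A_def by auto
  have CD: "C \<subseteq> {..<n}" "D \<subseteq> {..<n}" using sets_subset by (auto simp: C_def D_def)
  have s2: "fst s2 2 = k" using s1 writes_PREPARE by (simp add: s2_def eval_wv)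
  have "fst s3 20 = of_bool (\<exists>T\<subseteq>C. {..<n} \<subseteq> cov B P Q (D \<union> T) \<and> card (D \<union> T) \<le> k)"
    unfolding s3_def using ENUMERATE_correct[OF A(1) B_def P_def Q_def prep(1-5) CD prep(6-8)] s2 by simp
  also have "(\<exists>T\<subseteq>C. {..<n} \<subseteq> cov B P Q (D \<union> T) \<and> card (D \<union> T) \<le> k) \<longleftrightarrow>
      (\<exists>S\<subseteq>{..<n}. feasible {..<n} B P Q S \<and> card S \<le> k)"
    using optimum_from_candidates[of k] by (simp add: C_def D_def feasible_cov)
  also have "\<dots> \<longleftrightarrow> (\<exists>S\<subseteq>{0..<n}. feasible {0..<n} A {} {} S \<and> card S \<le> k)"
    unfolding B_def P_def Q_def
    using feasible_inner[of A "{..<n}"] A finite_subset[OF A(1)] by (simp add: lessThan_atLeast0)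
  finally have found: "fst s3 20 = of_bool (\<exists>S\<subseteq>{0..<n}. feasible {0..<n} A {} {} S \<and> card S \<le> k)" .
  have "fst s3 1 = fst s2 1" "fst s3 2 = fst s2 2"
    unfolding s3_def using writes_TEST(1) by (intro eval_wv; auto)+
  then have s3: "fst s3 1 = n" "fst s3 2 = k" using s1 s2 writes_PREPARE by (simp_all add: s2_def eval_wv)
  have and_bool: "aval (AndE e f) t = of_bool (0 < aval e t \<and> 0 < aval f t)" for e f t
    by (auto simp: AndE_def NotE_def)
  have "eval SOLVE s = eval (Assign 0 (AndE (V 20) (LessE (V 2) (Plus (V 1) (N 1))))) s3"
    by (simp add: SOLVE_def s3_def s2_def s1_def del: eval.simps(5))
  then have "fst (eval SOLVE s) 0 = of_bool (0 < fst s3 20 \<and> k < Suc n)"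
    using s3 by (simp add: and_bool)
  then show "fst (eval SOLVE s) 0 = of_bool (has_geodetic_set_of_size n (set as) k)"
    using has_geodetic_set_of_size_feasible[of A n k] A(1) found
    by (auto simp: A_def lessThan_atLeast0 less_Suc_eq_le)
  \<comment> \<open>Only the enumeration is counted by hand, as \<open>2 ^ card C\<close> rounds of
    a polynomially bounded body; in all other loops the limit is n and \<open>bnd\<close>
    applies.\<close>
  let ?l = "length (acomp (AndE (V 20) (LessE (V 2) (Plus (V 1) (N 1)))) 32)"
  let ?f = "\<lambda>s. setv 16 (Suc (fst s 16)) (eval (Seq SELECT TEST) s)"
  have "cost PREPARE s1 \<le> bnd PREPARE n"
    using writes_PREPARE s1 by (intro cost_le_bnd) auto
  moreover have "cost (Seq SELECT TEST) ((?f ^^ i) (setv 16 0 s2)) \<le> bnd (Seq SELECT TEST) n" for i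
  proof -
    have "fst ((?f ^^ i) (setv 16 0 s2)) 1 = n"
    proof (induction i)
      case 0
      then show ?case using s1 writes_PREPARE by (simp add: s2_def eval_wv)
    next
      case (Suc i)
      have "1 \<notin> wv TEST" using writes_TEST(1) by auto
      then show ?case using Suc by (simp add: eval_wv)
    qed
    then show ?thesis using writes_TEST by (intro cost_le_bnd) auto
  qed
  then have "(\<Sum>i<fst s2 15. 2 + cost (Seq SELECT TEST) ((?f ^^ i) (setv 16 0 s2)) + 4) \<le>
      fst s2 15 * (6 + bnd (Seq SELECT TEST) n)"
    by (intro order_trans[OF sum_bounded_above[where K = "6 + bnd (Seq SELECT TEST) n"]])
      (auto simp del: cost.simps bnd.simps simp: add.commute)
  then have "cost (For 16 15 (Seq SELECT TEST)) s2 \<le> 3 + 2 ^ card C * (6 + bnd (Seq SELECT TEST) n)"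
    unfolding cost.simps(5) prep(8) by simp
  \<comment> \<open>The allowance of 40 covers these 24 steps, 3 for the overhead of the loop and 2
    for the last assignment.\<close>
  moreover have "cost INIT s = 24" by (simp add: INIT_def)
  moreover have "cost SOLVE s = cost INIT s + (cost PREPARE s1 + (cost (For 16 15 (Seq SELECT TEST)) s2 + (?l + 2)))"
    by (simp add: SOLVE_def s2_def s1_def del: cost.simps(5) eval.simps(5))
  ultimately show "cost SOLVE s \<le> 40 + ?l + bnd PREPARE n +
      2 ^ card (candidates (inner (set as)) (snd ` bridges (set as)) (fst ` bridges (set as))) *
        (6 + bnd (Seq SELECT TEST) n)"
    unfolding C_def B_def P_def Q_def A_def by linarith
qed

theorem theorem2:
  "\<exists>(P :: instr list) (c :: nat).
     \<forall>(n :: nat) (k :: nat) (as :: (nat \<times> nat) list).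
       distinct as \<and> digraph n (set as) \<and> no_2cycle (set as) \<longrightarrow>
       (\<exists>t. t \<le> c * 2 ^ (c * feedback_edge_set_number (underlying_edges (set as))) * (n + 2) ^ c \<and>
            halted P (run P t (0, input_mem n k as)) \<and>
            snd (run P t (0, input_mem n k as)) 0 =
              (if has_geodetic_set_of_size n (set as) k then 1 else 0))"
proof -
  obtain K1 d1 where pre: "\<And>B. bnd PREPARE B \<le> K1 * (B + 2) ^ d1" using bnd_polynomial[of PREPARE] by blast
  obtain K2 d2 where body: "\<And>B. bnd (Seq SELECT TEST) B \<le> K2 * (B + 2) ^ d2"
    using bnd_polynomial[of "Seq SELECT TEST"] by blast
  define l where "l = length (acomp (AndE (V 20) (LessE (V 2) (Plus (V 1) (N 1)))) 32)"
  \<comment> \<open>\<open>d\<close> dominates the exponents \<open>d1\<close>, \<open>d2\<close>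
    and the 2 from the at most n^2 arcs. A single \<open>c\<close> has to serve as a factor and in
    both exponents, so it sums up all coefficients, 24 and \<open>d\<close>.\<close>
  define d where "d = d1 + d2 + 2"
  define c where "c = 8192 + (8192 + 540 + 40 + l) + K1 + 6 + K2 + 24 + d"
  have "\<exists>t. t \<le> c * 2 ^ (c * feedback_edge_set_number (underlying_edges (set as))) * (n + 2) ^ c \<and>
            halted (machine SOLVE) (run (machine SOLVE) t (0, input_mem n k as)) \<and>
            snd (run (machine SOLVE) t (0, input_mem n k as)) 0 =
              (if has_geodetic_set_of_size n (set as) k then 1 else 0)"
    if g: "distinct as" "digraph n (set as)" "no_2cycle (set as)" for n k as
  proof -
    let ?fen = "feedback_edge_set_number (underlying_edges (set as))"
    have A: "set as \<subseteq> {0..<n} \<times> {0..<n}" "\<And>x. (x, x) \<notin> set as" using g(2) by (auto simp: digraph_def)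
    obtain s t where run: "fst s 31 = 1024 * max 1 (length as)"
      "\<And>j. j < 1024 * max 1 (length as) \<Longrightarrow> j \<noteq> 2 \<Longrightarrow> snd s 0 j = input_mem n k as j"
      "t \<le> 8192 * (length as + 1) + 540 + cost SOLVE s"
      "halted (machine SOLVE) (run (machine SOLVE) t (0, input_mem n k as))"
      "snd (run (machine SOLVE) t (0, input_mem n k as)) 0 = fst (eval SOLVE s) 0"
      by (rule machine_correct[OF cwf_SOLVE, of as n k]) blast
    let ?C = "candidates (inner (set as)) (snd ` bridges (set as)) (fst ` bridges (set as))"
    have out: "fst (eval SOLVE s) 0 = of_bool (has_geodetic_set_of_size n (set as) k)"
      "cost SOLVE s \<le> 40 + l + bnd PREPARE n + 2 ^ card ?C * (6 + bnd (Seq SELECT TEST) n)"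
      using SOLVE_output[OF g(1,2) run(1)] run(2) unfolding l_def by blast+
    \<comment> \<open>The common unit: each summand of the running time is at most a constant times
      \<open>E\<close>.\<close>
    define E where "E = 2 ^ (24 * ?fen) * (n + 2) ^ d"
    have pow: "(n + 2) ^ i \<le> (n + 2) ^ d" if "i \<le> d" for i using that by (intro power_increasing) auto
    have one: "(1::nat) \<le> 2 ^ (24 * ?fen)" by simp
    have E: "X * (n + 2) ^ i \<le> X * E" if "i \<le> d" for X i
      unfolding E_def using mult_le_mono[OF one pow[OF that]] by simp
    have "length as \<le> n * n" using distinct_arcs_length g A by blast
    also have "n * n \<le> (n + 2) ^ 2" by (simp add: power2_eq_square)
    finally have t1: "8192 * length as \<le> 8192 * E" using E[of 2 8192] by (simp add: d_def)
    have t2: "8192 + 540 + 40 + l \<le> (8192 + 540 + 40 + l) * E"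
      using E[of 0 "8192 + 540 + 40 + l"] by simp
    have t3: "bnd PREPARE n \<le> K1 * E" by (rule order_trans[OF pre E]) (simp add: d_def)
    have t4: "2 ^ card ?C * (6 + bnd (Seq SELECT TEST) n) \<le> 6 * E + K2 * E"
    proof -
      have "(2::nat) ^ card ?C \<le> 2 ^ (24 * ?fen)"
        by (intro power_increasing card_candidates) (use A g(3) in auto)
      moreover have "6 + bnd (Seq SELECT TEST) n \<le> (6 + K2) * (n + 2) ^ d"
      proof -
        have "K2 * (n + 2) ^ d2 \<le> K2 * (n + 2) ^ d" by (intro mult_left_mono pow) (simp_all add: d_def)
        moreover have "6 \<le> 6 * (n + 2) ^ d" by simp
        ultimately show ?thesis using body[of n] unfolding add_mult_distrib by linarith
      qed
      ultimately have "2 ^ card ?C * (6 + bnd (Seq SELECT TEST) n) \<le>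
          2 ^ (24 * ?fen) * ((6 + K2) * (n + 2) ^ d)" by (rule mult_le_mono)
      also have "\<dots> = 6 * E + K2 * E" by (simp add: E_def algebra_simps)
      finally show ?thesis .
    qed
    define q where "q = 2 ^ card ?C * (6 + bnd (Seq SELECT TEST) n)"
    have "t \<le> 8192 * length as + (8192 + 540 + 40 + l) + bnd PREPARE n + q"
      using run(3) out(2)[folded q_def] by simp
    also have "\<dots> \<le> 8192 * E + (8192 + 540 + 40 + l) * E + K1 * E + (6 * E + K2 * E)"
      by (intro add_mono t1 t2 t3 t4[folded q_def])
    also have "\<dots> = (8192 + (8192 + 540 + 40 + l) + K1 + 6 + K2) * E" by (simp add: algebra_simps)
    also have "\<dots> \<le> c * E" by (intro mult_right_mono) (auto simp: c_def)
    also have "\<dots> \<le> c * (2 ^ (c * ?fen) * (n + 2) ^ c)"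
      unfolding E_def by (intro mult_left_mono mult_le_mono power_increasing mult_right_mono) (auto simp: c_def)
    finally have "t \<le> c * 2 ^ (c * ?fen) * (n + 2) ^ c" by (simp add: mult.assoc)
    then show ?thesis using run(4,5) out(1) by (intro exI[of _ t]) auto
  qed
  then show ?thesis by blast
qed

end
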